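(* Let $m\ge1$ be an integer, and let $(\Phi^{(m)}_{i,j})_{i,j\ge0}$ be the integer matrix defined recursively in the context. The map $$\Phi_m\colon\mathbb{Z}^{\mathbb{N}_0}\to\mathrm{Mom}^{\mathrm{Euler}}_{\ge 2m}\subseteq\mathbb{Z}^{\mathbb{N}_{\ge2m}},\qquad (l_i)_{i\ge0}\mapsto\Big(\sum_{j\ge0}\Phi^{(m)}_{k-2m,j}\,l_j\Big)_{k\ge2m}$$ is a well-defined isomorphism of groups.
   Context: For a prime $p$, $\mathrm{Meas}(\mathbb{Z}_p^*/\{\pm1\},\mathbb{Z}_p)$ is the set of $\mathbb{Z}_p$-linear maps $\mu\colon C(\mathbb{Z}_p^*/\{\pm1\},\mathbb{Z}_p)\to\mathbb{Z}_p$ on continuous functions; $\int f\,d\mu:=\mu(f)$. $\mathrm{Mom}^{\mathrm{Euler}}_{\ge2m}$ is the group (under addition) of integer sequences $(b_k)_{k\ge2m}$ with $b_{2k+1}=0$ for $k\ge m$ and such that for every prime $p$ there is $\mu_p\in\mathrm{Meas}(\mathbb{Z}_p^*/\{\pm1\},\mathbb{Z}_p)$ with $\int x^{2k}\,d\mu_p(x)=(1-p^{2k-1})b_{2k}$ for all $k\ge m$. Polynomials: for a prime $p$ and $a\in\mathbb{Z}/p^j\mathbb{Z}$ let $\tilde a$ be the unique integer lift in $\{-\lfloor p^j/2\rfloor,\dots,p^j-1-\lfloor p^j/2\rfloor\}$. Put $e_0^{(p)}:=X$, and $e_j^{(p)}:=\frac{1}{(p^j)!}\prod_{a\in(\mathbb{Z}/p^j\mathbb{Z})^\times}(X-\tilde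 a)$ for $j\ge1$. Each $n\ge0$ is uniquely $n=a_0+\sum_{j\ge1}a_j\varphi(p^j)$ with $0\le a_0\le p-2$, $0\le a_j\le p-1$ ($j\ge1$); put $E_n^{(p)}:=\prod_{j\ge0}(e_j^{(p)})^{a_j}$. For $k\ge0$, let $1/C_p(k)$ be the leading coefficient of $E^{(p)}_{2k}$, i.e. $C_p(k)=\prod_{i\ge0}(p^i!)^{a_i}$ where the $a_i$ are the digits of $2k$, and let the integers $c^{(k,p)}_{2i}$ ($0\le i<k$) be determined by $C_p(k)E^{(p)}_{2k}(X)=X^{2k}-\sum_{i=0}^{k-1}c^{(k,p)}_{2i}X^{2i}$. $v_p$ is the $p$-adic valuation. Matrix $\Phi^{(m)}$: $\Phi^{(m)}_{0,*}:=(1,0,0,\dots)$ and $\Phi^{(m)}_{2k+1,*}:=(0,0,0,\dots)$ for all $k\ge0$. For $k>0$, suppose the rows $\Phi^{(m)}_{i,*}$ with $i<2k$ are defined, and let $S_k:=\{p\text{ prime}\mid p-1\le2k\}$. For $0\le j<k$, $\Phi^{(m)}_{2k,j}$ is the unique integer with $0\le\Phi^{(m)}_{2k,j}<\prod_{p\in S_k}p^{v_p(C_p(k))}$ satisfying $$(1-p^{2(k+m)-1})\Phi^{(m)}_{2k,j}\equiv\sum_{i=0}^{k-1}c^{(k,p)}_{2i}(1-p^{2(i+m)-1})\Phi^{(m)}_{2i,j}\mod p^{v_p(C_p(k))}\quad\text{for all }p\in S_k$$ (existence and uniqueness by the Chinese remainder theorem). Further $\Phi^{(m)}_{2k,k}:=\prod_{p\in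 S_k}p^{v_p(C_p(k))}$ and $\Phi^{(m)}_{2k,j}:=0$ for $j>k$. *)

theory Defs
  imports
    "HOL-Analysis.Analysis"
    "HOL-Algebra.Product_Groups"
    "HOL-Number_Theory.Number_Theory"
    "HOL-Library.Groups_Big_Fun"
begin

subsection \<open>The p-adic integers\<close>

text \<open>
  A p-adic integer is a coherent sequence of residues, its \<open>n\<close>-th entry being the canonical
  representative modulo \<open>p ^ n\<close>: the ring is the inverse limit of the rings of integers
  modulo \<open>p ^ n\<close>. The identity is reduced because modulo \<open>p ^ 0\<close> it is \<open>0\<close>.
\<close>

definition padic_ints :: "nat \<Rightarrow> (nat \<Rightarrow> int) ring" where
  "padic_ints p =
     \<lparr>carrier = {x. \<forall>n. x n \<in> {0..<int p ^ n} \<and> x (Suc n) mod int p ^ n = x n},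
      monoid.mult = (\<lambda>x y n. x n * y n mod int p ^ n),
      monoid.one = (\<lambda>n. 1 mod int p ^ n),
      ring.zero = (\<lambda>n. 0),
      ring.add = (\<lambda>x y n. (x n + y n) mod int p ^ n)\<rparr>"

definition padic_of_int :: "nat \<Rightarrow> int \<Rightarrow> nat \<Rightarrow> int" where
  "padic_of_int p a = (\<lambda>n. a mod int p ^ n)"

text \<open>The inverse limit topology, every residue ring being discrete.\<close>

definition padic_topology :: "nat \<Rightarrow> (nat \<Rightarrow> int) topology" where
  "padic_topology p =
     subtopology (product_topology (\<lambda>n. discrete_topology UNIV) UNIV) (carrier (padic_ints p))"

lemma topspace_padic_topology [simp]: "topspace (padic_topology p) = carrier (padic_ints p)"
  by (simp add: padic_topology_def)

lemma padic_ints_carrier_iff: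
  "x \<in> carrier (padic_ints p) \<longleftrightarrow>
     (\<forall>n. 0 \<le> x n \<and> x n < int p ^ n \<and> x (Suc n) mod int p ^ n = x n)"
  by (simp add: padic_ints_def)

lemma mod_pow_Suc: "a mod int p ^ Suc n mod int p ^ n = a mod int p ^ n"
  by (rule mod_mod_cancel) simp

lemma padic_of_int_carrier: "p > 0 \<Longrightarrow> padic_of_int p a \<in> carrier (padic_ints p)"
  unfolding padic_ints_carrier_iff padic_of_int_def by (simp only: mod_pow_Suc) simp

lemma cring_padic_ints:
  assumes "p > 0"
  shows "cring (padic_ints p)"
proof (rule cringI)
  have coh: "x (Suc n) mod int p ^ n = x n" if "x \<in> carrier (padic_ints p)" for x n
    using that by (simp add: padic_ints_carrier_iff)
  have red: "x n mod int p ^ n = x n" if "x \<in> carrier (padic_ints p)" for x n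
    using that by (simp add: padic_ints_carrier_iff)
  have add_closed: "x \<oplus>\<^bsub>padic_ints p\<^esub> y \<in> carrier (padic_ints p)"
    if "x \<in> carrier (padic_ints p)" "y \<in> carrier (padic_ints p)" for x y
  proof -
    have "(x (Suc n) + y (Suc n)) mod int p ^ n = (x n + y n) mod int p ^ n" for n
      using coh[OF that(1), of n] coh[OF that(2), of n] by (metis mod_add_eq)
    then show ?thesis
      using assms unfolding padic_ints_carrier_iff
      by (simp add: padic_ints_def mod_pow_Suc del: power_Suc)
  qed
  have mult_closed: "x \<otimes>\<^bsub>padic_ints p\<^esub> y \<in> carrier (padic_ints p)"
    if "x \<in> carrier (padic_ints p)" "y \<in> carrier (padic_ints p)" for x y
  proof -
    have "(x (Suc n) * y (Suc n)) mod int p ^ n = (x n * y n) mod int p ^ n" for n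
      using coh[OF that(1), of n] coh[OF that(2), of n] by (metis mod_mult_eq)
    then show ?thesis
      using assms unfolding padic_ints_carrier_iff
      by (simp add: padic_ints_def mod_pow_Suc del: power_Suc)
  qed
  have one: "\<one>\<^bsub>padic_ints p\<^esub> = padic_of_int p 1"
    by (simp add: padic_ints_def padic_of_int_def)
  have zero: "\<zero>\<^bsub>padic_ints p\<^esub> = padic_of_int p 0"
    by (simp add: padic_ints_def padic_of_int_def)
  show "abelian_group (padic_ints p)"
  proof (rule abelian_groupI)
    fix x assume x: "x \<in> carrier (padic_ints p)"
    define y where "y = (\<lambda>n. (- x n) mod int p ^ n)"
    have "(- x (Suc n)) mod int p ^ n = (- x n) mod int p ^ n" for n
      using coh[OF x, of n] by (metis mod_minus_eq)
    then have "y \<in> carrier (padic_ints p)"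
      using assms unfolding padic_ints_carrier_iff y_def
      by (simp add: mod_pow_Suc del: power_Suc)
    moreover have "y \<oplus>\<^bsub>padic_ints p\<^esub> x = \<zero>\<^bsub>padic_ints p\<^esub>"
      by (simp add: y_def padic_ints_def mod_simps)
    ultimately show "\<exists>y\<in>carrier (padic_ints p). y \<oplus>\<^bsub>padic_ints p\<^esub> x = \<zero>\<^bsub>padic_ints p\<^esub>"
      by blast
    show "\<zero>\<^bsub>padic_ints p\<^esub> \<oplus>\<^bsub>padic_ints p\<^esub> x = x"
      using red[OF x] by (simp add: padic_ints_def)
  qed (use add_closed assms in \<open>auto simp: zero padic_of_int_carrier\<close>,
       auto simp: padic_ints_def mod_simps algebra_simps)
  show "comm_monoid (padic_ints p)"
  proof (rule comm_monoidI)
    fix x assume x: "x \<in> carrier (padic_ints p)"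
    show "\<one>\<^bsub>padic_ints p\<^esub> \<otimes>\<^bsub>padic_ints p\<^esub> x = x"
      using red[OF x] by (simp add: padic_ints_def mod_simps)
  qed (use mult_closed assms in \<open>auto simp: one padic_of_int_carrier\<close>,
       auto simp: padic_ints_def mod_simps algebra_simps)
qed (auto simp: padic_ints_def mod_simps algebra_simps)


subsection \<open>The space of units modulo sign, and measures on it\<close>

definition quotient_topology :: "'a topology \<Rightarrow> ('a \<Rightarrow> 'b) \<Rightarrow> 'b topology" where
  "quotient_topology T q =
     topology (\<lambda>U. U \<subseteq> q ` topspace T \<and> openin T {x \<in> topspace T. q x \<in> U})"

lemma openin_quotient_topology:
  "openin (quotient_topology T q) U \<longleftrightarrow>
     U \<subseteq> q ` topspace T \<and> openin T {x \<in> topspace T. q x \<in> U}"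
proof -
  have "istopology (\<lambda>U. U \<subseteq> q ` topspace T \<and> openin T {x \<in> topspace T. q x \<in> U})"
    unfolding istopology_def
  proof (intro conjI allI impI; (elim conjE)?)
    fix V W assume "openin T {x \<in> topspace T. q x \<in> V}" "openin T {x \<in> topspace T. q x \<in> W}"
    then have "openin T ({x \<in> topspace T. q x \<in> V} \<inter> {x \<in> topspace T. q x \<in> W})"
      by blast
    then show "openin T {x \<in> topspace T. q x \<in> V \<inter> W}"
      by (rule back_subst[of "openin T"]) auto
  next
    fix \<K> assume "\<forall>K\<in>\<K>. K \<subseteq> q ` topspace T \<and> openin T {x \<in> topspace T. q x \<in> K}"
    then have "openin T (\<Union>K\<in>\<K>. {x \<in> topspace T. q x \<in> K})"
      by blast
    then show "openin T {x \<in> topspace T. q x \<in> \<Union> \<K>}"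
      by (rule back_subst[of "openin T"]) auto
  qed auto
  then show ?thesis
    by (simp add: quotient_topology_def)
qed

lemma topspace_quotient_topology [simp]: "topspace (quotient_topology T q) = q ` topspace T"
proof -
  have "{x \<in> topspace T. q x \<in> q ` topspace T} = topspace T"
    by auto
  then have "openin (quotient_topology T q) (q ` topspace T)"
    by (simp add: openin_quotient_topology)
  then show ?thesis
    by (meson openin_quotient_topology openin_subset openin_topspace subset_antisym)
qed

lemma quotient_map_quotient_topology: "quotient_map T (quotient_topology T q) q"
  by (simp add: quotient_map_def openin_quotient_topology)

text \<open>The points of the quotient are the orbits \<open>{x, -x}\<close> of units.\<close>

definition units_mod_sign :: "nat \<Rightarrow> (nat \<Rightarrow> int) set topology" where
  "units_mod_sign p =
     quotient_topology (subtopology (padic_topology p) (Units (padic_ints p)))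
       (\<lambda>x. {x, \<ominus>\<^bsub>padic_ints p\<^esub> x})"

definition cont_functions :: "nat \<Rightarrow> ((nat \<Rightarrow> int) set \<Rightarrow> nat \<Rightarrow> int) set" where
  "cont_functions p =
     {f. continuous_map (units_mod_sign p) (padic_topology p) f \<and>
         f \<in> extensional (topspace (units_mod_sign p))}"

definition meas :: "nat \<Rightarrow> (((nat \<Rightarrow> int) set \<Rightarrow> nat \<Rightarrow> int) \<Rightarrow> nat \<Rightarrow> int) set" where
  "meas p =
     {\<mu> \<in> cont_functions p \<rightarrow>\<^sub>E carrier (padic_ints p).
        (\<forall>f\<in>cont_functions p. \<forall>g\<in>cont_functions p.
           \<mu> (\<lambda>c\<in>topspace (units_mod_sign p). f c \<oplus>\<^bsub>padic_ints p\<^esub> g c)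
             = \<mu> f \<oplus>\<^bsub>padic_ints p\<^esub> \<mu> g) \<and>
        (\<forall>a\<in>carrier (padic_ints p). \<forall>f\<in>cont_functions p.
           \<mu> (\<lambda>c\<in>topspace (units_mod_sign p). a \<otimes>\<^bsub>padic_ints p\<^esub> f c)
             = a \<otimes>\<^bsub>padic_ints p\<^esub> \<mu> f)}"

text \<open>
  The function \<open>x \<mapsto> x ^ n\<close> on the quotient, for even \<open>n\<close>: it is then constant on every
  orbit, so that the image of an orbit is a singleton.
\<close>

definition power_fun :: "nat \<Rightarrow> nat \<Rightarrow> (nat \<Rightarrow> int) set \<Rightarrow> nat \<Rightarrow> int" where
  "power_fun p n =
     (\<lambda>c\<in>topspace (units_mod_sign p). the_elem ((\<lambda>x. x [^]\<^bsub>padic_ints p\<^esub> n) ` c))"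


subsection \<open>The group of moment sequences\<close>

text \<open>
  Integer sequences indexed by \<open>I\<close> form the group \<open>seq_group I\<close>; sequences
  \<open>(b\<^sub>k)\<close> with \<open>k \<ge> 2 * m\<close> are functions on \<open>{2 * m..}\<close>,
  with value \<open>undefined\<close> elsewhere.
\<close>

abbreviation seq_group :: "nat set \<Rightarrow> (nat \<Rightarrow> int) monoid" where
  "seq_group I \<equiv> product_group I (\<lambda>_. integer_group)"

definition mom_euler :: "nat \<Rightarrow> (nat \<Rightarrow> int) set" where
  "mom_euler m =
     {b \<in> carrier (seq_group {2 * m..}).
        (\<forall>k\<ge>m. b (2 * k + 1) = 0) \<and>
        (\<forall>p. prime p \<longrightarrow>
           (\<exists>\<mu>\<in>meas p. \<forall>k\<ge>m.
              \<mu> (power_fun p (2 * k)) = padic_of_int p ((1 - int p ^ (2 * k - 1)) * b (2 * k))))}"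


subsection \<open>The polynomials\<close>

definition sym_lift :: "int \<Rightarrow> int \<Rightarrow> int" where
  "sym_lift n a = (THE z. z \<in> {- (n div 2)..n - 1 - n div 2} \<and> [z = a] (mod n))"

definition e_poly :: "nat \<Rightarrow> nat \<Rightarrow> rat poly" where
  "e_poly p j =
     (if j = 0 then [:0, 1:]
      else Polynomial.smult (1 / fact (p ^ j))
        (\<Prod>a\<in>Units (residue_ring (int p ^ j)). [:- of_int (sym_lift (int p ^ j) a), 1:]))"

definition digits :: "nat \<Rightarrow> nat \<Rightarrow> nat \<Rightarrow> nat" where
  "digits p n =
     (THE a. finite {j. a j \<noteq> 0} \<and> a 0 \<le> p - 2 \<and> (\<forall>j\<ge>1. a j \<le> p - 1) \<and>
        n = a 0 + Sum_any (\<lambda>j. a (Suc j) * totient (p ^ Suc j)))"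

definition E_poly :: "nat \<Rightarrow> nat \<Rightarrow> rat poly" where
  "E_poly p n = Prod_any (\<lambda>j. e_poly p j ^ digits p n j)"

text \<open>The inverse of the leading coefficient of \<open>E_poly p (2 * k)\<close>.\<close>

definition C_coeff :: "nat \<Rightarrow> nat \<Rightarrow> nat" where
  "C_coeff p k = Prod_any (\<lambda>i. fact (p ^ i) ^ digits p (2 * k) i)"

text \<open>
  \<open>c_coeff p k i\<close> is minus the coefficient at \<open>X ^ (2 * i)\<close>; it is put to \<open>0\<close>
  for \<open>i \<ge> k\<close> in order to make the family unique.
\<close>

definition c_coeff :: "nat \<Rightarrow> nat \<Rightarrow> nat \<Rightarrow> int" where
  "c_coeff p k =
     (THE c. (\<forall>i\<ge>k. c i = 0) \<and>
        Polynomial.smult (of_nat (C_coeff p k)) (E_poly p (2 * k)) =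
          Polynomial.monom 1 (2 * k) - (\<Sum>i<k. Polynomial.monom (of_int (c i)) (2 * i)))"


subsection \<open>The matrix\<close>

definition S_primes :: "nat \<Rightarrow> nat set" where
  "S_primes k = {p. prime p \<and> p - 1 \<le> 2 * k}"

definition S_modulus :: "nat \<Rightarrow> int" where
  "S_modulus k = (\<Prod>p\<in>S_primes k. int p ^ multiplicity p (C_coeff p k))"

function Phi :: "nat \<Rightarrow> nat \<Rightarrow> nat \<Rightarrow> int" where
  "Phi m n j =
     (if n = 0 then (if j = 0 then 1 else 0)
      else if odd n then 0
      else let k = n div 2 in
        if j < k then
          (THE z. 0 \<le> z \<and> z < S_modulus k \<and>
             (\<forall>p\<in>S_primes k.
                [(1 - int p ^ (2 * (k + m) - 1)) * z =
                 (\<Sum>i<k. c_coeff p k i * (1 - int p ^ (2 * (i + m) - 1)) * Phi m (2 * i) j)]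
                (mod int p ^ multiplicity p (C_coeff p k))))
        else if j = k then S_modulus k
        else 0)"
  by pat_completeness auto
termination
  by (relation "Wellfounded.measure (\<lambda>(m, n, j). n)") auto

declare Phi.simps [simp del]

lemma Phi_eq_0: "2 * j > n \<Longrightarrow> Phi m n j = 0"
  by (subst Phi.simps) (auto simp: Let_def)

lemma finite_Phi_row: "finite {j. Phi m n j * l j \<noteq> 0}"
  by (rule finite_subset[of _ "{..n}"]) (auto simp: not_le intro: ccontr Phi_eq_0)

text \<open>The sum over all \<open>j\<close> has finite support by the preceding lemma.\<close>

definition Phi_map :: "nat \<Rightarrow> (nat \<Rightarrow> int) \<Rightarrow> nat \<Rightarrow> int" where
  "Phi_map m l = (\<lambda>k\<in>{2 * m..}. Sum_any (\<lambda>j. Phi m (k - 2 * m) j * l j))"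

end

theory Submission
  imports Defs
begin

text \<open>
  Fix a prime \<open>p\<close>. If \<open>y\<^sub>k\<close> is the integral of \<open>x ^ (2 * (k + m))\<close> against a measure, then the functional
  \<open>L\<close> with \<open>L (X ^ k) = y\<^sub>k\<close> has the following property: \<open>p ^ r\<close> divides \<open>L P\<close> whenever it divides \<open>P (x\<^sup>2)\<close> for all
  integers \<open>x\<close> prime to \<open>p\<close>. Conversely this property suffices, because modulo \<open>p ^ n\<close> every continuous
  function on the units modulo sign has the form \<open>P (x\<^sup>2) / p ^ r\<close> with an integer polynomial \<open>P\<close>.

  The property need only be checked on the polynomials \<open>C\<^sub>p(k) E\<^bsub>2k\<^esub>\<close>, written in the variable \<open>X\<^sup>2\<close>: they
  are compared with the Newton polynomials whose nodes are the squares of the successive positive integers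
  \<open>u\<^sub>0 < u\<^sub>1 < \<dots>\<close> prime to \<open>p\<close>. Both families are monic, and for both the largest power of \<open>p\<close> dividing all
  values of the \<open>k\<close>-th member has exponent \<open>v\<^sub>p (C\<^sub>p(k)) = v\<^sub>p ((2 u\<^sub>k - 1)!)\<close>. So being a moment sequence amounts
  to the congruences which the columns of the matrix satisfy by construction, and the matrix is lower triangular
  with the product of the moduli of these congruences on the diagonal.
\<close>

subsection \<open>Digits and the valuation of the leading coefficients\<close>

text \<open>The polynomials \<open>E_poly\<close> are good for divisibility from below, but as
  products of powers they do not show that the bound is sharp. Newton polynomials do: the k-th one,
  N_k, vanishes at the first k nodes and has exactly the minimal valuation at the next one, so
  coefficients can be read off by evaluation. Both divisibilities have one source. If x is prime to
  p and p divides z, then x - z is prime to p; so the product of x - z over the units z in a run of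
  n consecutive integers has the same p-part as over the whole run, which n! divides. The valuations
  agree because Legendre's formula turns both into q + v(q!) with q the integer part of 2k / (p -
  1). A linear map on continuous functions respects congruences by itself: a continuous function
  divisible by p^v is p^v times a continuous function. The two factors that separate the sequences
  from plain moments can be inverted: x^(2m) is a unit at units, and 1 - p^(2(k+m)-1) is prime to p
  because m >= 1. The latter is why each congruence can be solved for the entry of the
  matrix.\<close>

lemma multiplicity_fact_prime_rec:
  fixes p n :: nat
  assumes "prime p"
  shows "multiplicity p (fact n :: nat) = n div p + multiplicity p (fact (n div p) :: nat)"
proof (induction n)
  case (Suc n)
  have mult_Suc: "multiplicity p (fact (Suc r) :: nat) = multiplicity p (Suc r) + multiplicity p (fact r :: nat)" for r
    using assms by (simp only: fact_Suc of_nat_id) (rule prime_elem_multiplicity_mult_distrib, auto)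
  show ?case
  proof (cases "p dvd Suc n")
    case True
    then obtain q where q: "Suc n = p * q" by blast
    with assms obtain r where r: "q = Suc r"
      by (metis Zero_not_Suc mult_0_right not0_implies_Suc)
    have "n div p = r"
      using q r assms by (metis div_Suc dvd_imp_mod_0 dvd_triv_left diff_Suc_1 nonzero_mult_div_cancel_left not_prime_0)
    moreover have "multiplicity p (Suc n) = Suc (multiplicity p q)"
      unfolding q using assms r by (subst multiplicity_times_same) auto
    moreover have "Suc n div p = Suc r"
      using q r assms by (simp add: prime_gt_0_nat)
    ultimately show ?thesis
      using Suc mult_Suc[of n] mult_Suc[of r] r by simp
  next
    case False
    then have "Suc n div p = n div p"
      by (simp add: div_Suc dvd_eq_mod_eq_0)
    with False show ?thesis
      using Suc mult_Suc[of n] by (simp add: not_dvd_imp_multiplicity_0)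
  qed
qed auto

lemma multiplicity_fact_prime_times:
  fixes p n :: nat
  assumes "prime p"
  shows "multiplicity p (fact (p * n) :: nat) = n + multiplicity p (fact n :: nat)"
  using multiplicity_fact_prime_rec[OF assms, of "p * n"] assms by (simp add: prime_gt_0_nat)

lemma sum_base_digits:
  fixes p q :: nat
  shows "(\<Sum>j<J. (q div p ^ j mod p) * p ^ j) = q mod p ^ J"
proof (induction J)
  case (Suc J)
  then show ?case
    using mod_mult2_eq[of q "p ^ J" p] by (simp add: mult.commute)
qed auto

text \<open>Together with \<open>sum_base_digits\<close> this is existence and uniqueness of base p
  digits, which \<open>digits_eq\<close> transfers to the weights
  \<open>totient (p ^ j)\<close>.\<close>

lemma base_digit_sum:
  fixes p :: nat
  assumes "\<And>j. d j < p"
  shows "(\<Sum>j<J. d j * p ^ j) div p ^ i mod p = (if i < J then d i else 0)"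
  using assms
proof (induction J arbitrary: d i)
  case (Suc J)
  have *: "(\<Sum>j<Suc J. d j * p ^ j) = d 0 + p * (\<Sum>j<J. d (Suc j) * p ^ j)"
    by (simp only: sum.lessThan_Suc_shift sum_distrib_left) (simp add: ac_simps)
  show ?case
  proof (cases i)
    case 0
    then show ?thesis using Suc.prems[of 0] unfolding * by simp
  next
    case (Suc i')
    have "(d 0 + p * (\<Sum>j<J. d (Suc j) * p ^ j)) div p = (\<Sum>j<J. d (Suc j) * p ^ j)"
      using Suc.prems[of 0] by simp
    then have "(\<Sum>j<Suc J. d j * p ^ j) div p ^ i mod p = (\<Sum>j<J. d (Suc j) * p ^ j) div p ^ i' mod p"
      unfolding * Suc by (simp add: div_mult2_eq)
    also have "\<dots> = (if i' < J then d (Suc i') else 0)"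
      by (rule Suc.IH) (rule Suc.prems)
    finally show ?thesis using Suc by simp
  qed
qed auto

text \<open>Legendre's formula is additive along base p digits: v(q!) = q div p + v((q div p)!),
  where division by p shifts the digits, and v(p^(j+1)!) = p^j + v(p^j!). So the induction runs over
  the number of digits.\<close>

lemma multiplicity_fact_base_digits:
  fixes p q :: nat
  assumes p: "prime p" and "q < p ^ J"
  shows "(\<Sum>j<J. (q div p ^ j mod p) * multiplicity p (fact (p ^ j) :: nat)) = multiplicity p (fact q :: nat)"
  using assms(2)
proof (induction J arbitrary: q)
  case 0
  then show ?case by simp
next
  case (Suc J)
  have q: "q div p < p ^ J"
    using Suc.prems p by (simp add: div_less_iff_less_mult prime_gt_0_nat mult.commute)
  have rec: "multiplicity p (fact (p ^ Suc j) :: nat) = p ^ j + multiplicity p (fact (p ^ j) :: nat)" for j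
    using multiplicity_fact_prime_times[OF p, of "p ^ j"] by simp
  have "(\<Sum>j<Suc J. (q div p ^ j mod p) * multiplicity p (fact (p ^ j) :: nat))
      = (\<Sum>j<J. (q div p div p ^ j mod p) * multiplicity p (fact (p ^ Suc j) :: nat))"
    by (simp only: sum.lessThan_Suc_shift) (simp add: div_mult2_eq)
  also have "\<dots> = (\<Sum>j<J. (q div p div p ^ j mod p) * p ^ j)
      + (\<Sum>j<J. (q div p div p ^ j mod p) * multiplicity p (fact (p ^ j) :: nat))"
    unfolding rec by (simp add: algebra_simps sum.distrib)
  also have "\<dots> = q div p + multiplicity p (fact (q div p) :: nat)"
    using Suc.IH[OF q] q by (simp add: sum_base_digits)
  finally show ?case
    unfolding multiplicity_fact_prime_rec[OF p, of q] .
qed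

lemma less_power_self: "(p::nat) \<ge> 2 \<Longrightarrow> q < p ^ q"
  using power_mono[of 2 p q] less_exp[of q] by linarith

text \<open>Since \<open>totient (p ^ Suc j)\<close> is p^j (p - 1), the part of n beyond the digit
  of index 0 is a multiple of p - 1: that digit is the remainder modulo p - 1, and the others are
  the base p digits of the quotient. For p = 2 the remainder modulo 1 is 0, in accordance with the
  bound p - 2.\<close>

lemma digits_eq:
  assumes p: "prime p"
  shows "digits p n = (\<lambda>j. case j of 0 \<Rightarrow> n mod (p - 1) | Suc i \<Rightarrow> n div (p - 1) div p ^ i mod p)"
    (is "_ = ?a")
proof -
  have p2: "p \<ge> 2" using p by (rule prime_ge_2_nat)
  have tot: "totient (p ^ Suc j) = p ^ j * (p - 1)" for j
    using p by (rule totient_prime_power_Suc)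
  have Sum_eq: "Sum_any (\<lambda>j. a (Suc j) * totient (p ^ Suc j)) = (p - 1) * (\<Sum>j<J. a (Suc j) * p ^ j)"
    if "\<And>j. j \<ge> J \<Longrightarrow> a (Suc j) = 0" for a :: "nat \<Rightarrow> nat" and J
  proof -
    have "Sum_any (\<lambda>j. a (Suc j) * totient (p ^ Suc j)) = (\<Sum>j<J. a (Suc j) * totient (p ^ Suc j))"
    proof (rule Sum_any.expand_superset)
      show "{j. a (Suc j) * totient (p ^ Suc j) \<noteq> 0} \<subseteq> {..<J}"
        using that by (metis (mono_tags, lifting) lessThan_iff mem_Collect_eq mult_zero_left not_le subsetI)
    qed simp
    then show ?thesis
      by (simp only: tot) (simp add: sum_distrib_left ac_simps)
  qed
  show ?thesis
    unfolding digits_def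
  proof (rule the_equality)
    let ?q = "n div (p - 1)"
    \<comment> \<open>The quotient itself bounds the number of its digits, because
      \<open>?q < p ^ ?q\<close>.\<close>
    have vanish: "?a (Suc j) = 0" if "j \<ge> ?q" for j
    proof -
      have "?q < p ^ j"
        using less_power_self[OF p2, of ?q] power_increasing[OF that, of p] p2 by linarith
      then show ?thesis by simp
    qed
    have "{j. ?a j \<noteq> 0} \<subseteq> {..?q}"
    proof
      fix j assume j: "j \<in> {j. ?a j \<noteq> 0}"
      show "j \<in> {..?q}"
      proof (cases j)
        case (Suc i)
        then show ?thesis using j vanish[of i] by (meson atMost_iff mem_Collect_eq not_less_eq_eq)
      qed simp
    qed
    then have "finite {j. ?a j \<noteq> 0}"
      using finite_subset by blast
    moreover have "n = ?a 0 + Sum_any (\<lambda>j. ?a (Suc j) * totient (p ^ Suc j))"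
    proof -
      have "(\<Sum>j<?q. ?a (Suc j) * p ^ j) = ?q"
        using sum_base_digits[where q = ?q and J = ?q and p = p] less_power_self[OF p2, of ?q] by simp
      then show ?thesis
        using Sum_eq[where a = ?a and J = ?q] vanish by simp
    qed
    moreover have "?a 0 \<le> p - 2"
      using p2 mod_less_divisor[of "p - 1" n] by (simp del: mod_less_divisor, linarith?)
    moreover have "\<forall>j\<ge>1. ?a j \<le> p - 1"
    proof (intro allI impI)
      fix j :: nat assume "j \<ge> 1"
      then obtain i where "j = Suc i" by (cases j) auto
      then show "?a j \<le> p - 1"
        using p2 mod_less_divisor[of p "?q div p ^ i"] by (simp del: mod_less_divisor, linarith?)
    qed
    ultimately show "finite {j. ?a j \<noteq> 0} \<and> ?a 0 \<le> p - 2 \<and> (\<forall>j\<ge>1. ?a j \<le> p - 1) \<and>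
        n = ?a 0 + Sum_any (\<lambda>j. ?a (Suc j) * totient (p ^ Suc j))"
      by blast
  next
    fix a :: "nat \<Rightarrow> nat"
    assume a: "finite {j. a j \<noteq> 0} \<and> a 0 \<le> p - 2 \<and> (\<forall>j\<ge>1. a j \<le> p - 1) \<and>
        n = a 0 + Sum_any (\<lambda>j. a (Suc j) * totient (p ^ Suc j))"
    from a obtain J where "{j. a j \<noteq> 0} \<subseteq> {..J}"
      using finite_nat_iff_bounded_le by blast
    then have van: "a (Suc j) = 0" if "j \<ge> J" for j
      using that by (metis (mono_tags, lifting) atMost_iff mem_Collect_eq not_less_eq_eq subsetD)
    let ?S = "\<Sum>j<J. a (Suc j) * p ^ j"
    have n: "n = a 0 + (p - 1) * ?S"
      using a Sum_eq[of J a] van by simp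
    have a0: "a 0 < p - 1" using a p2 by linarith
    have n_mod: "n mod (p - 1) = a 0"
      unfolding n using a0 by simp
    have n_div: "n div (p - 1) = ?S"
      unfolding n using a0 by simp
    have less: "a (Suc j) < p" for j
    proof -
      have "a (Suc j) \<le> p - 1" using a by simp
      then show ?thesis using p2 by linarith
    qed
    have dig: "?S div p ^ i mod p = a (Suc i)" for i
      using base_digit_sum[of "\<lambda>j. a (Suc j)" p J i] less van[of i] by (cases "i < J") auto
    show "a = ?a"
    proof
      fix j show "a j = ?a j"
        by (cases j) (simp_all only: nat.case n_mod n_div dig)
    qed
  qed
qed

lemma digits_0: "prime p \<Longrightarrow> digits p n 0 = n mod (p - 1)"
  by (simp add: digits_eq)

lemma digits_Suc: "prime p \<Longrightarrow> digits p n (Suc i) = n div (p - 1) div p ^ i mod p"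
  by (simp add: digits_eq)

lemma digits_Suc_eq_0:
  assumes "prime p" "j \<ge> n div (p - 1)"
  shows "digits p n (Suc j) = 0"
proof -
  have "p \<ge> 2" using assms prime_ge_2_nat by blast
  then have "n div (p - 1) < p ^ j"
    using less_power_self[of p "n div (p - 1)"] power_increasing[OF assms(2), of p] by linarith
  then show ?thesis unfolding digits_Suc[OF assms(1)] by (simp only: div_less mod_0)
qed

lemma digits_sum:
  assumes "prime p"
  shows "digits p n 0 + (\<Sum>j<n div (p - 1). digits p n (Suc j) * (p ^ j * (p - 1))) = n"
proof -
  have "(\<Sum>j<n div (p - 1). digits p n (Suc j) * (p ^ j * (p - 1)))
      = (p - 1) * (\<Sum>j<n div (p - 1). (n div (p - 1) div p ^ j mod p) * p ^ j)"
    unfolding sum_distrib_left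
    by (intro sum.cong refl) (simp only: digits_Suc[OF assms] ac_simps)
  also have "\<dots> = (p - 1) * (n div (p - 1))"
    unfolding sum_base_digits
    using less_power_self[OF prime_ge_2_nat[OF assms], of "n div (p - 1)"] by (simp only: mod_less)
  finally show ?thesis by (simp only: digits_0[OF assms] mod_mult_div_eq)
qed

lemma Prod_any_digits:
  fixes f :: "nat \<Rightarrow> 'a::comm_monoid_mult"
  assumes "prime p"
  shows "Prod_any (\<lambda>j. f j ^ digits p n j)
    = f 0 ^ digits p n 0 * (\<Prod>j<n div (p - 1). f (Suc j) ^ digits p n (Suc j))"
proof -
  have "Prod_any (\<lambda>j. f j ^ digits p n j) = (\<Prod>j<Suc (n div (p - 1)). f j ^ digits p n j)"
  proof (rule Prod_any.expand_superset)
    show "{j. f j ^ digits p n j \<noteq> 1} \<subseteq> {..<Suc (n div (p - 1))}"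
    proof
      fix j assume j: "j \<in> {j. f j ^ digits p n j \<noteq> 1}"
      show "j \<in> {..<Suc (n div (p - 1))}"
      proof (cases j)
        case (Suc i)
        then have "digits p n (Suc i) \<noteq> 0" using j by (metis (mono_tags) mem_Collect_eq power_0)
        then have "i < n div (p - 1)"
          using digits_Suc_eq_0[OF assms, of n i] by (meson not_le)
        then show ?thesis using Suc by simp
      qed simp
    qed
  qed auto
  then show ?thesis by (simp only: prod.lessThan_Suc_shift)
qed

lemma C_coeff_eq:
  assumes "prime p"
  shows "C_coeff p k = (\<Prod>j<2 * k div (p - 1). fact (p ^ Suc j) ^ digits p (2 * k) (Suc j))"
  unfolding C_coeff_def using Prod_any_digits[OF assms, of "\<lambda>i. fact (p ^ i)" "2 * k"] by simp

text \<open>With q = 2k div (p - 1), the digits of index at least 1 are the base p digits of q, and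
  v(p^(j+1)!) = p^j + v(p^j!). The sum is q + v(q!) = v((p q)!). The power of X contributes only
  (p^0)! = 1.\<close>

lemma multiplicity_C_coeff:
  assumes p: "prime p"
  shows "multiplicity p (C_coeff p k) = multiplicity p (fact (p * (2 * k div (p - 1))) :: nat)"
proof -
  let ?q = "2 * k div (p - 1)"
  have q: "?q < p ^ ?q" using less_power_self prime_ge_2_nat[OF p] by blast
  have rec: "multiplicity p (fact (p ^ Suc j) :: nat) = p ^ j + multiplicity p (fact (p ^ j) :: nat)" for j
    using multiplicity_fact_prime_times[OF p, of "p ^ j"] by simp
  have "multiplicity p (C_coeff p k)
      = (\<Sum>j<?q. multiplicity p ((fact (p ^ Suc j) :: nat) ^ digits p (2 * k) (Suc j)))"
    unfolding C_coeff_eq[OF p] using p by (intro prime_elem_multiplicity_prod_distrib) auto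
  also have "\<dots> = (\<Sum>j<?q. (?q div p ^ j mod p) * multiplicity p (fact (p ^ Suc j) :: nat))"
    using p by (intro sum.cong refl) (simp add: prime_elem_multiplicity_power_distrib digits_Suc del: power_Suc)
  also have "\<dots> = (\<Sum>j<?q. (?q div p ^ j mod p) * p ^ j)
      + (\<Sum>j<?q. (?q div p ^ j mod p) * multiplicity p (fact (p ^ j) :: nat))"
    unfolding rec by (simp add: algebra_simps sum.distrib)
  also have "\<dots> = ?q + multiplicity p (fact ?q :: nat)"
    unfolding sum_base_digits multiplicity_fact_base_digits[OF p q] using q by (simp only: mod_less)
  finally show ?thesis by (simp only: multiplicity_fact_prime_times[OF p])
qed

subsection \<open>Values of the polynomials at integers prime to p\<close>

lemma fact_dvd_prod_consecutive:
  fixes x l :: int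
  shows "fact n dvd (\<Prod>z\<in>{l..<l + int n}. x - z)"
proof -
  have "(\<Prod>z\<in>{l..<l + int n}. x - z) = (\<Prod>i\<in>{0..<n}. (x - l - int n + 1) + int i)"
    by (rule prod.reindex_bij_witness[where i = "\<lambda>i. l + int n - 1 - int i"
          and j = "\<lambda>z. nat (l + int n - 1 - z)"]) auto
  also have "\<dots> = pochhammer (x - l - int n + 1) n"
    by (simp add: pochhammer_prod)
  finally show ?thesis
    using fact_dvd_pochhammer by metis
qed

lemma coprime_int_prime_iff:
  assumes "prime p"
  shows "coprime z (int p) \<longleftrightarrow> \<not> int p dvd z"
proof -
  have "prime (int p)" using assms by simp
  then show ?thesis
    by (metis coprime_commute coprime_absorb_left not_prime_unit prime_imp_coprime)
qed

text \<open>If p divides z but not x, it does not divide x - z. So leaving out the z divisible by p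
  keeps the power of p in the product, and divisibility by factorials survives the restriction to
  units.\<close>

lemma prod_split_coprime:
  fixes x :: int
  assumes "prime p" "coprime x (int p)" "finite W"
  obtains c where "coprime c (int p)" "(\<Prod>z\<in>W. x - z) = (\<Prod>z\<in>{z \<in> W. coprime z (int p)}. x - z) * c"
proof
  let ?c = "\<Prod>z\<in>{z \<in> W. \<not> coprime z (int p)}. x - z"
  have "coprime (x - z) (int p)" if "\<not> coprime z (int p)" for z
  proof -
    show ?thesis
      using that assms(2) dvd_diff_right_iff[of "int p" z x]
      by (metis coprime_int_prime_iff[OF assms(1)] dvd_diff_left_iff)
  qed
  then show "coprime ?c (int p)" by (intro prod_coprime_left) auto
  have "W = {z \<in> W. coprime z (int p)} \<union> {z \<in> W. \<not> coprime z (int p)}" by auto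
  then show "(\<Prod>z\<in>W. x - z) = (\<Prod>z\<in>{z \<in> W. coprime z (int p)}. x - z) * ?c"
    using assms(3) by (subst (1) \<open>W = _\<close>, intro prod.union_disjoint) auto
qed

lemma prime_power_dvd_prod_units:
  fixes x l :: int
  assumes "prime p" "coprime x (int p)"
  shows "int p ^ multiplicity p (fact n :: nat) dvd (\<Prod>z\<in>{z\<in>{l..<l + int n}. coprime z (int p)}. x - z)"
proof -
  obtain c where c: "coprime c (int p)"
    "(\<Prod>z\<in>{l..<l + int n}. x - z) = (\<Prod>z\<in>{z\<in>{l..<l + int n}. coprime z (int p)}. x - z) * c"
    using prod_split_coprime[OF assms] by blast
  have "int p ^ multiplicity p (fact n :: nat) dvd fact n"
    by (metis multiplicity_dvd of_nat_dvd_iff of_nat_fact of_nat_power)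
  also have "\<dots> dvd (\<Prod>z\<in>{l..<l + int n}. x - z)"
    by (rule fact_dvd_prod_consecutive)
  finally show ?thesis
    using c by (simp add: coprime_commute coprime_dvd_mult_left_iff)
qed

section \<open>The roots of \<open>e_poly\<close> as units in a symmetric window\<close>

lemma bij_betw_sym_lift:
  assumes n: "n > 1"
  shows "bij_betw (sym_lift n) (Units (residue_ring n)) {z\<in>{- (n div 2)..<- (n div 2) + n}. coprime z n}"
proof -
  define W where "W = {- (n div 2)..n - 1 - n div 2}"
  have W: "W = {- (n div 2)..<- (n div 2) + n}" by (auto simp: W_def)
  have U: "Units (residue_ring n) = {x. 0 < x \<and> x < n \<and> coprime x n}"
    using residues.res_units_eq[of n] n by (simp add: residues_def)
  have lift: "sym_lift n a = z" if "z \<in> W" "[z = a] (mod n)" for a z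
    unfolding sym_lift_def
  proof (rule the_equality)
    fix y assume y: "y \<in> {- (n div 2)..n - 1 - n div 2} \<and> [y = a] (mod n)"
    then have "n dvd y - z" using that by (metis cong_iff_dvd_diff cong_sym cong_trans)
    moreover have "\<bar>y - z\<bar> < n" using y that by (auto simp: W_def)
    ultimately show "y = z" by (metis dvd_imp_le_int eq_iff_diff_eq_0 abs_of_pos n not_le order_less_trans zero_less_one)
  qed (use that in \<open>auto simp: W_def\<close>)
  show ?thesis
    unfolding W[symmetric] U
  proof (rule bij_betw_byWitness[where f' = "\<lambda>z. z mod n"])
    have ex: "sym_lift n a \<in> W \<and> [sym_lift n a = a] (mod n)" for a
    proof -
      \<comment> \<open>Shifting by half the modulus before and after the reduction moves the
        residue from {0..<n} into the window.\<close>
      let ?z = "(a + n div 2) mod n - n div 2"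
      have "?z \<in> W" using n by (auto simp: W_def)
      moreover have "[?z = a] (mod n)"
        by (simp add: cong_def mod_simps)
      ultimately show ?thesis using lift[of ?z a] by simp
    qed
    show "\<forall>a\<in>{x. 0 < x \<and> x < n \<and> coprime x n}. sym_lift n a mod n = a"
      using ex by (auto simp: cong_def)
    show "\<forall>z\<in>{z \<in> W. coprime z n}. sym_lift n (z mod n) = z"
      by (auto intro!: lift simp: cong_def)
    show "sym_lift n ` {x. 0 < x \<and> x < n \<and> coprime x n} \<subseteq> {z \<in> W. coprime z n}"
      using ex by (auto dest: cong_imp_coprime cong_sym)
    show "(\<lambda>z. z mod n) ` {z \<in> W. coprime z n} \<subseteq> {x. 0 < x \<and> x < n \<and> coprime x n}"
    proof clarify
      fix z assume z: "z \<in> W" "coprime z n"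
      have "z mod n \<noteq> 0" 
      proof
        assume "z mod n = 0"
        then have "n dvd z" by auto
        then have "n dvd 1" using z(2) by (metis coprime_common_divisor dvd_refl)
        then show False using n zdvd_imp_le by fastforce
      qed
      moreover have "z mod n \<ge> 0" using n by simp
      ultimately have "0 < z mod n" by linarith
      then show "0 < z mod n \<and> z mod n < n \<and> coprime (z mod n) n" using z n by simp
    qed
  qed
qed

text \<open>For j > 0 these are the roots of \<open>e_poly p j\<close>. The half-open interval has
  the form required by \<open>prime_power_dvd_prod_units\<close>.\<close>

definition unit_window :: "nat \<Rightarrow> nat \<Rightarrow> int set" where
  "unit_window p j = {z\<in>{- (int p ^ j div 2)..<- (int p ^ j div 2) + int p ^ j}. coprime z (int p)}"

lemma finite_unit_window [simp]: "finite (unit_window p j)"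
  unfolding unit_window_def by (rule finite_subset[OF _ finite_atLeastLessThan_int]) blast

lemma coprime_int_power_right_iff: "j > 0 \<Longrightarrow> coprime z (int p ^ j) \<longleftrightarrow> coprime z (int p)"
  by simp

text \<open>Both facts come from \<open>sym_lift\<close> being a bijection from the unit classes
  onto the window: it reindexes the product, and it reduces the number of roots to a
  totient.\<close>

lemma
  assumes p: "prime p"
  shows e_poly_Suc: "Polynomial.smult (of_nat (fact (p ^ Suc j))) (e_poly p (Suc j))
      = (\<Prod>z\<in>unit_window p (Suc j). [:- of_int z, 1:])"
    and card_unit_window: "card (unit_window p (Suc j)) = p ^ j * (p - 1)"
proof -
  let ?n = "int p ^ Suc j"
  have n: "?n > 1" using p by (metis of_nat_1 of_nat_less_iff one_less_power prime_gt_1_nat zero_less_Suc of_nat_power)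
  have bij: "bij_betw (sym_lift ?n) (Units (residue_ring ?n)) (unit_window p (Suc j))"
    using bij_betw_sym_lift[OF n] unfolding unit_window_def by (simp only: coprime_int_power_right_iff[OF zero_less_Suc])
  have "(\<Prod>a\<in>Units (residue_ring ?n). [:- of_int (sym_lift ?n a), 1::rat:]) = (\<Prod>z\<in>unit_window p (Suc j). [:- of_int z, 1:])"
    by (rule prod.reindex_bij_betw[OF bij])
  then show "Polynomial.smult (of_nat (fact (p ^ Suc j))) (e_poly p (Suc j)) = (\<Prod>z\<in>unit_window p (Suc j). [:- of_int z, 1:])"
    unfolding e_poly_def by (simp del: power_Suc)
  have "card (unit_window p (Suc j)) = card (Units (residue_ring ?n))"
    using bij_betw_same_card[OF bij] by simp
  also have "Units (residue_ring ?n) = {x. 0 < x \<and> x < ?n \<and> coprime x ?n}"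
    using residues.res_units_eq[of ?n] n by (simp add: residues_def)
  also have "card \<dots> = card (totatives (p ^ Suc j))"
  proof (rule bij_betw_same_card[of nat], rule bij_betw_byWitness[where f' = int])
    have n': "p ^ Suc j > 1" using p by (meson one_less_power prime_gt_1_nat zero_less_Suc)
    show "nat ` {x. 0 < x \<and> x < ?n \<and> coprime x ?n} \<subseteq> totatives (p ^ Suc j)"
    proof clarify
      fix x assume x: "0 < x" "x < ?n" "coprime x ?n"
      then have "coprime (int (nat x)) (int (p ^ Suc j))" by simp
      then have "coprime (nat x) (p ^ Suc j)" unfolding coprime_int_iff .
      moreover have "nat x \<le> p ^ Suc j" using x by (metis nat_le_iff of_nat_power order_less_imp_le)
      ultimately show "nat x \<in> totatives (p ^ Suc j)" using x by (simp add: in_totatives_iff)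
    qed
    show "int ` totatives (p ^ Suc j) \<subseteq> {x. 0 < x \<and> x < ?n \<and> coprime x ?n}"
    proof clarify
      fix x assume x: "x \<in> totatives (p ^ Suc j)"
      then have "x < p ^ Suc j" using n' by (rule totatives_less)
      then have "int x < ?n" by (metis of_nat_less_iff of_nat_power)
      moreover have "coprime (int x) (int (p ^ Suc j))"
        unfolding coprime_int_iff using x by (simp add: in_totatives_iff)
      ultimately show "0 < int x \<and> int x < ?n \<and> coprime (int x) ?n"
        using x by (simp add: in_totatives_iff)
    qed
  qed auto
  also have "\<dots> = p ^ j * (p - 1)"
    using totient_prime_power_Suc[OF p, of j] by (simp only: totient_def)
  finally show "card (unit_window p (Suc j)) = p ^ j * (p - 1)" .
qed

text \<open>Integrality and evenness are what makes \<open>c_coeff\<close> exist. The coefficients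
  live in the rationals because those of \<open>e_poly\<close> do.\<close>

definition even_int_poly :: "rat poly \<Rightarrow> bool" where
  "even_int_poly f \<longleftrightarrow> (\<forall>i. poly.coeff f i \<in> \<int> \<and> (odd i \<longrightarrow> poly.coeff f i = 0))"

lemma even_int_poly_mult:
  assumes "even_int_poly f" "even_int_poly g"
  shows "even_int_poly (f * g)"
  unfolding even_int_poly_def
proof (intro allI conjI impI)
  fix i
  show "poly.coeff (f * g) i \<in> \<int>"
    unfolding coeff_mult using assms by (intro Ints_sum Ints_mult) (auto simp: even_int_poly_def)
  assume "odd i"
  have "poly.coeff f j * poly.coeff g (i - j) = 0" if "j \<le> i" for j
    using assms \<open>odd i\<close> that by (cases "odd j") (auto simp: even_int_poly_def)
  then show "poly.coeff (f * g) i = 0"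
    unfolding coeff_mult by (intro sum.neutral) auto
qed

lemma even_int_poly_1: "even_int_poly 1"
  by (auto simp: even_int_poly_def coeff_1)

lemma even_int_poly_power: "even_int_poly f \<Longrightarrow> even_int_poly (f ^ n)"
  by (induction n) (auto intro: even_int_poly_mult even_int_poly_1)

lemma even_int_poly_prod: "(\<And>i. i \<in> A \<Longrightarrow> even_int_poly (f i)) \<Longrightarrow> even_int_poly (prod f A)"
  by (induction A rule: infinite_finite_induct) (auto intro: even_int_poly_mult even_int_poly_1)

lemma even_int_poly_quadratic: "even_int_poly [:of_int a, 0, 1:]"
  by (auto simp: even_int_poly_def coeff_pCons split: nat.split)

text \<open>The factors for z and -z combine to X^2 - z^2. The root 0 is excluded because it would
  be its own partner.\<close>

lemma even_int_poly_symmetric_prod: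
  fixes A :: "int set"
  assumes "finite A" "\<And>z. z \<in> A \<Longrightarrow> - z \<in> A" "0 \<notin> A"
  shows "even_int_poly (\<Prod>z\<in>A. [:- of_int z, 1:])"
proof -
  let ?B = "{z \<in> A. z > 0}"
  have A: "A = ?B \<union> uminus ` ?B"
  proof (intro equalityI subsetI)
    fix z assume z: "z \<in> A"
    then have "z \<noteq> 0" using assms(3) by auto
    then consider "z > 0" | "- z > 0" by linarith
    then show "z \<in> ?B \<union> uminus ` ?B"
    proof cases
      case 2
      then have "- z \<in> ?B" using z assms(2) by auto
      then show ?thesis by (metis UnI2 image_eqI minus_minus)
    qed (use z in auto)
  qed (use assms(2) in auto)
  have "(\<Prod>z\<in>A. [:- of_int z, 1:]) = (\<Prod>z\<in>?B. [:- of_int z, 1:]) * (\<Prod>z\<in>uminus ` ?B. [:- of_int z, 1::rat:])"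
    using assms(1) by (subst A, intro prod.union_disjoint) auto
  also have "(\<Prod>z\<in>uminus ` ?B. [:- of_int z, 1::rat:]) = (\<Prod>z\<in>?B. [:of_int z, 1:])"
    by (subst prod.reindex) auto
  also have "(\<Prod>z\<in>?B. [:- of_int z, 1:]) * \<dots> = (\<Prod>z\<in>?B. [:of_int (- (z * z)), 0, 1:])"
    by (simp flip: prod.distrib)
  finally show ?thesis
    by (simp only:) (intro even_int_poly_prod even_int_poly_quadratic)
qed

text \<open>For odd p the window is symmetric about 0. For p = 2 its left end -2^(j-1) lacks a
  partner, but for j > 1 it is even and hence no unit; for j = 1 the window is {-1}, which is not
  symmetric.\<close>

lemma even_int_poly_unit_window:
  assumes p: "prime p" and j: "p > 2 \<or> j > 1" "j > 0"
  shows "even_int_poly (\<Prod>z\<in>unit_window p j. [:- of_int z, 1:])"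
proof (rule even_int_poly_symmetric_prod)
  have p1: "int p > 1" using p prime_gt_1_nat by fastforce
  show "0 \<notin> unit_window p j" using p1 by (auto simp: unit_window_def)
  fix z assume z: "z \<in> unit_window p j"
  let ?n = "int p ^ j"
  show "- z \<in> unit_window p j"
  proof (cases "odd ?n")
    case True
    then have "?n = 2 * (?n div 2) + 1" by simp
    then show ?thesis using z by (auto simp: unit_window_def)
  next
    case False
    then have "even p" by simp
    then have p2: "p = 2" using p prime_odd_nat[of p] prime_ge_2_nat[OF p] by linarith
    with j have "j = Suc (Suc (j - 2))" by simp
    then obtain i where i: "j = Suc (Suc i)" by blast
    have "z \<noteq> - (?n div 2)"
    proof
      assume "z = - (?n div 2)"
      then have "even z" using p2 i by simp
      then show False using z p2 by (auto simp: unit_window_def)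
    qed
    then show ?thesis using z p2 i by (auto simp: unit_window_def)
  qed
qed simp

definition CE_poly :: "nat \<Rightarrow> nat \<Rightarrow> rat poly" where
  "CE_poly p k = Polynomial.smult (of_nat (C_coeff p k)) (E_poly p (2 * k))"

lemma CE_poly_eq:
  assumes p: "prime p"
  shows "CE_poly p k = [:0, 1:] ^ digits p (2 * k) 0 *
    (\<Prod>j<2 * k div (p - 1). (\<Prod>z\<in>unit_window p (Suc j). [:- of_int z, 1:]) ^ digits p (2 * k) (Suc j))"
proof -
  have "E_poly p (2 * k) = [:0, 1:] ^ digits p (2 * k) 0 *
    (\<Prod>j<2 * k div (p - 1). e_poly p (Suc j) ^ digits p (2 * k) (Suc j))"
    unfolding E_poly_def Prod_any_digits[OF p] by (simp add: e_poly_def)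
  then have "CE_poly p k = [:0, 1:] ^ digits p (2 * k) 0 *
    (\<Prod>j<2 * k div (p - 1). Polynomial.smult (of_nat (fact (p ^ Suc j) ^ digits p (2 * k) (Suc j)))
        (e_poly p (Suc j) ^ digits p (2 * k) (Suc j)))"
    unfolding CE_poly_def C_coeff_eq[OF p] of_nat_prod prod_smult by (simp add: mult_smult_right)
  then show ?thesis
    by (simp only: e_poly_Suc[OF p, symmetric] smult_power of_nat_power)
qed

text \<open>Two factors could break parity. The exponent of X is 2k mod (p - 1), which is even for
  odd p and 0 for p = 2. The asymmetric window, for p = 2 and index 1, occurs with exponent 2k mod 2
  = 0.\<close>

lemma even_int_poly_CE_poly:
  assumes p: "prime p"
  shows "even_int_poly (CE_poly p k)"
  unfolding CE_poly_eq[OF p]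
proof (intro even_int_poly_mult even_int_poly_prod)
  have p2: "p \<ge> 2" using p by (rule prime_ge_2_nat)
  have X: "even_int_poly ([:0, 1:] ^ (2 * i))" for i
    using even_int_poly_power[OF even_int_poly_quadratic[of 0], of i] by (simp add: power_mult power2_eq_square)
  have "even (digits p (2 * k) 0)"
  proof (cases "p = 2")
    case False
    then have "odd p" using p p2 prime_odd_nat[of p] by simp
    then have "even (p - 1)" using p2 by simp
    then show ?thesis using p by (simp add: digits_0 dvd_mod)
  qed (use p in \<open>simp add: digits_0\<close>)
  then show "even_int_poly ([:0, 1:] ^ digits p (2 * k) 0)"
    using X by (auto elim: evenE)
  fix j
  show "even_int_poly ((\<Prod>z\<in>unit_window p (Suc j). [:- of_int z, 1:]) ^ digits p (2 * k) (Suc j))"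
  proof (cases "p = 2 \<and> j = 0")
    case True
    then have "digits p (2 * k) (Suc j) = 0" using digits_Suc[OF p] by simp
    then show ?thesis by (simp add: even_int_poly_1)
  next
    case False
    then show ?thesis
      using p p2 by (intro even_int_poly_power even_int_poly_unit_window) auto
  qed
qed

lemma
  assumes p: "prime p"
  shows degree_CE_poly: "Polynomial.degree (CE_poly p k) = 2 * k"
    and lead_coeff_CE_poly: "Polynomial.lead_coeff (CE_poly p k) = 1"
proof -
  let ?d = "digits p (2 * k)"
  let ?f = "\<lambda>j. \<Prod>z\<in>unit_window p (Suc j). [:- of_int z, 1::rat:]"
  have lead: "Polynomial.lead_coeff (?f j) = 1" for j
    by (simp add: lead_coeff_prod)
  have nz: "?f j \<noteq> 0" for j using lead[of j] by (metis coeff_0 zero_neq_one)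
  have deg: "Polynomial.degree (?f j) = p ^ j * (p - 1)" for j
    using card_unit_window[OF p, of j] by (subst degree_prod_eq_sum_degree) auto
  show "Polynomial.lead_coeff (CE_poly p k) = 1"
    unfolding CE_poly_eq[OF p] lead_coeff_mult lead_coeff_prod lead_coeff_power lead by simp
  have "Polynomial.degree (CE_poly p k) = ?d 0 + (\<Sum>j<2 * k div (p - 1). ?d (Suc j) * (p ^ j * (p - 1)))"
    unfolding CE_poly_eq[OF p]
  proof (subst degree_mult_eq)
    show "Polynomial.degree ([:0, 1::rat:] ^ ?d 0) + Polynomial.degree (\<Prod>j<2 * k div (p - 1). ?f j ^ ?d (Suc j)) =
      ?d 0 + (\<Sum>j<2 * k div (p - 1). ?d (Suc j) * (p ^ j * (p - 1)))"
    proof (subst degree_prod_eq_sum_degree)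
      show "Polynomial.degree ([:0, 1::rat:] ^ ?d 0)
          + (\<Sum>j<2 * k div (p - 1). Polynomial.degree (?f j ^ ?d (Suc j))) =
        ?d 0 + (\<Sum>j<2 * k div (p - 1). ?d (Suc j) * (p ^ j * (p - 1)))"
        by (simp only: degree_power_eq[OF nz] deg) (simp add: degree_power_eq)
    qed (use nz in auto)
  qed (use nz in auto)
  then show "Polynomial.degree (CE_poly p k) = 2 * k"
    using digits_sum[OF p, of "2 * k"] by simp
qed

lemma diff_left_imp_eq: "a - b = a - c \<Longrightarrow> b = c" for a b c :: "'a::ab_group_add"
  by simp

lemma c_coeff_spec:
  assumes p: "prime p"
  shows "CE_poly p k = Polynomial.monom 1 (2 * k) - (\<Sum>i<k. Polynomial.monom (of_int (c_coeff p k i)) (2 * i))"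
proof -
  let ?P = "\<lambda>c. (\<forall>i\<ge>k. c i = 0) \<and>
        CE_poly p k = Polynomial.monom 1 (2 * k) - (\<Sum>i<k. Polynomial.monom (of_int (c i)) (2 * i))"
  have coef: "poly.coeff (\<Sum>i<k. Polynomial.monom (of_int (c i)) (2 * i) :: rat poly) n
      = (if even n \<and> n < 2 * k then of_int (c (n div 2)) else 0)" for c n
  proof -
    have "poly.coeff (\<Sum>i<k. Polynomial.monom (of_int (c i)) (2 * i) :: rat poly) n
      = (\<Sum>i<k. if i = n div 2 then (if even n then of_int (c i) else 0) else 0)"
      unfolding coeff_sum by (intro sum.cong refl) auto
    then show ?thesis by auto
  qed
  \<comment> \<open>The floor only turns an integral rational into an integer; the sign is the one
    in the definition of \<open>c_coeff\<close>.\<close>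
  let ?c = "\<lambda>i. if i < k then - \<lfloor>poly.coeff (CE_poly p k) (2 * i)\<rfloor> else 0"
  have ex: "?P ?c"
  proof (intro conjI allI impI poly_eqI)
    fix n
    have ev: "poly.coeff (CE_poly p k) n \<in> \<int>" "odd n \<Longrightarrow> poly.coeff (CE_poly p k) n = 0"
      using even_int_poly_CE_poly[OF p, of k] by (auto simp: even_int_poly_def)
    show "poly.coeff (CE_poly p k) n
      = poly.coeff (Polynomial.monom 1 (2 * k) - (\<Sum>i<k. Polynomial.monom (of_int (?c i)) (2 * i))) n"
    proof (cases "n < 2 * k")
      case True
      then show ?thesis
        using ev by (simp only: coeff_diff coef) (auto elim!: evenE Ints_cases)
    next
      case False
      then consider "n = 2 * k" | "n > 2 * k" by linarith
      then show ?thesis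
      proof cases
        case 1
        then show ?thesis using lead_coeff_CE_poly[OF p, of k] degree_CE_poly[OF p, of k]
          by (simp only: coeff_diff coef) simp
      next
        case 2
        then show ?thesis using degree_CE_poly[OF p, of k] by (simp only: coeff_diff coef) (simp add: coeff_eq_0)
      qed
    qed
  qed auto
  have "c i = c' i" if "?P c" "?P c'" for c c' i
  proof (cases "i < k")
    case True
    have "(\<Sum>i<k. Polynomial.monom (of_int (c i)) (2 * i)) = (\<Sum>i<k. Polynomial.monom (of_int (c' i)) (2 * i) :: rat poly)"
      using trans[OF sym[OF conjunct2[OF that(1)]] conjunct2[OF that(2)]] by (rule diff_left_imp_eq)
    then have "poly.coeff (\<Sum>i<k. Polynomial.monom (of_int (c i)) (2 * i) :: rat poly) (2 * i)
        = poly.coeff (\<Sum>i<k. Polynomial.monom (of_int (c' i)) (2 * i)) (2 * i)" by simp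
    then show ?thesis using True unfolding coef by simp
  qed (use that in auto)
  then have uniq: "c = c'" if "?P c" "?P c'" for c c'
    using that by blast
  have "?P (THE c. ?P c)"
    by (rule theI[of ?P, OF ex]) (rule uniq[OF _ ex])
  then show ?thesis
    unfolding c_coeff_def CE_poly_def by blast
qed

text \<open>\<open>CE_poly p k\<close> written in the variable X^2, so that its value at x^2 is that
  of \<open>CE_poly p k\<close> at x. Halving the exponents makes k the degree.\<close>

definition Q_poly :: "nat \<Rightarrow> nat \<Rightarrow> int poly" where
  "Q_poly p k = Polynomial.monom 1 k - (\<Sum>i<k. Polynomial.monom (c_coeff p k i) i)"

lemma poly_Q_poly: "poly (Q_poly p k) t = t ^ k - (\<Sum>i<k. c_coeff p k i * t ^ i)"
  by (simp add: Q_poly_def poly_monom poly_sum)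

text \<open>At a unit x the factor belonging to a window of p^j integers is divisible by the p-part
  of (p^j)!, and \<open>C_coeff\<close> is the product of these factorials with the same
  exponents.\<close>

lemma Q_poly_dvd:
  assumes p: "prime p" and x: "coprime x (int p)"
  shows "int p ^ multiplicity p (C_coeff p k) dvd poly (Q_poly p k) (x ^ 2)"
proof -
  let ?d = "digits p (2 * k)"
  let ?z = "x ^ ?d 0 * (\<Prod>j<2 * k div (p - 1). (\<Prod>z\<in>unit_window p (Suc j). x - z) ^ ?d (Suc j))"
  have "rat_of_int (poly (Q_poly p k) (x ^ 2)) = poly (CE_poly p k) (of_int x)"
    unfolding c_coeff_spec[OF p] poly_Q_poly by (simp add: poly_monom poly_sum power_mult)
  also have "\<dots> = of_int ?z"
    unfolding CE_poly_eq[OF p] by (simp add: poly_prod)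
  finally have eq: "poly (Q_poly p k) (x ^ 2) = ?z" by (simp only: of_int_eq_iff)
  have "multiplicity p (C_coeff p k)
      = (\<Sum>j<2 * k div (p - 1). ?d (Suc j) * multiplicity p (fact (p ^ Suc j) :: nat))"
    unfolding C_coeff_eq[OF p] using p
    by (subst prime_elem_multiplicity_prod_distrib)
      (auto simp: prime_elem_multiplicity_power_distrib simp del: power_Suc)
  then have "int p ^ multiplicity p (C_coeff p k)
      = (\<Prod>j<2 * k div (p - 1). (int p ^ multiplicity p (fact (p ^ Suc j) :: nat)) ^ ?d (Suc j))"
    by (simp only: power_sum flip: power_mult) (simp add: mult.commute)
  also have "\<dots> dvd (\<Prod>j<2 * k div (p - 1). (\<Prod>z\<in>unit_window p (Suc j). x - z) ^ ?d (Suc j))"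
  proof (intro prod_dvd_prod dvd_power_same)
    fix j
    show "int p ^ multiplicity p (fact (p ^ Suc j) :: nat) dvd (\<Prod>z\<in>unit_window p (Suc j). x - z)"
      using prime_power_dvd_prod_units[OF p x, of "p ^ Suc j" "- (int p ^ Suc j div 2)"]
      by (simp only: unit_window_def of_nat_power)
  qed
  finally show ?thesis unfolding eq by simp
qed

subsection \<open>Newton polynomials and moment functionals\<close>

text \<open>Counted from 0, starting with 1. The summand \<open>k div (p - 1)\<close> is the number
  of skipped multiples of p, one after each block of p - 1 units.\<close>

definition nth_unit :: "nat \<Rightarrow> nat \<Rightarrow> nat" where
  "nth_unit p k = k + k div (p - 1) + 1"

lemma nth_unit_strict_mono: "i < k \<Longrightarrow> nth_unit p i < nth_unit p k"
  using div_le_mono[of i k "p - 1"] by (simp add: nth_unit_def)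

lemma nth_unit_decomp:
  assumes "prime p"
  shows "nth_unit p k = p * (k div (p - 1)) + (k mod (p - 1) + 1)"
proof -
  have "k = (p - 1) * (k div (p - 1)) + k mod (p - 1)" by simp
  moreover have "p * (k div (p - 1)) = (p - 1) * (k div (p - 1)) + k div (p - 1)"
    using prime_ge_2_nat[OF assms] by (cases p) auto
  ultimately show ?thesis unfolding nth_unit_def by linarith
qed

lemma mod_pred_less:
  fixes k :: nat
  assumes "prime p"
  shows "k mod (p - 1) + 1 < p"
  using mod_less_divisor[of "p - 1" k] prime_ge_2_nat[OF assms] by linarith

lemma not_dvd_nth_unit:
  assumes "prime p"
  shows "\<not> p dvd nth_unit p k"
proof
  assume "p dvd nth_unit p k"
  then have "p dvd k mod (p - 1) + 1"
    unfolding nth_unit_decomp[OF assms] by (simp add: dvd_add_right_iff del: One_nat_def add_Suc_right)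
  then show False
    using mod_pred_less[OF assms, of k] by (auto dest: dvd_imp_le)
qed

lemma unit_eq_nth_unit:
  assumes p: "prime p" and b: "\<not> p dvd b"
  obtains k where "b = nth_unit p k"
proof
  let ?s = "b div p" and ?t = "b mod p"
  have t: "0 < ?t" "?t < p"
    using b prime_gt_0_nat[OF p] by (auto simp: dvd_eq_mod_eq_0)
  have d: "(?t - 1) div (p - 1) = 0" using t by (intro div_less) linarith
  have "((p - 1) * ?s + (?t - 1)) div (p - 1) = ?s"
    using t d prime_ge_2_nat[OF p] by (subst div_mult_self4) auto
  moreover have "b = (p - 1) * ?s + ?s + ?t"
  proof -
    have "b = p * ?s + ?t" by simp
    also have "p * ?s = (p - 1) * ?s + ?s" using prime_ge_2_nat[OF p] by (cases p) auto
    finally show ?thesis .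
  qed
  \<comment> \<open>Before b lie \<open>?s\<close> full blocks of p - 1 units and
    \<open>?t - 1\<close> further ones.\<close>
  ultimately show "b = nth_unit p ((p - 1) * ?s + (?t - 1))"
    unfolding nth_unit_def using t by linarith
qed

lemma nth_unit_image:
  assumes "prime p"
  shows "nth_unit p ` {..<k} = {b. b < nth_unit p k \<and> \<not> p dvd b}"
proof (intro equalityI subsetI)
  fix b assume b: "b \<in> {b. b < nth_unit p k \<and> \<not> p dvd b}"
  then obtain i where i: "b = nth_unit p i" using unit_eq_nth_unit[OF assms] by blast
  then have "i < k"
    using b nth_unit_strict_mono[of k i p] by (cases i k rule: linorder_cases) auto
  then show "b \<in> nth_unit p ` {..<k}" using i by blast
qed (use nth_unit_strict_mono not_dvd_nth_unit[OF assms] in auto)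

text \<open>The identity behind the equality of the two valuations. Write k = (p - 1) s + t with t <
  p - 1; then 2 \<open>nth_unit p k\<close> - 1 = 2 p s + 2 t + 1. Apart from 2s, the quotients are
  (2t + 1) div p and 2t div (p - 1): both are 0 if 2t + 1 < p, and both are 1 otherwise.\<close>

lemma double_nth_unit_div:
  assumes p: "prime p"
  shows "(2 * nth_unit p k - 1) div p = 2 * k div (p - 1)"
proof -
  let ?s = "k div (p - 1)" and ?t = "k mod (p - 1)"
  have t: "?t + 1 < p" by (rule mod_pred_less[OF p])
  have "2 * nth_unit p k - 1 = (2 * ?t + 1) + p * (2 * ?s)"
    unfolding nth_unit_decomp[OF p] by simp
  then have 1: "(2 * nth_unit p k - 1) div p = 2 * ?s + (2 * ?t + 1) div p"
    using prime_gt_0_nat[OF p] by (simp only: div_mult_self2 neq0_conv)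
  have "2 * k = 2 * ?t + (p - 1) * (2 * ?s)"
  proof -
    have "2 * k = 2 * (?t + (p - 1) * ?s)" by (simp only: mod_mult_div_eq)
    then show ?thesis by (simp only: distrib_left mult.left_commute)
  qed
  moreover have "p - 1 \<noteq> 0" using prime_ge_2_nat[OF p] by simp
  ultimately have 2: "2 * k div (p - 1) = 2 * ?s + 2 * ?t div (p - 1)"
    by (simp only: div_mult_self2 not_False_eq_True)
  have "(2 * ?t + 1) div p = 2 * ?t div (p - 1)"
  proof (cases "2 * ?t + 1 < p")
    case True
    then have "2 * ?t < p - 1" by linarith
    then show ?thesis using True by (simp only: div_less)
  next
    case False
    have "(2 * ?t + 1) div p = 1"
      using t False by (intro div_nat_eqI; simp only: mult_Suc_right mult_1_right; linarith)
    moreover have "2 * ?t div (p - 1) = 1"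
      using t False by (intro div_nat_eqI; simp only: mult_Suc_right mult_1_right; linarith)
    ultimately show ?thesis by (simp only:)
  qed
  with 1 2 show ?thesis by (simp only:)
qed


section \<open>Newton polynomials with the squares of the units as nodes\<close>

definition newton_poly :: "nat \<Rightarrow> nat \<Rightarrow> int poly" where
  "newton_poly p k = (\<Prod>i<k. [:- (int (nth_unit p i) ^ 2), 1:])"

lemma degree_newton_poly: "Polynomial.degree (newton_poly p k) = k"
  unfolding newton_poly_def by (subst degree_prod_eq_sum_degree) auto

lemma lead_coeff_newton_poly: "Polynomial.lead_coeff (newton_poly p k) = 1"
  unfolding newton_poly_def by (simp add: lead_coeff_prod)

text \<open>Each x^2 - u^2 splits as (x - u)(x + u), and the signed nodes are exactly the integers
  prime to p strictly between -\<open>nth_unit p k\<close> and \<open>nth_unit p k\<close>. This run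
  of 2 \<open>nth_unit p k\<close> - 1 consecutive integers is the source of the factorial
  below.\<close>

lemma poly_newton_poly:
  assumes p: "prime p"
  shows "poly (newton_poly p k) (x ^ 2)
    = (\<Prod>z\<in>{z\<in>{1 - int (nth_unit p k)..<1 - int (nth_unit p k) + int (2 * nth_unit p k - 1)}.
        coprime z (int p)}. x - z)"
    (is "_ = prod _ ?W")
proof -
  let ?B = "{b. b < nth_unit p k \<and> \<not> p dvd b}"
  have u: "nth_unit p k \<ge> 1" by (simp add: nth_unit_def)
  have W: "?W = int ` ?B \<union> uminus ` int ` ?B"
  proof (rule Set.set_eqI)
    fix z
    have lhs: "z \<in> ?W \<longleftrightarrow> \<bar>z\<bar> < int (nth_unit p k) \<and> \<not> int p dvd z"
      unfolding mem_Collect_eq coprime_int_prime_iff[OF p] atLeastLessThan_iff using u by linarith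
    have mem: "z \<in> int ` ?B \<longleftrightarrow> 0 \<le> z \<and> z < int (nth_unit p k) \<and> \<not> int p dvd z" for z
    proof
      assume "0 \<le> z \<and> z < int (nth_unit p k) \<and> \<not> int p dvd z"
      moreover from this obtain b where "z = int b" by (metis nonneg_int_cases)
      ultimately show "z \<in> int ` ?B" by simp
    qed auto
    have "z \<in> uminus ` int ` ?B \<longleftrightarrow> - z \<in> int ` ?B"
      by (metis (no_types, lifting) image_iff minus_minus)
    then show "z \<in> ?W \<longleftrightarrow> z \<in> int ` ?B \<union> uminus ` int ` ?B"
      unfolding lhs Un_iff mem dvd_minus_iff by linarith
  qed
  have "prod ((-) x) ?W = prod ((-) x) (int ` ?B) * prod ((-) x) (uminus ` int ` ?B)"
    unfolding W
  proof (rule prod.union_disjoint)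
    have "int b = - int c \<Longrightarrow> b = 0" for b c by linarith
    then show "int ` ?B \<inter> uminus ` int ` ?B = {}" by fastforce
  qed auto
  also have "prod ((-) x) (int ` ?B) = (\<Prod>b\<in>?B. x - int b)"
    by (subst prod.reindex) (auto simp: inj_on_def)
  also have "prod ((-) x) (uminus ` int ` ?B) = (\<Prod>b\<in>?B. x + int b)"
    unfolding image_image by (subst prod.reindex) (auto simp: inj_on_def)
  also have "(\<Prod>b\<in>?B. x - int b) * (\<Prod>b\<in>?B. x + int b) = (\<Prod>b\<in>?B. - (int b ^ 2) + x ^ 2)"
    unfolding prod.distrib[symmetric] by (intro prod.cong refl) (simp add: algebra_simps power2_eq_square)
  also have "\<dots> = (\<Prod>i<k. - (int (nth_unit p i) ^ 2) + x ^ 2)"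
  proof -
    have "inj_on (nth_unit p) {..<k}"
      by (rule strict_mono_on_imp_inj_on) (auto intro!: strict_mono_onI nth_unit_strict_mono)
    then show ?thesis
      unfolding nth_unit_image[OF p, symmetric] by (subst prod.reindex) auto
  qed
  also have "\<dots> = poly (newton_poly p k) (x ^ 2)"
    by (simp add: newton_poly_def poly_prod)
  finally show ?thesis by simp
qed

text \<open>One Legendre step on either side gives q + v(q!) with the same q = 2k div (p -
  1).\<close>

lemma multiplicity_C_coeff_nth_unit:
  assumes p: "prime p"
  shows "multiplicity p (C_coeff p k) = multiplicity p (fact (2 * nth_unit p k - 1) :: nat)"
  unfolding multiplicity_C_coeff[OF p] multiplicity_fact_prime_times[OF p]
    multiplicity_fact_prime_rec[OF p, of "2 * nth_unit p k - 1"] double_nth_unit_div[OF p] ..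

lemma newton_poly_dvd:
  assumes p: "prime p" and x: "coprime x (int p)"
  shows "int p ^ multiplicity p (C_coeff p k) dvd poly (newton_poly p k) (x ^ 2)"
  unfolding poly_newton_poly[OF p] multiplicity_C_coeff_nth_unit[OF p]
  by (rule prime_power_dvd_prod_units[OF p x])

lemma coprime_nth_unit: "prime p \<Longrightarrow> coprime (int (nth_unit p k)) (int p)"
  using coprime_int_prime_iff[of p "int (nth_unit p k)"] not_dvd_nth_unit[of p k] by simp

text \<open>At the k-th unit u the differences u - z over the full run are 1, ..., 2u - 1, with
  product (2u - 1)!. The z divisible by p contribute a factor prime to p, so the bound of
  \<open>newton_poly_dvd\<close> is attained.\<close>

lemma newton_poly_nth_unit:
  assumes p: "prime p"
  obtains c where "coprime c (int p)"
    "poly (newton_poly p k) (int (nth_unit p k) ^ 2) = int p ^ multiplicity p (C_coeff p k) * c"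
proof -
  let ?u = "int (nth_unit p k)"
  let ?n = "2 * nth_unit p k - 1"
  let ?v = "multiplicity p (C_coeff p k)"
  obtain c where c: "coprime c (int p)"
    "(\<Prod>z\<in>{1 - ?u..<1 - ?u + int ?n}. ?u - z) = poly (newton_poly p k) (?u ^ 2) * c"
    unfolding poly_newton_poly[OF p] using prod_split_coprime[OF p coprime_nth_unit[OF p]] by blast
  have "(\<Prod>z\<in>{1 - ?u..<1 - ?u + int ?n}. ?u - z) = (\<Prod>i\<in>{1..?n}. int i)"
    by (rule prod.reindex_bij_witness[where i = "\<lambda>i. ?u - int i" and j = "\<lambda>z. nat (?u - z)"])
      (auto simp: nth_unit_def of_nat_diff)
  also have "\<dots> = fact ?n" by (simp add: fact_prod)
  finally have eq: "poly (newton_poly p k) (?u ^ 2) * c = fact ?n" using c(2) by simp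
  obtain d where d: "fact ?n = int p ^ ?v * d" "coprime d (int p)"
  proof -
    have nu: "\<not> is_unit p" using p by auto
    obtain d where d: "(fact ?n :: nat) = p ^ multiplicity p (fact ?n :: nat) * d" "\<not> p dvd d"
      using multiplicity_decompose'[of "fact ?n :: nat" p] nu by auto
    have "fact ?n = int (fact ?n)" by simp
    also have "\<dots> = int p ^ ?v * int d"
      unfolding multiplicity_C_coeff_nth_unit[OF p] by (subst d(1)) simp
    finally have "fact ?n = int p ^ ?v * int d" .
    moreover have "coprime (int d) (int p)" using d(2) coprime_int_prime_iff[OF p] by simp
    ultimately show ?thesis using that by blast
  qed
  obtain e where e: "poly (newton_poly p k) (?u ^ 2) = int p ^ ?v * e"
    using newton_poly_dvd[OF p coprime_nth_unit[OF p]] by blast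
  have "e * c = d" using eq unfolding d(1) e using p by (auto simp: prime_gt_0_nat)
  then have "coprime e (int p)" using d(2) by auto
  then show ?thesis using e that by blast
qed

lemma newton_poly_nth_unit_eq_0: "i < k \<Longrightarrow> poly (newton_poly p k) (int (nth_unit p i) ^ 2) = 0"
  unfolding newton_poly_def poly_prod by (intro prod_zero) auto

text \<open>The Newton polynomials are monic, one in each degree, so leading terms are stripped
  without division. The disjunct \<open>P = 0\<close> covers d = 0, where no degree is below
  d.\<close>

lemma newton_expansion:
  fixes P :: "int poly"
  assumes "P = 0 \<or> Polynomial.degree P < d"
  obtains a where "P = (\<Sum>i<d. Polynomial.smult (a i) (newton_poly p i))"
  using assms
proof (induction d arbitrary: P thesis)
  case (Suc d)
  let ?R = "P - Polynomial.smult (poly.coeff P d) (newton_poly p d)"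
  have "?R = 0 \<or> Polynomial.degree ?R < d"
  proof (rule disj_imp[THEN iffD2, OF impI])
    assume nz: "?R \<noteq> 0"
    have deg: "Polynomial.degree ?R \<le> d"
      using Suc.prems(2) degree_newton_poly[of p d] degree_smult_le[of "poly.coeff P d" "newton_poly p d"]
      by (intro degree_diff_le) auto
    have "poly.coeff ?R d = 0"
      using lead_coeff_newton_poly[of p d] by (simp add: degree_newton_poly)
    then have "Polynomial.degree ?R \<noteq> d" using nz by (metis leading_coeff_0_iff)
    then show "Polynomial.degree ?R < d" using deg by simp
  qed
  then obtain a where a: "?R = (\<Sum>i<d. Polynomial.smult (a i) (newton_poly p i))"
    using Suc.IH by blast
  have "P = (\<Sum>i<Suc d. Polynomial.smult ((a(d := poly.coeff P d)) i) (newton_poly p i))"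
  proof -
    have "P = ?R + Polynomial.smult (poly.coeff P d) (newton_poly p d)" by simp
    also have "?R = (\<Sum>i<d. Polynomial.smult ((a(d := poly.coeff P d)) i) (newton_poly p i))"
      unfolding a by (intro sum.cong refl) auto
    finally show ?thesis by simp
  qed
  then show ?case using Suc.prems(1) by blast
qed auto

text \<open>Evaluation at the squared k-th unit is triangular: the terms after k vanish, those
  before k are divisible by induction, and the k-th is \<open>a k\<close> times the prime power
  times a unit.\<close>

lemma newton_coeff_dvd:
  assumes p: "prime p"
    and P: "\<And>x. coprime x (int p) \<Longrightarrow> int p ^ r dvd poly (\<Sum>i<d. Polynomial.smult (a i) (newton_poly p i)) (x ^ 2)"
    and k: "k < d"
  shows "int p ^ r dvd a k * int p ^ multiplicity p (C_coeff p k)"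
  using k
proof (induction k rule: less_induct)
  case (less k)
  let ?u = "int (nth_unit p k) ^ 2"
  let ?t = "\<lambda>i. a i * poly (newton_poly p i) ?u"
  have "(\<Sum>i<d. ?t i) = (\<Sum>i<Suc k. ?t i)"
  proof (rule sum.mono_neutral_right)
    show "\<forall>i\<in>{..<d} - {..<Suc k}. ?t i = 0"
      using newton_poly_nth_unit_eq_0[of k _ p] by auto
  qed (use less.prems in auto)
  then have "int p ^ r dvd (\<Sum>i<k. ?t i) + ?t k"
    using P[OF coprime_nth_unit[OF p, of k]] by (simp add: poly_sum)
  moreover have "int p ^ r dvd (\<Sum>i<k. ?t i)"
  proof (rule dvd_sum)
    fix i assume "i \<in> {..<k}"
    then have "int p ^ r dvd a i * int p ^ multiplicity p (C_coeff p i)"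
      using less.IH[of i] less.prems by simp
    also have "\<dots> dvd ?t i"
      by (intro mult_dvd_mono dvd_refl newton_poly_dvd[OF p coprime_nth_unit[OF p]])
    finally show "int p ^ r dvd ?t i" .
  qed
  ultimately have "int p ^ r dvd ?t k" by (simp add: dvd_add_right_iff)
  moreover obtain c where "coprime c (int p)"
      "poly (newton_poly p k) ?u = int p ^ multiplicity p (C_coeff p k) * c"
    using newton_poly_nth_unit[OF p] by blast
  ultimately have "int p ^ r dvd (a k * int p ^ multiplicity p (C_coeff p k)) * c"
    by (simp add: mult.assoc)
  then show ?case
    using \<open>coprime c (int p)\<close> by (simp add: coprime_commute coprime_dvd_mult_left_iff)
qed

section \<open>Linear functionals on integer polynomials given by their moments\<close>

definition moment_functional :: "(nat \<Rightarrow> int) \<Rightarrow> int poly \<Rightarrow> int" where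
  "moment_functional y P = (\<Sum>i\<le>Polynomial.degree P. poly.coeff P i * y i)"

lemma moment_functional_eq:
  assumes "Polynomial.degree P < d"
  shows "moment_functional y P = (\<Sum>i<d. poly.coeff P i * y i)"
  unfolding moment_functional_def
  by (rule sum.mono_neutral_left) (use assms in \<open>auto simp: coeff_eq_0\<close>)

lemma moment_functional_add: "moment_functional y (P + Q) = moment_functional y P + moment_functional y Q"
proof -
  let ?d = "Suc (max (Polynomial.degree P) (Polynomial.degree Q))"
  have "Polynomial.degree (P + Q) < ?d" "Polynomial.degree P < ?d" "Polynomial.degree Q < ?d"
    using degree_add_le_max[of P Q] by auto
  then show ?thesis by (simp add: moment_functional_eq sum.distrib algebra_simps del: sum.lessThan_Suc)
qed

lemma moment_functional_smult: "moment_functional y (Polynomial.smult c P) = c * moment_functional y P"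
proof -
  have "Polynomial.degree (Polynomial.smult c P) < Suc (Polynomial.degree P)"
    by (simp add: degree_smult_le le_imp_less_Suc)
  then show ?thesis
    by (simp add: moment_functional_eq[where d = "Suc (Polynomial.degree P)"] sum_distrib_left algebra_simps
        del: sum.lessThan_Suc)
qed

lemma moment_functional_diff: "moment_functional y (P - Q) = moment_functional y P - moment_functional y Q"
  using moment_functional_add[of y "P - Q" Q] by simp

lemma moment_functional_sum: "moment_functional y (\<Sum>i\<in>A. P i) = (\<Sum>i\<in>A. moment_functional y (P i))"
  by (induction A rule: infinite_finite_induct)
    (simp_all add: moment_functional_add, simp_all add: moment_functional_def)

lemma moment_functional_monom: "moment_functional y (Polynomial.monom c i) = c * y i"
  by (subst moment_functional_eq[where d = "Suc i"]) (auto simp: degree_monom_le le_imp_less_Suc if_distrib cong: if_cong)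

text \<open>In the Newton expansion of P, p^r divides \<open>a i * ?w i\<close> by
  \<open>newton_coeff_dvd\<close>, so it suffices that \<open>?w i\<close> divides the functional at
  N_i. This is transferred from \<open>Q\<close> by induction: \<open>Q k\<close> - N_k has degree
  below k and values divisible by \<open>?w k\<close> at units, so it is a combination of earlier
  N_i to which the same argument applies.\<close>

lemma moment_functional_dvd:
  assumes p: "prime p"
    and Q: "\<And>k. Polynomial.degree (Q k) = k" "\<And>k. Polynomial.lead_coeff (Q k) = 1"
      "\<And>k x. coprime x (int p) \<Longrightarrow> int p ^ multiplicity p (C_coeff p k) dvd poly (Q k) (x ^ 2)"
      "\<And>k. int p ^ multiplicity p (C_coeff p k) dvd moment_functional y (Q k)"
    and P: "\<And>x. coprime x (int p) \<Longrightarrow> int p ^ r dvd poly P (x ^ 2)"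
  shows "int p ^ r dvd moment_functional y P"
proof -
  let ?w = "\<lambda>k. int p ^ multiplicity p (C_coeff p k)"
  \<comment> \<open>Used for two moduli: \<open>?w k\<close> when \<open>Q k\<close> is compared
    with N_k, and the given p^r for P.\<close>
  have dvd_combination: "int p ^ r dvd moment_functional y (\<Sum>i<d. Polynomial.smult (a i) (newton_poly p i))"
    if N: "\<And>i. i < d \<Longrightarrow> ?w i dvd moment_functional y (newton_poly p i)"
      and R: "\<And>x. coprime x (int p) \<Longrightarrow>
        int p ^ r dvd poly (\<Sum>i<d. Polynomial.smult (a i) (newton_poly p i)) (x ^ 2)" for a d r
    unfolding moment_functional_sum moment_functional_smult
  proof (rule dvd_sum)
    fix i assume i: "i \<in> {..<d}"
    have "int p ^ r dvd a i * ?w i"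
      using newton_coeff_dvd[OF p R] i by simp
    also have "\<dots> dvd a i * moment_functional y (newton_poly p i)"
      using N i by (intro mult_dvd_mono) auto
    finally show "int p ^ r dvd a i * moment_functional y (newton_poly p i)" .
  qed
  have N: "?w k dvd moment_functional y (newton_poly p k)" for k
  proof (induction k rule: less_induct)
    case (less k)
    let ?D = "Q k - newton_poly p k"
    have "?D = 0 \<or> Polynomial.degree ?D < k"
    proof (rule disj_imp[THEN iffD2, OF impI])
      assume nz: "?D \<noteq> 0"
      have "Polynomial.degree ?D \<le> k"
        by (intro degree_diff_le) (simp_all add: Q(1) degree_newton_poly)
      moreover have "poly.coeff ?D k = 0"
        using Q(1,2)[of k] lead_coeff_newton_poly[of p k] by (simp add: degree_newton_poly)
      then have "Polynomial.degree ?D \<noteq> k" using nz by (metis leading_coeff_0_iff)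
      ultimately show "Polynomial.degree ?D < k" by simp
    qed
    then obtain a where a: "?D = (\<Sum>i<k. Polynomial.smult (a i) (newton_poly p i))"
      using newton_expansion by blast
    have "?w k dvd moment_functional y ?D"
      unfolding a
    proof (rule dvd_combination)
      fix x assume "coprime x (int p)"
      then have "?w k dvd poly ?D (x ^ 2)"
        using Q(3)[of x k] newton_poly_dvd[OF p, of x k] by (simp add: dvd_diff)
      then show "?w k dvd poly (\<Sum>i<k. Polynomial.smult (a i) (newton_poly p i)) (x ^ 2)"
        unfolding a .
    qed (use less.IH in auto)
    moreover have "moment_functional y (newton_poly p k) = moment_functional y (Q k) - moment_functional y ?D"
      by (simp add: moment_functional_diff)
    ultimately show ?case using Q(4)[of k] by (simp add: dvd_diff)
  qed
  define d where "d = Suc (Polynomial.degree P)"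
  obtain a where a: "P = (\<Sum>i<d. Polynomial.smult (a i) (newton_poly p i))"
    using newton_expansion[of P d] by (auto simp: d_def)
  show ?thesis
    unfolding a by (rule dvd_combination[OF N]) (use P in \<open>simp only: a\<close>)
qed

subsection \<open>Approximation by even polynomials\<close>

text \<open>For 0 < i < p^N the valuation of i is below N, so y + i has the same valuation as i when
  p^N divides y.\<close>

lemma pochhammer_unit_part:
  fixes y :: int
  assumes p: "prime p" and y: "int p ^ N dvd y"
  obtains c where "coprime c (int p)"
    "pochhammer (y + 1) (p ^ N - 1) = int p ^ multiplicity p (fact (p ^ N - 1) :: nat) * c"
proof -
  let ?n = "p ^ N - 1"
  have factor: "\<exists>c. coprime c (int p) \<and> y + 1 + int i = int p ^ multiplicity p (Suc i) * c" if i: "i < ?n" for i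
  proof -
    let ?v = "multiplicity p (Suc i)"
    obtain d where d: "Suc i = p ^ ?v * d" "\<not> p dvd d"
      using multiplicity_decompose'[of "Suc i" p] p by (metis Zero_not_Suc not_prime_unit)
    have "?v < N"
    proof (rule ccontr)
      assume "\<not> ?v < N"
      then have "p ^ N dvd Suc i" using multiplicity_dvd' not_less by blast
      then have "p ^ N \<le> Suc i" by (rule dvd_imp_le) simp
      then show False using i by linarith
    qed
    then have "int p ^ Suc ?v dvd y" using y by (meson Suc_leI dvd_trans le_imp_power_dvd)
    then obtain e where e: "y = int p ^ Suc ?v * e" by blast
    have "y + 1 + int i = y + int (p ^ ?v * d)"
      by (subst d(1)[symmetric]) simp
    also have "\<dots> = int p ^ ?v * (int p * e + int d)"
      unfolding e by (simp add: algebra_simps)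
    finally have "y + 1 + int i = int p ^ ?v * (int p * e + int d)" .
    moreover have "coprime (int p * e + int d) (int p)"
      unfolding coprime_int_prime_iff[OF p] using d(2) by (simp add: dvd_add_right_iff)
    ultimately show ?thesis by blast
  qed
  then obtain c where c: "coprime (c i) (int p)" "y + 1 + int i = int p ^ multiplicity p (Suc i) * c i"
    if "i < ?n" for i
    by metis
  have "multiplicity p (fact ?n :: nat) = (\<Sum>i<?n. multiplicity p (Suc i))"
    unfolding fact_prod_Suc lessThan_atLeast0[symmetric] of_nat_id
    using p by (intro prime_elem_multiplicity_prod_distrib) auto
  moreover have "pochhammer (y + 1) ?n = (\<Prod>i<?n. int p ^ multiplicity p (Suc i) * c i)"
    unfolding pochhammer_prod lessThan_atLeast0[symmetric] using c(2) by (intro prod.cong refl) simp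
  ultimately have "pochhammer (y + 1) ?n = int p ^ multiplicity p (fact ?n :: nat) * (\<Prod>i<?n. c i)"
    by (simp add: prod.distrib power_sum)
  moreover have "coprime (\<Prod>i<?n. c i) (int p)"
    using c(1) by (intro prod_coprime_left) auto
  ultimately show ?thesis using that by blast
qed

text \<open>Multiplied by y, the product runs over p^N consecutive integers and is divisible by
  (p^N)!, hence by p^(N + ?s). As y has valuation below N, at least ?s + 1 factors p remain. With
  \<open>pochhammer_unit_part\<close>: the binomial coefficient of y + p^N - 1 over p^N - 1 is prime
  to p exactly when p^N divides y.\<close>

lemma pochhammer_dvd:
  fixes y :: int
  assumes p: "prime p" and y: "\<not> int p ^ N dvd y"
  shows "int p ^ Suc (multiplicity p (fact (p ^ N - 1) :: nat)) dvd pochhammer (y + 1) (p ^ N - 1)"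
proof -
  let ?s = "multiplicity p (fact (p ^ N - 1) :: nat)"
  let ?V = "pochhammer (y + 1) (p ^ N - 1)"
  have p0: "p > 0" using p by (rule prime_gt_0_nat)
  have pN: "p ^ N = Suc (p ^ N - 1)" using p0 by simp
  have "y \<noteq> 0" using y by auto
  then obtain c where c: "y = int p ^ multiplicity (int p) y * c" "\<not> int p dvd c"
    using multiplicity_decompose'[of y "int p"] p by (metis not_prime_unit prime_nat_int_transfer)
  define w where "w = multiplicity (int p) y"
  have w: "w < N"
    using y unfolding w_def by (meson multiplicity_dvd' not_less)
  have "int p ^ (N + ?s) dvd fact (p ^ N)"
  proof -
    have "(fact (p ^ N) :: nat) = p ^ N * fact (p ^ N - 1)"
      using fact_reduce[of "p ^ N", where 'a = nat] p0 by simp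
    then have "p ^ (N + ?s) dvd (fact (p ^ N) :: nat)"
      by (simp add: power_add multiplicity_dvd)
    then have "int (p ^ (N + ?s)) dvd int (fact (p ^ N))" by (simp only: int_dvd_int_iff)
    then show ?thesis by simp
  qed
  also have "fact (p ^ N) dvd pochhammer y (p ^ N)" by (rule fact_dvd_pochhammer)
  also have "pochhammer y (p ^ N) = y * ?V"
    by (subst (1) pN, subst pochhammer_rec) (simp flip: pN)
  also have "y * ?V = int p ^ w * (c * ?V)"
    by (subst c(1)) (simp only: w_def mult.assoc)
  finally have "int p ^ (N + ?s) dvd int p ^ w * (c * ?V)" .
  moreover have "int p ^ (N + ?s) = int p ^ w * int p ^ (N + ?s - w)"
    using w by (simp flip: power_add)
  ultimately have "int p ^ (N + ?s - w) dvd c * ?V"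
    using p0 by simp
  moreover have "Suc ?s \<le> N + ?s - w" using w by linarith
  ultimately have "int p ^ Suc ?s dvd c * ?V"
    by (meson dvd_trans le_imp_power_dvd)
  moreover have "coprime c (int p ^ Suc ?s)"
    using c(2) coprime_int_prime_iff[OF p, of c] by simp
  ultimately show ?thesis
    by (simp add: coprime_commute coprime_dvd_mult_right_iff)
qed

lemma poly_even_part:
  fixes F :: "int poly"
  obtains H where "\<And>x. poly F x + poly F (- x) = poly H (x ^ 2)"
proof -
  have "\<exists>G H. \<forall>x. poly F x = poly G (x ^ 2) + x * poly H (x ^ 2)"
  proof (induction F)
    case (pCons a F)
    then obtain G H where "\<And>x. poly F x = poly G (x ^ 2) + x * poly H (x ^ 2)" by blast
    then have "poly (pCons a F) x = poly (pCons a H) (x ^ 2) + x * poly G (x ^ 2)" for x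
      by (simp add: algebra_simps power2_eq_square)
    then show ?case by blast
  qed (metis add.right_neutral mult_zero_right poly_0)
  then obtain G H where "\<And>x. poly F x = poly G (x ^ 2) + x * poly H (x ^ 2)" by blast
  then have "poly F x + poly F (- x) = poly (Polynomial.smult 2 G) (x ^ 2)" for x by simp
  then show ?thesis using that by blast
qed

text \<open>The exponent in Euler's theorem for p^n is large enough to kill multiples of p modulo
  p^n as well.\<close>

lemma totient_prime_power_ge:
  assumes "prime p"
  shows "n \<le> totient (p ^ n)"
proof (cases n)
  case (Suc k)
  have "k < p ^ k" using less_power_self prime_ge_2_nat[OF assms] by blast
  also have "p ^ k \<le> p ^ k * (p - 1)" using prime_ge_2_nat[OF assms] by simp
  finally show ?thesis unfolding Suc totient_prime_power_Suc[OF assms] by simp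
qed simp

lemma euler_theorem_int:
  assumes "coprime c (int m)" "m > 0"
  shows "[c ^ totient m = 1] (mod int m)"
proof -
  obtain c' where c': "c mod int m = int c'"
    using assms(2) by (metis of_nat_0_less_iff pos_mod_sign nonneg_int_cases)
  then have cong: "[c = int c'] (mod int m)" by (metis cong_mod_right cong_refl)
  then have "coprime c' m" using assms(1) by (metis cong_imp_coprime coprime_int_iff)
  then have "[int (c' ^ totient m) = int 1] (mod int m)"
    by (simp only: cong_int_iff euler_theorem)
  then show ?thesis using cong_trans[OF cong_pow[OF cong]] by simp
qed

text \<open>\<open>g\<close> agrees with P(x^2) / p^r modulo p^n; multiplying through by p^r keeps P
  integral. Integers prime to p are dense in the units, so they suffice as test points.\<close>

definition approximable :: "nat \<Rightarrow> nat \<Rightarrow> (int \<Rightarrow> int) \<Rightarrow> bool" where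
  "approximable p n g \<longleftrightarrow> (\<exists>P r. \<forall>x. coprime x (int p) \<longrightarrow>
     int p ^ (r + n) dvd poly P (x ^ 2) - int p ^ r * g x)"

lemma approximable_0: "approximable p n (\<lambda>x. 0)"
  unfolding approximable_def by (rule exI[of _ 0], rule exI[of _ 0]) simp

lemma approximable_add:
  assumes "approximable p n f" "approximable p n g"
  shows "approximable p n (\<lambda>x. f x + g x)"
proof -
  obtain P r P' r' where
    P: "\<And>x. coprime x (int p) \<Longrightarrow> int p ^ (r + n) dvd poly P (x ^ 2) - int p ^ r * f x" and
    P': "\<And>x. coprime x (int p) \<Longrightarrow> int p ^ (r' + n) dvd poly P' (x ^ 2) - int p ^ r' * g x"
    using assms unfolding approximable_def by blast
  let ?R = "Polynomial.smult (int p ^ r') P + Polynomial.smult (int p ^ r) P'"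
  have "int p ^ ((r + r') + n) dvd poly ?R (x ^ 2) - int p ^ (r + r') * (f x + g x)"
    if x: "coprime x (int p)" for x
  proof -
    have "poly ?R (x ^ 2) - int p ^ (r + r') * (f x + g x)
      = int p ^ r' * (poly P (x ^ 2) - int p ^ r * f x) + int p ^ r * (poly P' (x ^ 2) - int p ^ r' * g x)"
      by (simp add: algebra_simps power_add)
    moreover have "int p ^ ((r + r') + n) dvd int p ^ r' * (poly P (x ^ 2) - int p ^ r * f x)"
      using mult_dvd_mono[OF dvd_refl P[OF x], of "int p ^ r'"] by (simp add: power_add ac_simps)
    moreover have "int p ^ ((r + r') + n) dvd int p ^ r * (poly P' (x ^ 2) - int p ^ r' * g x)"
      using mult_dvd_mono[OF dvd_refl P'[OF x], of "int p ^ r"] by (simp add: power_add ac_simps)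
    ultimately show ?thesis by simp
  qed
  then show ?thesis unfolding approximable_def by blast
qed

lemma approximable_mult_left:
  assumes "approximable p n f"
  shows "approximable p n (\<lambda>x. c * f x)"
proof -
  obtain P r where
    P: "\<And>x. coprime x (int p) \<Longrightarrow> int p ^ (r + n) dvd poly P (x ^ 2) - int p ^ r * f x"
    using assms unfolding approximable_def by blast
  have "int p ^ (r + n) dvd poly (Polynomial.smult c P) (x ^ 2) - int p ^ r * (c * f x)"
    if x: "coprime x (int p)" for x
    using dvd_mult[OF P[OF x], of c] by (simp add: algebra_simps)
  then show ?thesis unfolding approximable_def by blast
qed

lemma approximable_sum:
  "(\<And>i. i \<in> A \<Longrightarrow> approximable p n (f i)) \<Longrightarrow> approximable p n (\<lambda>x. \<Sum>i\<in>A. f i x)"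
  by (induction A rule: infinite_finite_induct) (simp_all add: approximable_0 approximable_add)

lemma approximable_indicator:
  assumes p: "prime p" and N: "N \<ge> 2" and a: "coprime a (int p)"
  shows "approximable p n (\<lambda>x. of_bool (int p ^ N dvd x - a \<or> int p ^ N dvd x + a))"
proof -
  \<comment> \<open>\<open>F x\<close> is \<open>p ^ ?s\<close> times a unit if \<open>x\<close> is congruent to \<open>a\<close> modulo \<open>p ^ N\<close>, and divisible by \<open>p ^ Suc ?s\<close> otherwise.
    Taking the power \<open>totient (p ^ n)\<close> makes the unit \<open>1\<close> and the rest \<open>0\<close> modulo \<open>p ^ n\<close>.\<close>
  let ?s = "multiplicity p (fact (p ^ N - 1) :: nat)"
  define F where "F = (\<Prod>i<p ^ N - 1. [:1 + int i - a, 1:])"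
  obtain H where H: "\<And>x. poly F x + poly F (- x) = poly H (x ^ 2)" using poly_even_part by blast
  have F: "poly F x = pochhammer (x - a + 1) (p ^ N - 1)" for x
    unfolding F_def poly_prod pochhammer_prod lessThan_atLeast0[symmetric]
    by (intro prod.cong refl) (simp add: algebra_simps)
  have F_unit: "\<exists>c. coprime c (int p) \<and> poly F x = int p ^ ?s * c" if "int p ^ N dvd x - a" for x
    using pochhammer_unit_part[OF p that] unfolding F by metis
  have F_dvd: "int p ^ Suc ?s dvd poly F x" if "\<not> int p ^ N dvd x - a" for x
    using pochhammer_dvd[OF p that] unfolding F .
  \<comment> \<open>\<open>N \<ge> 2\<close> gives p^N >= 4, so a and -a lie in different classes
    even for p = 2. Hence F(x) and F(-x) never both have the exact valuation \<open>?s\<close>, and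
    their sum keeps it when one of them has it.\<close>
  have distinct: "\<not> int p ^ N dvd 2 * a"
  proof
    assume "int p ^ N dvd 2 * a"
    moreover have "coprime a (int p ^ N)" using a by simp
    ultimately have "int p ^ N dvd 2" by (simp add: coprime_commute coprime_dvd_mult_left_iff)
    then have "int p ^ N \<le> 2" by (rule zdvd_imp_le) simp
    moreover have "int p ^ N \<ge> 2 ^ 2"
      using prime_ge_2_nat[OF p] N power_mono[of 2 "int p" N] power_increasing[of 2 N "2::int"] by linarith
    ultimately show False by simp
  qed
  have unit: "\<exists>c. coprime c (int p) \<and> poly H (x ^ 2) = int p ^ ?s * c" if x: "int p ^ N dvd x - a" for x
  proof -
    obtain c where c: "coprime c (int p)" "poly F x = int p ^ ?s * c" using F_unit[OF x] by blast
    have "\<not> int p ^ N dvd - x - a"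
    proof
      assume "int p ^ N dvd - x - a"
      then have "int p ^ N dvd (x - a) + (- x - a)" using x by (rule dvd_add[rotated])
      then have "int p ^ N dvd - (2 * a)" by simp
      then show False using distinct by (simp only: dvd_minus_iff)
    qed
    from F_dvd[OF this] obtain d where d: "poly F (- x) = int p ^ Suc ?s * d" by blast
    have "poly H (x ^ 2) = int p ^ ?s * (int p * d + c)"
      unfolding H[symmetric] c(2) d by (simp add: algebra_simps)
    moreover have "coprime (int p * d + c) (int p)"
      using c(1) unfolding coprime_int_prime_iff[OF p] by (simp add: dvd_add_right_iff)
    ultimately show ?thesis by blast
  qed
  let ?t = "totient (p ^ n)"
  have "int p ^ ((?s * ?t) + n) dvd poly (H ^ ?t) (x ^ 2)
    - int p ^ (?s * ?t) * of_bool (int p ^ N dvd x - a \<or> int p ^ N dvd x + a)" for x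
  proof (cases "int p ^ N dvd x - a \<or> int p ^ N dvd x + a")
    case True
    have "\<exists>c. coprime c (int p) \<and> poly H (x ^ 2) = int p ^ ?s * c"
      using True
    proof
      assume "int p ^ N dvd x + a"
      then have "int p ^ N dvd - x - a" by (metis dvd_minus_iff minus_add_distrib uminus_add_conv_diff add.commute minus_diff_eq diff_minus_eq_add)
      then show ?thesis using unit[of "- x"] by simp
    qed (rule unit)
    then obtain c where c: "coprime c (int p)" "poly H (x ^ 2) = int p ^ ?s * c" by blast
    have "[c ^ ?t = 1] (mod (int (p ^ n)))"
    proof -
      have "coprime c (int (p ^ n))" using c(1) by simp
      then show ?thesis using prime_gt_0_nat[OF p] by (intro euler_theorem_int) auto
    qed
    then have "int p ^ n dvd c ^ ?t - 1" by (simp add: cong_iff_dvd_diff)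
    then have "int p ^ (?s * ?t) * int p ^ n dvd int p ^ (?s * ?t) * (c ^ ?t - 1)"
      by (intro mult_dvd_mono dvd_refl)
    also have "int p ^ (?s * ?t) * (c ^ ?t - 1) = poly (H ^ ?t) (x ^ 2) - int p ^ (?s * ?t)"
      unfolding poly_power c(2) power_mult_distrib power_mult by (simp only: right_diff_distrib mult_1_right)
    finally show ?thesis using True by (simp add: power_add)
  next
    case False
    have "int p ^ Suc ?s dvd poly F x" using False by (intro F_dvd) blast
    moreover have "\<not> int p ^ N dvd - x - a"
      using False by (metis dvd_minus_iff minus_diff_eq diff_minus_eq_add add.commute)
    then have "int p ^ Suc ?s dvd poly F (- x)" by (rule F_dvd)
    ultimately have "int p ^ Suc ?s dvd poly H (x ^ 2)" unfolding H[symmetric] by (rule dvd_add)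
    then have "(int p ^ Suc ?s) ^ ?t dvd poly H (x ^ 2) ^ ?t" by (rule dvd_power_same)
    moreover have "int p ^ (?s * ?t + n) dvd (int p ^ Suc ?s) ^ ?t"
      unfolding power_mult[symmetric] using totient_prime_power_ge[OF p, of n]
      by (intro le_imp_power_dvd) (simp add: add.commute)
    ultimately show ?thesis using False by (auto intro: dvd_trans)
  qed
  then show ?thesis unfolding approximable_def by blast
qed

text \<open>An even function that depends only on x modulo M is a finite combination of indicators
  of the sets of x congruent to b or -b.\<close>

lemma approximable_locally_constant:
  assumes p: "prime p"
    and even: "\<And>x. coprime x (int p) \<Longrightarrow> g (- x) = g x"
    and loc: "\<And>x y. coprime x (int p) \<Longrightarrow> coprime y (int p) \<Longrightarrow> int p ^ N dvd x - y \<Longrightarrow> g x = g y"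
  shows "approximable p n g"
proof -
  \<comment> \<open>The summand 2 meets the requirement \<open>N \<ge> 2\<close> of
    \<open>approximable_indicator\<close>.\<close>
  define M where "M = int p ^ (N + 2)"
  \<comment> \<open>The smaller of the two residues picks one representative from each pair of
    opposite classes, so no pair is counted twice.\<close>
  define rep where "rep x = min (x mod M) ((- x) mod M)" for x
  define B where "B = {b \<in> {0..<M}. coprime b (int p) \<and> rep b = b}"
  have M: "M > 0" using prime_gt_0_nat[OF p] by (simp add: M_def)
  have "finite B" unfolding B_def by (rule finite_subset[of _ "{0..<M}"]) auto
  have coprime_mod: "coprime (x mod M) (int p) \<longleftrightarrow> coprime x (int p)" for x
  proof -
    have "int p dvd M" by (simp add: M_def)
    then show ?thesis unfolding coprime_int_prime_iff[OF p] by (simp add: dvd_mod_iff)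
  qed
  have rep_cong: "rep x = rep y" if "M dvd x - y \<or> M dvd x + y" for x y
    using that
  proof
    assume "M dvd x - y"
    then have "x mod M = y mod M" by (simp add: mod_eq_dvd_iff)
    moreover from this have "(- x) mod M = (- y) mod M" by (metis mod_minus_eq)
    ultimately show ?thesis by (simp add: rep_def)
  next
    assume "M dvd x + y"
    then have "x mod M = (- y) mod M" by (simp add: mod_eq_dvd_iff)
    moreover from this have "(- x) mod M = y mod M" by (metis mod_minus_eq minus_minus)
    ultimately show ?thesis by (simp add: rep_def min.commute)
  qed
  have rep_cases: "M dvd x - rep x \<or> M dvd x + rep x" for x
  proof -
    have "rep x = x mod M \<or> rep x = (- x) mod M" by (simp add: rep_def min_def)
    then show ?thesis
    proof
      assume "rep x = x mod M"
      then show ?thesis by (simp add: dvd_minus_mod)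
    next
      assume 2: "rep x = (- x) mod M"
      have "M dvd - x - (- x) mod M" by (rule dvd_minus_mod)
      then have "M dvd - (- x - (- x) mod M)" by (simp only: dvd_minus_iff)
      then have "M dvd x + rep x" unfolding 2 by (simp only: minus_diff_eq minus_minus diff_minus_eq_add add.commute)
      then show ?thesis ..
    qed
  qed
  have rep_B: "rep x \<in> B" if "coprime x (int p)" for x
  proof -
    have "coprime (rep x) (int p)"
      using that coprime_mod[of x] coprime_mod[of "- x"] by (auto simp: rep_def min_def)
    moreover have "rep (rep x) = rep x" using rep_cong[OF rep_cases] by simp
    moreover have "rep x \<in> {0..<M}" using M by (auto simp: rep_def min_def)
    ultimately show ?thesis by (simp add: B_def)
  qed
  have g_rep: "g (rep x) = g x" if x: "coprime x (int p)" for x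
  proof -
    have c: "coprime (rep x) (int p)" using rep_B[OF x] by (simp add: B_def)
    have MN: "int p ^ N dvd M" by (simp add: M_def power_add)
    show ?thesis using rep_cases[of x]
    proof
      assume "M dvd x - rep x"
      then show ?thesis using loc[OF x c] MN by (metis dvd_trans)
    next
      assume "M dvd x + rep x"
      then have "int p ^ N dvd x - (- rep x)" using MN by (simp add: dvd_trans)
      then have "g x = g (- rep x)" using loc[OF x] c by simp
      then show ?thesis using even[OF c] by simp
    qed
  qed
  have "approximable p n (\<lambda>x. \<Sum>b\<in>B. g b * of_bool (M dvd x - b \<or> M dvd x + b))"
    unfolding M_def
    by (intro approximable_sum approximable_mult_left approximable_indicator[OF p]) (auto simp: B_def)
  moreover have "(\<Sum>b\<in>B. g b * of_bool (M dvd x - b \<or> M dvd x + b)) = g x" if x: "coprime x (int p)" for x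
  proof -
    have "(M dvd x - b \<or> M dvd x + b) \<longleftrightarrow> b = rep x" if "b \<in> B" for b
      using that rep_cong[of x b] rep_cases[of x] by (auto simp: B_def)
    then have "(\<Sum>b\<in>B. g b * of_bool (M dvd x - b \<or> M dvd x + b)) = (\<Sum>b\<in>B. if b = rep x then g b else 0)"
      by (intro sum.cong refl) simp
    also have "\<dots> = g (rep x)"
      using rep_B[OF x] \<open>finite B\<close> by (simp add: sum.delta)
    finally show ?thesis using g_rep[OF x] by simp
  qed
  ultimately show ?thesis
    unfolding approximable_def by (metis (no_types, lifting))
qed

subsection \<open>Continuous functions on the units modulo sign\<close>

definition orbit :: "nat \<Rightarrow> (nat \<Rightarrow> int) \<Rightarrow> (nat \<Rightarrow> int) set" where
  "orbit p x = {x, \<ominus>\<^bsub>padic_ints p\<^esub> x}"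

lemma padic_mod:
  assumes "x \<in> carrier (padic_ints p)" "i \<le> n"
  shows "x n mod int p ^ i = x i"
  using assms(2)
proof (induction n rule: dec_induct)
  case base
  then show ?case using assms(1) by (simp add: padic_ints_carrier_iff)
next
  case (step n)
  have "x (Suc n) mod int p ^ i = x (Suc n) mod int p ^ n mod int p ^ i"
    using step.hyps by (simp add: mod_mod_cancel le_imp_power_dvd)
  then show ?case using step.IH assms(1) by (simp add: padic_ints_carrier_iff)
qed

lemma padic_bounds:
  assumes "x \<in> carrier (padic_ints p)"
  shows "0 \<le> x n" "x n < int p ^ n"
  using assms by (auto simp: padic_ints_carrier_iff)

lemma padic_add: "(x \<oplus>\<^bsub>padic_ints p\<^esub> y) n = (x n + y n) mod int p ^ n"
  by (simp add: padic_ints_def)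

lemma padic_mult: "(x \<otimes>\<^bsub>padic_ints p\<^esub> y) n = (x n * y n) mod int p ^ n"
  by (simp add: padic_ints_def)

lemma padic_one: "\<one>\<^bsub>padic_ints p\<^esub> n = 1 mod int p ^ n"
  by (simp add: padic_ints_def)

lemma padic_zero: "\<zero>\<^bsub>padic_ints p\<^esub> n = 0"
  by (simp add: padic_ints_def)

lemma padic_pow: "(x [^]\<^bsub>padic_ints p\<^esub> (k::nat)) n = x n ^ k mod int p ^ n"
proof (induction k)
  case 0
  then show ?case by (simp add: nat_pow_def padic_one)
next
  case (Suc k)
  have "(x [^]\<^bsub>padic_ints p\<^esub> Suc k) n = (x [^]\<^bsub>padic_ints p\<^esub> k \<otimes>\<^bsub>padic_ints p\<^esub> x) n"
    by (simp add: nat_pow_def)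
  also have "\<dots> = x n ^ k * x n mod int p ^ n"
    unfolding padic_mult Suc by (simp add: mod_simps)
  finally show ?case by (simp add: mult.commute)
qed

lemma padic_minus:
  assumes "p > 0" and x: "x \<in> carrier (padic_ints p)"
  shows "(\<ominus>\<^bsub>padic_ints p\<^esub> x) n = (- x n) mod int p ^ n"
proof -
  interpret cring "padic_ints p" by (rule cring_padic_ints[OF assms(1)])
  let ?y = "\<ominus>\<^bsub>padic_ints p\<^esub> x"
  have y: "?y \<in> carrier (padic_ints p)" using x by simp
  have "?y \<oplus>\<^bsub>padic_ints p\<^esub> x = \<zero>\<^bsub>padic_ints p\<^esub>" using x by (rule l_neg)
  then have "(?y \<oplus>\<^bsub>padic_ints p\<^esub> x) n = 0" by (simp add: padic_zero)
  then have "int p ^ n dvd ?y n - (- x n)" by (simp add: padic_add dvd_eq_mod_eq_0)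
  then have "?y n mod int p ^ n = (- x n) mod int p ^ n" by (simp only: mod_eq_dvd_iff)
  then show ?thesis using padic_bounds[OF y] by simp
qed

lemma padic_of_int_minus:
  assumes "p > 0"
  shows "\<ominus>\<^bsub>padic_ints p\<^esub> padic_of_int p a = padic_of_int p (- a)"
  by (rule ext) (simp add: padic_minus[OF assms padic_of_int_carrier[OF assms]], simp add: padic_of_int_def mod_simps)

lemma orbit_padic_of_int_minus:
  assumes "p > 0"
  shows "orbit p (padic_of_int p (- a)) = orbit p (padic_of_int p a)"
  by (auto simp: orbit_def padic_of_int_minus[OF assms])

text \<open>Being prime to p lets every coordinate be inverted modulo p^n. Inverses modulo p^n are
  unique, so they are coherent and form a p-adic integer.\<close>

lemma Units_padic_ints:
  assumes p: "prime p"
  shows "Units (padic_ints p) = {x \<in> carrier (padic_ints p). coprime (x 1) (int p)}"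
proof (intro equalityI subsetI)
  fix x assume x: "x \<in> Units (padic_ints p)"
  then obtain y where y: "x \<otimes>\<^bsub>padic_ints p\<^esub> y = \<one>\<^bsub>padic_ints p\<^esub>" and xc: "x \<in> carrier (padic_ints p)"
    by (auto simp: Units_def)
  have "(x 1 * y 1) mod int p = 1 mod int p"
    using fun_cong[OF y, of 1] by (simp add: padic_mult padic_one)
  then have "[x 1 * y 1 = 1] (mod int p)" by (simp add: cong_def)
  then have "coprime (x 1) (int p)" by (metis coprime_iff_invertible_int)
  then show "x \<in> {x \<in> carrier (padic_ints p). coprime (x 1) (int p)}" using xc by simp
next
  fix x assume "x \<in> {x \<in> carrier (padic_ints p). coprime (x 1) (int p)}"
  then have x: "x \<in> carrier (padic_ints p)" and cop: "coprime (x 1) (int p)" by auto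
  interpret cring "padic_ints p" by (rule cring_padic_ints[OF prime_gt_0_nat[OF p]])
  have cop_n: "coprime (x n) (int p ^ n)" for n
  proof (cases n)
    case (Suc k)
    then have "x n mod int p = x 1" using padic_mod[OF x, of 1 n] by simp
    then have "coprime (x n mod int p) (int p)" using cop by simp
    then have "coprime (x n) (int p)" using prime_gt_0_nat[OF p] by simp
    then show ?thesis by simp
  qed simp
  then have "\<exists>z. [x n * z = 1] (mod int p ^ n)" for n by (rule cong_solve_coprime_int)
  then obtain z where z: "\<And>n. [x n * z n = 1] (mod int p ^ n)" by metis
  define y where "y n = z n mod int p ^ n" for n
  have yinv: "[x n * y n = 1] (mod int p ^ n)" for n
    using z[of n] unfolding y_def by (simp add: cong_def mod_simps)
  have "y (Suc n) mod int p ^ n = y n" for n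
  proof -
    have "[x (Suc n) * y (Suc n) = 1] (mod int p ^ n)"
      by (rule cong_dvd_modulus[OF yinv[of "Suc n"]]) simp
    moreover have "[x (Suc n) = x n] (mod int p ^ n)"
      using padic_mod[OF x, of n "Suc n"] padic_mod[OF x, of n n] by (simp add: cong_def)
    ultimately have "[x n * y (Suc n) = 1] (mod int p ^ n)"
      by (metis cong_scalar_right cong_sym cong_trans)
    then have "[x n * y (Suc n) = x n * y n] (mod int p ^ n)"
      using yinv[of n] by (metis cong_sym cong_trans)
    then have "[y (Suc n) = y n] (mod int p ^ n)"
      using cop_n[of n] by (simp add: cong_mult_lcancel)
    then show ?thesis by (simp add: cong_def y_def)
  qed
  then have y: "y \<in> carrier (padic_ints p)"
    unfolding padic_ints_carrier_iff using prime_gt_0_nat[OF p] by (simp add: y_def)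
  have "x \<otimes>\<^bsub>padic_ints p\<^esub> y = \<one>\<^bsub>padic_ints p\<^esub>"
    by (rule ext) (use yinv in \<open>simp add: padic_mult padic_one cong_def\<close>)
  moreover from this have "y \<otimes>\<^bsub>padic_ints p\<^esub> x = \<one>\<^bsub>padic_ints p\<^esub>"
    using x y m_comm by simp
  ultimately show "x \<in> Units (padic_ints p)"
    using x y unfolding Units_def by blast
qed

lemma Units_padic_carrier: "x \<in> Units (padic_ints p) \<Longrightarrow> x \<in> carrier (padic_ints p)"
  by (simp add: Units_def)

lemma Units_padic_coprime:
  assumes p: "prime p" and x: "x \<in> Units (padic_ints p)" and n: "n > 0"
  shows "coprime (x n) (int p)"
proof -
  have "x n mod int p = x 1"
    using padic_mod[OF Units_padic_carrier[OF x], of 1 n] n by simp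
  then have "coprime (x n mod int p) (int p)"
    using x by (simp add: Units_padic_ints[OF p])
  then show ?thesis using prime_gt_0_nat[OF p] by simp
qed

lemma padic_of_int_Units:
  assumes p: "prime p" and a: "coprime a (int p)"
  shows "padic_of_int p a \<in> Units (padic_ints p)"
  using a padic_of_int_carrier[OF prime_gt_0_nat[OF p]] prime_gt_0_nat[OF p]
  by (simp add: Units_padic_ints[OF p], simp add: padic_of_int_def)

lemma topspace_units_mod_sign:
  "topspace (units_mod_sign p) = orbit p ` Units (padic_ints p)"
  unfolding units_mod_sign_def by (auto simp: orbit_def Units_def)

section \<open>Topology and compactness of the units\<close>

abbreviation padic_product :: "(nat \<Rightarrow> int) topology" where
  "padic_product \<equiv> product_topology (\<lambda>n. discrete_topology UNIV) UNIV"

lemma unit_subtopology: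
  "subtopology (padic_topology p) (Units (padic_ints p)) = subtopology padic_product (Units (padic_ints p))"
  unfolding padic_topology_def subtopology_subtopology
  by (rule arg_cong[where f = "subtopology padic_product"]) (auto simp: Units_def)

lemma openin_padic_product:
  "openin padic_product W \<longleftrightarrow> (\<forall>x\<in>W. \<exists>F. finite F \<and> {y. \<forall>i\<in>F. y i = x i} \<subseteq> W)"
proof
  assume W: "openin padic_product W"
  show "\<forall>x\<in>W. \<exists>F. finite F \<and> {y. \<forall>i\<in>F. y i = x i} \<subseteq> W"
  proof
    fix x assume "x \<in> W"
    then have "\<exists>V. finite {i. V i \<noteq> UNIV} \<and> x \<in> Pi\<^sub>E UNIV V \<and> Pi\<^sub>E UNIV V \<subseteq> W"
      using W unfolding openin_product_topology_alt by simp
    then obtain V :: "nat \<Rightarrow> int set" where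
      V: "finite {i. V i \<noteq> UNIV}" "x \<in> Pi\<^sub>E UNIV V" "Pi\<^sub>E UNIV V \<subseteq> W"
      by blast
    have "{y. \<forall>i\<in>{i. V i \<noteq> UNIV}. y i = x i} \<subseteq> Pi\<^sub>E UNIV V"
    proof
      fix y assume y: "y \<in> {y. \<forall>i\<in>{i. V i \<noteq> UNIV}. y i = x i}"
      have "y i \<in> V i" for i
        using y V(2) by (cases "V i = UNIV") (auto simp: PiE_UNIV_domain Pi_iff)
      then show "y \<in> Pi\<^sub>E UNIV V" by (simp add: PiE_UNIV_domain)
    qed
    then have "{y. \<forall>i\<in>{i. V i \<noteq> UNIV}. y i = x i} \<subseteq> W"
      using V(3) by (rule order.trans)
    then show "\<exists>F. finite F \<and> {y. \<forall>i\<in>F. y i = x i} \<subseteq> W"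
      by (intro exI[of _ "{i. V i \<noteq> UNIV}"] conjI V(1))
  qed
next
  assume W: "\<forall>x\<in>W. \<exists>F. finite F \<and> {y. \<forall>i\<in>F. y i = x i} \<subseteq> W"
  show "openin padic_product W"
    unfolding openin_product_topology_alt
  proof
    fix x assume "x \<in> W"
    then obtain F where F: "finite F" "{y. \<forall>i\<in>F. y i = x i} \<subseteq> W" using W by blast
    let ?V = "\<lambda>i. if i \<in> F then {x i} else UNIV"
    have "{i \<in> UNIV. ?V i \<noteq> topspace (discrete_topology UNIV)} \<subseteq> F" by auto
    then have "finite {i \<in> UNIV. ?V i \<noteq> topspace (discrete_topology UNIV)}"
      using F(1) finite_subset by blast
    moreover have "Pi\<^sub>E UNIV ?V \<subseteq> {y. \<forall>i\<in>F. y i = x i}"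
    proof clarify
      fix y i assume y: "y \<in> Pi\<^sub>E UNIV ?V" and i: "i \<in> F"
      show "y i = x i" using PiE_mem[OF y UNIV_I, of i] i by simp
    qed
    then have "Pi\<^sub>E UNIV ?V \<subseteq> W" using F(2) by (rule order.trans)
    ultimately show "\<exists>V. finite {i \<in> UNIV. V i \<noteq> topspace (discrete_topology UNIV)} \<and>
        (\<forall>i\<in>UNIV. openin (discrete_topology UNIV) (V i)) \<and> x \<in> Pi\<^sub>E UNIV V \<and> Pi\<^sub>E UNIV V \<subseteq> W"
      by (intro exI[of _ ?V] conjI) (auto simp: PiE_UNIV_domain)
  qed
qed

text \<open>A closed subset of a product of finite discrete spaces, which is compact by Tychonoff.
  It is closed because the failure of a defining condition shows in the coordinates 1, n and n +
  1.\<close>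

lemma compactin_padic_Units:
  assumes p: "prime p"
  shows "compactin padic_product (Units (padic_ints p))"
proof (rule closed_compactin)
  let ?K = "Pi\<^sub>E UNIV (\<lambda>n. {0..<int p ^ n})"
  show "compactin padic_product ?K"
    by (simp add: compactin_PiE compactin_discrete_topology)
  show "Units (padic_ints p) \<subseteq> ?K"
    by (auto simp: Units_def padic_bounds)
  have "openin padic_product (- Units (padic_ints p))"
    unfolding openin_padic_product
  proof
    fix x assume x: "x \<in> - Units (padic_ints p)"
    let ?ok = "\<lambda>n x. 0 \<le> x n \<and> x n < int p ^ n \<and> x (Suc n) mod int p ^ n = x n \<and> coprime (x 1) (int p)"
    have U: "y \<in> Units (padic_ints p) \<longleftrightarrow> (\<forall>n. ?ok n y)" for y
      by (auto simp: Units_padic_ints[OF p] padic_ints_carrier_iff)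
    obtain n where n: "\<not> ?ok n x" using x U by blast
    have "{y. \<forall>i\<in>{1, n, Suc n}. y i = x i} \<subseteq> - Units (padic_ints p)"
    proof
      fix y assume "y \<in> {y. \<forall>i\<in>{1, n, Suc n}. y i = x i}"
      then have "y 1 = x 1" "y n = x n" "y (Suc n) = x (Suc n)" by auto
      then have "\<not> ?ok n y" using n by simp
      then show "y \<in> - Units (padic_ints p)" using U by blast
    qed
    then show "\<exists>F. finite F \<and> {y. \<forall>i\<in>F. y i = x i} \<subseteq> - Units (padic_ints p)"
      by (intro exI[of _ "{1, n, Suc n}"]) simp
  qed
  then show "closedin padic_product (Units (padic_ints p))"
    by (simp add: closedin_def Compl_eq_Diff_UNIV)
qed

text \<open>Continuity into a discrete space is local constancy, and compactness makes it uniform.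
  One coordinate N suffices because it determines all earlier ones.\<close>

lemma continuous_map_padic_discrete_iff:
  fixes h :: "(nat \<Rightarrow> int) \<Rightarrow> int"
  assumes p: "prime p"
  defines "U \<equiv> Units (padic_ints p)"
  shows "continuous_map (subtopology padic_product U) (discrete_topology UNIV) h \<longleftrightarrow>
    (\<exists>N. \<forall>x\<in>U. \<forall>y\<in>U. x N = y N \<longrightarrow> h x = h y)"
proof
  assume cont: "continuous_map (subtopology padic_product U) (discrete_topology UNIV) h"
  have "\<exists>N. \<forall>y\<in>U. y N = x N \<longrightarrow> h y = h x" if x: "x \<in> U" for x
  proof -
    have "openin (subtopology padic_product U) {y \<in> topspace (subtopology padic_product U). h y \<in> {h x}}"
      using cont by (rule openin_continuous_map_preimage) simp
    then obtain W where W: "openin padic_product W" "{y \<in> U. h y = h x} = W \<inter> U"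
      unfolding openin_subtopology by auto
    then have "x \<in> W" using x by blast
    then obtain F where F: "finite F" "{y. \<forall>i\<in>F. y i = x i} \<subseteq> W"
      using W(1) unfolding openin_padic_product by blast
    obtain N where N: "\<And>i. i \<in> F \<Longrightarrow> i \<le> N" using F(1) by (metis finite_nat_set_iff_bounded_le)
    have "h y = h x" if y: "y \<in> U" "y N = x N" for y
    proof -
      have "y i = x i" if "i \<in> F" for i
        using padic_mod[of y p i N] padic_mod[of x p i N] x y N[OF that]
        by (simp add: U_def Units_padic_carrier)
      then have "y \<in> W" using F(2) by blast
      then show ?thesis using W(2) y(1) by blast
    qed
    then show ?thesis by blast
  qed
  then obtain N where N: "\<And>x y. x \<in> U \<Longrightarrow> y \<in> U \<Longrightarrow> y (N x) = x (N x) \<Longrightarrow> h y = h x" by metis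
  let ?C = "\<lambda>x. {y. y (N x) = x (N x)}"
  have "openin padic_product (?C x)" for x
    unfolding openin_padic_product
  proof
    fix y assume "y \<in> ?C x"
    then show "\<exists>F. finite F \<and> {z. \<forall>i\<in>F. z i = y i} \<subseteq> ?C x"
      by (intro exI[of _ "{N x}"]) auto
  qed
  moreover have "U \<subseteq> \<Union> (?C ` U)" by auto
  ultimately obtain \<F> where F: "finite \<F>" "\<F> \<subseteq> ?C ` U" "U \<subseteq> \<Union>\<F>"
    using compactinD[OF compactin_padic_Units[OF p], of "?C ` U"] unfolding U_def[symmetric] by blast
  obtain K where K: "finite K" "K \<subseteq> U" "\<F> = ?C ` K"
    using finite_subset_image[OF F(1,2)] by blast
  have K_cover: "U \<subseteq> (\<Union>x\<in>K. ?C x)" using F(3) unfolding K(3) .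
  obtain M where M: "\<And>x. x \<in> K \<Longrightarrow> N x \<le> M"
    using finite_imageI[OF K(1), of N] by (metis finite_nat_set_iff_bounded_le imageI)
  have "h x = h y" if xy: "x \<in> U" "y \<in> U" "x M = y M" for x y
  proof -
    obtain z where z: "z \<in> K" "x (N z) = z (N z)" using K_cover xy(1) by blast
    have "y (N z) = x (N z)"
      using padic_mod[of x p "N z" M] padic_mod[of y p "N z" M] M[OF z(1)] xy
      by (simp add: U_def Units_padic_carrier)
    then show ?thesis using N[of z x] N[of z y] z K(2) xy by auto
  qed
  then show "\<exists>N. \<forall>x\<in>U. \<forall>y\<in>U. x N = y N \<longrightarrow> h x = h y" by blast
next
  assume "\<exists>N. \<forall>x\<in>U. \<forall>y\<in>U. x N = y N \<longrightarrow> h x = h y"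
  then obtain N where N: "\<And>x y. x \<in> U \<Longrightarrow> y \<in> U \<Longrightarrow> x N = y N \<Longrightarrow> h x = h y" by blast
  show "continuous_map (subtopology padic_product U) (discrete_topology UNIV) h"
    unfolding continuous_map
  proof (intro conjI allI impI)
    fix S :: "int set"
    \<comment> \<open>The union of the level N cylinders around those points of U whose value lies
      in S; h is constant on each cylinder within U, so this cuts out the preimage.\<close>
    let ?W = "{x. \<exists>y\<in>U. y N = x N \<and> h y \<in> S}"
    have "openin padic_product ?W"
      unfolding openin_padic_product
    proof
      fix x assume "x \<in> ?W"
      then show "\<exists>F. finite F \<and> {z. \<forall>i\<in>F. z i = x i} \<subseteq> ?W"
        by (intro exI[of _ "{N}"]) auto
    qed
    moreover have "{x \<in> topspace (subtopology padic_product U). h x \<in> S} = ?W \<inter> U"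
    proof (intro equalityI subsetI)
      fix x assume "x \<in> ?W \<inter> U"
      then obtain y where "x \<in> U" "y \<in> U" "y N = x N" "h y \<in> S" by blast
      then show "x \<in> {x \<in> topspace (subtopology padic_product U). h x \<in> S}"
        using N[of y x] by simp
    qed auto
    ultimately show "openin (subtopology padic_product U) {x \<in> topspace (subtopology padic_product U). h x \<in> S}"
      unfolding openin_subtopology by blast
  qed simp
qed

text \<open>The quotient map turns continuity of f into that of its composite with
  \<open>orbit\<close>. The target is a subspace of a product of discrete spaces, so each coordinate
  is treated by \<open>continuous_map_padic_discrete_iff\<close>.\<close>

lemma cont_functions_iff:
  assumes p: "prime p"
  shows "f \<in> cont_functions p \<longleftrightarrow>
    f \<in> extensional (orbit p ` Units (padic_ints p)) \<and>
    (\<forall>x\<in>Units (padic_ints p). f (orbit p x) \<in> carrier (padic_ints p)) \<and>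
    (\<forall>n. \<exists>N. \<forall>x\<in>Units (padic_ints p). \<forall>y\<in>Units (padic_ints p). x N = y N \<longrightarrow> f (orbit p x) n = f (orbit p y) n)"
proof -
  let ?U = "Units (padic_ints p)"
  let ?X = "subtopology padic_product ?U"
  have "quotient_map ?X (units_mod_sign p) (orbit p)"
    unfolding units_mod_sign_def unit_subtopology orbit_def[abs_def] by (rule quotient_map_quotient_topology)
  then have "continuous_map (units_mod_sign p) (padic_topology p) f
      \<longleftrightarrow> continuous_map ?X (padic_topology p) (f \<circ> orbit p)"
    by (simp add: continuous_compose_quotient_map_eq)
  also have "\<dots> \<longleftrightarrow> (\<forall>n. continuous_map ?X (discrete_topology UNIV) (\<lambda>x. f (orbit p x) n))
      \<and> (\<forall>x\<in>?U. f (orbit p x) \<in> carrier (padic_ints p))"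
    unfolding padic_topology_def continuous_map_in_subtopology continuous_map_componentwise_UNIV
    by auto
  also have "\<dots> \<longleftrightarrow> (\<forall>n. \<exists>N. \<forall>x\<in>?U. \<forall>y\<in>?U. x N = y N \<longrightarrow> f (orbit p x) n = f (orbit p y) n)
      \<and> (\<forall>x\<in>?U. f (orbit p x) \<in> carrier (padic_ints p))"
    unfolding continuous_map_padic_discrete_iff[OF p] ..
  finally show ?thesis
    unfolding cont_functions_def topspace_units_mod_sign by blast
qed

subsection \<open>Measures with prescribed moments\<close>

text \<open>The function R(x^2) on orbits. The representative is chosen by \<open>SOME\<close>,
  harmlessly, as it enters through its square.\<close>

definition sq_fun :: "nat \<Rightarrow> int poly \<Rightarrow> (nat \<Rightarrow> int) set \<Rightarrow> nat \<Rightarrow> int" where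
  "sq_fun p R = (\<lambda>c\<in>orbit p ` Units (padic_ints p). \<lambda>n. poly R ((SOME x. x \<in> c) n ^ 2) mod int p ^ n)"

lemma poly_mod_cong: "[a = b] (mod m) \<Longrightarrow> [poly R a = poly R b] (mod m)" for R :: "int poly"
  by (induction R) (auto intro: cong_add cong_mult)

lemma sq_fun_orbit:
  assumes p: "p > 0" and x: "x \<in> Units (padic_ints p)"
  shows "sq_fun p R (orbit p x) n = poly R (x n ^ 2) mod int p ^ n"
proof -
  have "(SOME y. y \<in> orbit p x) \<in> orbit p x" by (rule someI[of _ x]) (simp add: orbit_def)
  moreover have "[((\<ominus>\<^bsub>padic_ints p\<^esub> x) n)\<^sup>2 = (x n)\<^sup>2] (mod int p ^ n)"
    unfolding padic_minus[OF p Units_padic_carrier[OF x]]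
    by (simp add: cong_def power_mod)
  ultimately have "[(SOME y. y \<in> orbit p x) n ^ 2 = x n ^ 2] (mod int p ^ n)"
    by (auto simp: orbit_def)
  then have "[poly R ((SOME y. y \<in> orbit p x) n ^ 2) = poly R (x n ^ 2)] (mod int p ^ n)"
    by (rule poly_mod_cong)
  then show ?thesis using x by (simp add: sq_fun_def cong_def)
qed

lemma power_fun_orbit:
  assumes p: "p > 0" and x: "x \<in> Units (padic_ints p)"
  shows "power_fun p (2 * k) (orbit p x) n = x n ^ (2 * k) mod int p ^ n"
proof -
  let ?y = "x [^]\<^bsub>padic_ints p\<^esub> (2 * k)"
  have "(\<ominus>\<^bsub>padic_ints p\<^esub> x) [^]\<^bsub>padic_ints p\<^esub> (2 * k) = ?y"
    by (rule ext) (simp add: padic_pow padic_minus[OF p Units_padic_carrier[OF x]] power_mod)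
  then have "(\<lambda>z. z [^]\<^bsub>padic_ints p\<^esub> (2 * k)) ` orbit p x = {?y}"
    by (simp add: orbit_def)
  then show ?thesis
    using x by (simp add: power_fun_def topspace_units_mod_sign padic_pow)
qed

lemma orbit_fun_eqI:
  assumes "f \<in> extensional (orbit p ` Units (padic_ints p))" "g \<in> extensional (orbit p ` Units (padic_ints p))"
    and "\<And>x n. x \<in> Units (padic_ints p) \<Longrightarrow> f (orbit p x) n = g (orbit p x) n"
  shows "f = g"
  by (rule extensionalityI[OF assms(1,2)]) (use assms(3) in auto)

lemma power_fun_eq_sq_fun:
  assumes "p > 0"
  shows "power_fun p (2 * k) = sq_fun p (Polynomial.monom 1 k)"
proof (rule orbit_fun_eqI)
  show "power_fun p (2 * k) \<in> extensional (orbit p ` Units (padic_ints p))"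
    by (simp add: power_fun_def topspace_units_mod_sign)
  show "sq_fun p (Polynomial.monom 1 k) \<in> extensional (orbit p ` Units (padic_ints p))"
    by (simp add: sq_fun_def)
qed (simp add: sq_fun_orbit[OF assms] power_fun_orbit[OF assms] poly_monom power_mult)

lemma sq_fun_cont:
  assumes p: "prime p"
  shows "sq_fun p R \<in> cont_functions p"
  unfolding cont_functions_iff[OF p]
proof (intro conjI ballI allI)
  have p0: "p > 0" using p by (rule prime_gt_0_nat)
  show "sq_fun p R \<in> extensional (orbit p ` Units (padic_ints p))" by (simp add: sq_fun_def)
  show "sq_fun p R (orbit p x) \<in> carrier (padic_ints p)" if x: "x \<in> Units (padic_ints p)" for x
    unfolding padic_ints_carrier_iff sq_fun_orbit[OF p0 x]
  proof (intro allI conjI)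
    fix n
    have "[x (Suc n) = x n] (mod int p ^ n)"
      using padic_mod[OF Units_padic_carrier[OF x], of n "Suc n"]
        padic_mod[OF Units_padic_carrier[OF x], of n n] by (simp add: cong_def)
    then have "[poly R (x (Suc n) ^ 2) = poly R (x n ^ 2)] (mod int p ^ n)"
      by (intro poly_mod_cong cong_pow)
    then show "poly R ((x (Suc n))\<^sup>2) mod int p ^ Suc n mod int p ^ n = poly R ((x n)\<^sup>2) mod int p ^ n"
      by (simp only: mod_pow_Suc cong_def)
  qed (use p0 in auto)
  show "\<exists>N. \<forall>x\<in>Units (padic_ints p). \<forall>y\<in>Units (padic_ints p). x N = y N \<longrightarrow>
      sq_fun p R (orbit p x) n = sq_fun p R (orbit p y) n" for n
    by (rule exI[of _ n]) (simp add: sq_fun_orbit[OF p0])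
qed

lemma cont_functions_add:
  assumes p: "prime p" and f: "f \<in> cont_functions p" and g: "g \<in> cont_functions p"
  shows "(\<lambda>c\<in>topspace (units_mod_sign p). f c \<oplus>\<^bsub>padic_ints p\<^esub> g c) \<in> cont_functions p" (is "?h \<in> _")
proof -
  interpret cring "padic_ints p" by (rule cring_padic_ints[OF prime_gt_0_nat[OF p]])
  let ?U = "Units (padic_ints p)"
  have h: "?h (orbit p x) = f (orbit p x) \<oplus>\<^bsub>padic_ints p\<^esub> g (orbit p x)" if "x \<in> ?U" for x
    using that by (simp add: topspace_units_mod_sign)
  show ?thesis
    unfolding cont_functions_iff[OF p]
  proof (intro conjI ballI allI)
    show "?h \<in> extensional (orbit p ` ?U)" by (simp add: topspace_units_mod_sign)
    show "?h (orbit p x) \<in> carrier (padic_ints p)" if "x \<in> ?U" for x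
      unfolding h[OF that] using that f g by (simp add: cont_functions_iff[OF p])
    fix n
    obtain N N' where N: "\<And>x y. x \<in> ?U \<Longrightarrow> y \<in> ?U \<Longrightarrow> x N = y N \<Longrightarrow> f (orbit p x) n = f (orbit p y) n"
      and N': "\<And>x y. x \<in> ?U \<Longrightarrow> y \<in> ?U \<Longrightarrow> x N' = y N' \<Longrightarrow> g (orbit p x) n = g (orbit p y) n"
      using f g unfolding cont_functions_iff[OF p] by metis
    have "?h (orbit p x) n = ?h (orbit p y) n" if xy: "x \<in> ?U" "y \<in> ?U" "x (max N N') = y (max N N')" for x y
    proof -
      have "x i = y i" if "i \<le> max N N'" for i
        using padic_mod[OF Units_padic_carrier[OF xy(1)] that] padic_mod[OF Units_padic_carrier[OF xy(2)] that] xy(3)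
        by simp
      then show ?thesis unfolding h[OF xy(1)] h[OF xy(2)] padic_add using N[OF xy(1,2)] N'[OF xy(1,2)] by simp
    qed
    then show "\<exists>N. \<forall>x\<in>?U. \<forall>y\<in>?U. x N = y N \<longrightarrow> ?h (orbit p x) n = ?h (orbit p y) n" by blast
  qed
qed

lemma cont_functions_scale:
  assumes p: "prime p" and z: "z \<in> carrier (padic_ints p)" and f: "f \<in> cont_functions p"
  shows "(\<lambda>c\<in>topspace (units_mod_sign p). z \<otimes>\<^bsub>padic_ints p\<^esub> f c) \<in> cont_functions p" (is "?h \<in> _")
proof -
  interpret cring "padic_ints p" by (rule cring_padic_ints[OF prime_gt_0_nat[OF p]])
  let ?U = "Units (padic_ints p)"
  have h: "?h (orbit p x) = z \<otimes>\<^bsub>padic_ints p\<^esub> f (orbit p x)" if "x \<in> ?U" for x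
    using that by (simp add: topspace_units_mod_sign)
  show ?thesis
    unfolding cont_functions_iff[OF p]
  proof (intro conjI ballI allI)
    show "?h \<in> extensional (orbit p ` ?U)" by (simp add: topspace_units_mod_sign)
    show "?h (orbit p x) \<in> carrier (padic_ints p)" if "x \<in> ?U" for x
      unfolding h[OF that] using that z f by (simp add: cont_functions_iff[OF p])
    fix n
    obtain N where N: "\<And>x y. x \<in> ?U \<Longrightarrow> y \<in> ?U \<Longrightarrow> x N = y N \<Longrightarrow> f (orbit p x) n = f (orbit p y) n"
      using f unfolding cont_functions_iff[OF p] by metis
    have "?h (orbit p x) n = ?h (orbit p y) n" if xy: "x \<in> ?U" "y \<in> ?U" "x N = y N" for x y
      unfolding h[OF xy(1)] h[OF xy(2)] padic_mult using N[OF xy] by simp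
    then show "\<exists>N. \<forall>x\<in>?U. \<forall>y\<in>?U. x N = y N \<longrightarrow> ?h (orbit p x) n = ?h (orbit p y) n" by blast
  qed
qed

text \<open>F is p^v times a continuous function G, and scalars from the p-adic integers can be
  pulled out of the integral.\<close>

lemma meas_dvd:
  assumes p: "prime p" and \<mu>: "\<mu> \<in> meas p" and F: "F \<in> cont_functions p"
    and v: "\<And>x. x \<in> Units (padic_ints p) \<Longrightarrow> F (orbit p x) v = 0"
  shows "\<mu> F v = 0"
proof -
  let ?U = "Units (padic_ints p)" and ?T = "topspace (units_mod_sign p)"
  have p0: "p > 0" using p by (rule prime_gt_0_nat)
  \<comment> \<open>Division by p^v loses v digits of precision, so coordinate n of the quotient
    comes from coordinate n + v of F.\<close>
  define G where "G = (\<lambda>c\<in>orbit p ` ?U. \<lambda>n. F c (n + v) div int p ^ v)"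
  have Fc: "F (orbit p x) \<in> carrier (padic_ints p)" if "x \<in> ?U" for x
    using F that by (simp add: cont_functions_iff[OF p])
  have G: "int p ^ v * G (orbit p x) n = F (orbit p x) (n + v)" if "x \<in> ?U" for x n
  proof -
    have "F (orbit p x) (n + v) mod int p ^ v = 0"
      using padic_mod[OF Fc[OF that], of v "n + v"] v[OF that] by simp
    then show ?thesis using that by (auto simp: G_def)
  qed
  have "G \<in> cont_functions p"
    unfolding cont_functions_iff[OF p]
  proof (intro conjI ballI allI)
    show "G \<in> extensional (orbit p ` ?U)" by (simp add: G_def)
    show "G (orbit p x) \<in> carrier (padic_ints p)" if x: "x \<in> ?U" for x
      unfolding padic_ints_carrier_iff
    proof (intro allI conjI)
      fix n
      have pv: "int p ^ v > 0" using p0 by simp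
      show "0 \<le> G (orbit p x) n"
        using padic_bounds(1)[OF Fc[OF x], of "n + v"] pv unfolding G[OF x, symmetric]
        by (simp add: zero_le_mult_iff)
      show "G (orbit p x) n < int p ^ n"
        using padic_bounds(2)[OF Fc[OF x], of "n + v"] pv unfolding G[OF x, symmetric]
        by (simp add: power_add)
      have "int p ^ v * (G (orbit p x) (Suc n) mod int p ^ n) = F (orbit p x) (Suc n + v) mod int p ^ (n + v)"
        unfolding mult_mod_right G[OF x] by (simp add: power_add mult.commute)
      also have "\<dots> = int p ^ v * G (orbit p x) n"
        using padic_mod[OF Fc[OF x], of "n + v" "Suc n + v"] unfolding G[OF x] by simp
      finally show "G (orbit p x) (Suc n) mod int p ^ n = G (orbit p x) n" using p0 by simp
    qed
    fix n
    obtain N where N: "\<And>x y. x \<in> ?U \<Longrightarrow> y \<in> ?U \<Longrightarrow> x N = y N \<Longrightarrow> F (orbit p x) (n + v) = F (orbit p y) (n + v)"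
      using F unfolding cont_functions_iff[OF p] by metis
    have "G (orbit p x) n = G (orbit p y) n" if xy: "x \<in> ?U" "y \<in> ?U" "x N = y N" for x y
      using N[OF xy] xy(1,2) by (simp add: G_def)
    then show "\<exists>N. \<forall>x\<in>?U. \<forall>y\<in>?U. x N = y N \<longrightarrow> G (orbit p x) n = G (orbit p y) n" by blast
  qed
  then have "\<mu> (\<lambda>c\<in>?T. padic_of_int p (int p ^ v) \<otimes>\<^bsub>padic_ints p\<^esub> G c)
      = padic_of_int p (int p ^ v) \<otimes>\<^bsub>padic_ints p\<^esub> \<mu> G"
    using \<mu> padic_of_int_carrier[OF p0] unfolding meas_def by blast
  moreover have "(\<lambda>c\<in>?T. padic_of_int p (int p ^ v) \<otimes>\<^bsub>padic_ints p\<^esub> G c) = F"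
  proof (rule orbit_fun_eqI)
    show "F \<in> extensional (orbit p ` ?U)" using F by (simp add: cont_functions_iff[OF p])
    fix x n assume x: "x \<in> ?U"
    have "(padic_of_int p (int p ^ v) \<otimes>\<^bsub>padic_ints p\<^esub> G (orbit p x)) n = F (orbit p x) (n + v) mod int p ^ n"
      unfolding G[OF x, symmetric] by (simp add: padic_mult padic_of_int_def mod_simps)
    also have "\<dots> = F (orbit p x) n" using padic_mod[OF Fc[OF x], of n "n + v"] by simp
    finally show "(\<lambda>c\<in>?T. padic_of_int p (int p ^ v) \<otimes>\<^bsub>padic_ints p\<^esub> G c) (orbit p x) n = F (orbit p x) n"
      using x by (simp add: topspace_units_mod_sign)
  qed (simp add: topspace_units_mod_sign)
  ultimately show ?thesis by (simp add: padic_mult padic_of_int_def)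
qed

lemma meas_sq_fun:
  fixes d :: nat
  assumes p: "prime p" and \<mu>: "\<mu> \<in> meas p"
  shows "\<mu> (sq_fun p (\<Sum>i<d. Polynomial.monom (a i) (e i))) n
    = (\<Sum>i<d. a i * \<mu> (power_fun p (2 * e i)) n) mod int p ^ n"
proof -
  let ?U = "Units (padic_ints p)" and ?T = "topspace (units_mod_sign p)"
  have p0: "p > 0" using p by (rule prime_gt_0_nat)
  have add: "\<mu> (sq_fun p (R + S)) n = (\<mu> (sq_fun p R) n + \<mu> (sq_fun p S) n) mod int p ^ n" for R S
  proof -
    have "sq_fun p (R + S) = (\<lambda>c\<in>?T. sq_fun p R c \<oplus>\<^bsub>padic_ints p\<^esub> sq_fun p S c)"
      by (rule orbit_fun_eqI) (auto simp: sq_fun_orbit[OF p0] topspace_units_mod_sign padic_add mod_simps,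
          auto simp: sq_fun_def)
    then have "\<mu> (sq_fun p (R + S)) = \<mu> (sq_fun p R) \<oplus>\<^bsub>padic_ints p\<^esub> \<mu> (sq_fun p S)"
      using \<mu> sq_fun_cont[OF p] unfolding meas_def by simp
    then show ?thesis by (simp add: padic_add)
  qed
  have scale: "\<mu> (sq_fun p (Polynomial.smult c R)) n = c * \<mu> (sq_fun p R) n mod int p ^ n" for c R
  proof -
    have "sq_fun p (Polynomial.smult c R) = (\<lambda>u\<in>?T. padic_of_int p c \<otimes>\<^bsub>padic_ints p\<^esub> sq_fun p R u)"
      by (rule orbit_fun_eqI) (auto simp: sq_fun_orbit[OF p0] topspace_units_mod_sign padic_mult padic_of_int_def mod_simps,
          auto simp: sq_fun_def)
    then have "\<mu> (sq_fun p (Polynomial.smult c R)) = padic_of_int p c \<otimes>\<^bsub>padic_ints p\<^esub> \<mu> (sq_fun p R)"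
      using \<mu> sq_fun_cont[OF p] padic_of_int_carrier[OF p0] unfolding meas_def by simp
    then show ?thesis by (simp add: padic_mult padic_of_int_def mod_simps)
  qed
  show ?thesis
  proof (induction d)
    case 0
    then show ?case using scale[of 0 0] by simp
  next
    case (Suc d)
    have "Polynomial.monom (a d) (e d) = Polynomial.smult (a d) (Polynomial.monom 1 (e d))"
      by (simp add: smult_monom)
    then have "\<mu> (sq_fun p (Polynomial.monom (a d) (e d))) n = a d * \<mu> (power_fun p (2 * e d)) n mod int p ^ n"
      using scale power_fun_eq_sq_fun[OF p0] by metis
    then show ?case
      unfolding sum.lessThan_Suc add Suc by (simp add: mod_simps)
  qed
qed

text \<open>The given moments start at exponent 2m, so the function integrated is x^(2m) Q(x^2),
  encoded by \<open>?R\<close>, and \<open>meas_dvd\<close> applies to it. The case v = 0 is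
  separated because coordinate 0 of a unit is 0 and says nothing about being prime to p.\<close>

lemma moment_functional_dvd_of_meas:
  assumes p: "prime p" and \<mu>: "\<mu> \<in> meas p"
    and y: "\<And>i. \<mu> (power_fun p (2 * (i + m))) = padic_of_int p (y i)"
    and Q: "\<And>x. coprime x (int p) \<Longrightarrow> int p ^ v dvd poly Q (x ^ 2)"
  shows "int p ^ v dvd moment_functional y Q"
proof (cases "v = 0")
  case False
  let ?d = "Suc (Polynomial.degree Q)"
  let ?R = "\<Sum>i<?d. Polynomial.monom (poly.coeff Q i) (i + m)"
  have p0: "p > 0" using p by (rule prime_gt_0_nat)
  have R: "poly ?R t = t ^ m * poly Q t" for t
  proof -
    have "poly ?R t = (\<Sum>i<?d. t ^ m * (poly.coeff Q i * t ^ i))"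
      unfolding poly_sum by (intro sum.cong refl) (simp add: poly_monom power_add)
    then show ?thesis unfolding poly_altdef sum_distrib_left lessThan_Suc_atMost .
  qed
  have "\<mu> (sq_fun p ?R) v = 0"
  proof (rule meas_dvd[OF p \<mu> sq_fun_cont[OF p]])
    fix x assume x: "x \<in> Units (padic_ints p)"
    have "int p ^ v dvd poly Q (x v ^ 2)"
      using Units_padic_coprime[OF p x] False by (intro Q) simp
    then show "sq_fun p ?R (orbit p x) v = 0"
      unfolding sq_fun_orbit[OF p0 x] R by simp
  qed
  then have "(\<Sum>i<?d. poly.coeff Q i * (y i mod int p ^ v)) mod int p ^ v = 0"
    unfolding meas_sq_fun[OF p \<mu>] y by (simp add: padic_of_int_def)
  moreover have "[(\<Sum>i<?d. poly.coeff Q i * (y i mod int p ^ v)) = (\<Sum>i<?d. poly.coeff Q i * y i)] (mod int p ^ v)"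
    by (intro cong_sum cong_scalar_left cong_mod_left[THEN iffD2] cong_refl)
  ultimately have "(\<Sum>i<?d. poly.coeff Q i * y i) mod int p ^ v = 0"
    by (simp only: cong_def)
  then have "int p ^ v dvd (\<Sum>i<?d. poly.coeff Q i * y i)" by (simp only: dvd_eq_mod_eq_0)
  then show ?thesis by (simp only: moment_functional_eq[OF lessI])
qed simp

text \<open>
  The measure is built one residue ring at a time: modulo \<open>p ^ n\<close> a continuous function agrees
  with \<open>x ^ (2 * m) * P (x\<^sup>2) / p ^ r\<close> for some integer polynomial \<open>P\<close>, and the integral has to be
  \<open>moment_functional y P / p ^ r\<close>.
\<close>

definition represents :: "nat \<Rightarrow> nat \<Rightarrow> ((nat \<Rightarrow> int) set \<Rightarrow> nat \<Rightarrow> int) \<Rightarrow> nat \<Rightarrow> int poly \<Rightarrow> nat \<Rightarrow> bool" where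
  "represents p m f n P r \<longleftrightarrow> (\<forall>a. coprime a (int p) \<longrightarrow>
     int p ^ (r + n) dvd a ^ (2 * m) * poly P (a ^ 2) - int p ^ r * f (orbit p (padic_of_int p a)) n)"

lemma represents_exists:
  assumes p: "prime p" and f: "f \<in> cont_functions p"
  shows "\<exists>P r. represents p m f n P r"
proof -
  have p0: "p > 0" using p by (rule prime_gt_0_nat)
  let ?g = "\<lambda>a. f (orbit p (padic_of_int p a)) n"
  obtain N where N: "\<And>x y. x \<in> Units (padic_ints p) \<Longrightarrow> y \<in> Units (padic_ints p) \<Longrightarrow> x N = y N \<Longrightarrow>
      f (orbit p x) n = f (orbit p y) n"
    using f unfolding cont_functions_iff[OF p] by blast
  have "approximable p n ?g"
  proof (rule approximable_locally_constant[OF p])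
    show "?g (- a) = ?g a" for a by (simp add: orbit_padic_of_int_minus[OF p0])
    show "?g a = ?g b" if "coprime a (int p)" "coprime b (int p)" "int p ^ N dvd a - b" for a b
      using that by (intro N padic_of_int_Units[OF p]) (simp_all add: padic_of_int_def mod_eq_dvd_iff)
  qed
  then obtain P r where P: "\<And>a. coprime a (int p) \<Longrightarrow> int p ^ (r + n) dvd poly P (a ^ 2) - int p ^ r * ?g a"
    unfolding approximable_def by blast
  \<comment> \<open>By Euler's theorem the extra factor \<open>a ^ (2 * (m * ?t - m))\<close> cancels \<open>a ^ (2 * m)\<close> modulo \<open>p ^ n\<close>.\<close>
  let ?t = "totient (p ^ n)"
  have "p ^ n > 0" using p0 by simp
  then have "?t > 0" by (simp only: totient_gt_0_iff)
  \<comment> \<open>Makes the truncated difference \<open>m * ?t - m\<close> a true one.\<close>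
  then have t: "m \<le> m * ?t" by (metis mult_le_mono2 mult_1_right Suc_leI One_nat_def)
  have "represents p m f n (Polynomial.monom 1 (m * ?t - m) * P) r"
    unfolding represents_def
  proof (intro allI impI)
    fix a assume a: "coprime a (int p)"
    have "a ^ (2 * m) * poly (Polynomial.monom 1 (m * ?t - m) * P) (a ^ 2) = a ^ (2 * (m * ?t)) * poly P (a ^ 2)"
      using t by (simp add: poly_monom flip: power_mult power_add mult.assoc) (simp add: algebra_simps)
    then have eq: "a ^ (2 * m) * poly (Polynomial.monom 1 (m * ?t - m) * P) (a ^ 2) - int p ^ r * ?g a
      = (a ^ (2 * (m * ?t)) - 1) * poly P (a ^ 2) + (poly P (a ^ 2) - int p ^ r * ?g a)"
      by (simp add: algebra_simps)
    have "[(a ^ ?t) ^ (2 * m) = 1 ^ (2 * m)] (mod int (p ^ n))"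
      using a p0 by (intro cong_pow euler_theorem_int) auto
    then have "int p ^ n dvd a ^ (2 * (m * ?t)) - 1"
      by (simp add: cong_iff_dvd_diff ac_simps flip: power_mult)
    \<comment> \<open>Euler's theorem supplies only p^n; the remaining p^r comes from the values of
      P.\<close>
    moreover have "int p ^ r dvd poly P (a ^ 2)"
    proof -
      have "int p ^ r dvd poly P (a ^ 2) - int p ^ r * ?g a"
        using P[OF a] by (meson dvd_trans le_add1 le_imp_power_dvd)
      then show ?thesis by (simp add: dvd_diff_left_iff)
    qed
    ultimately have "int p ^ n * int p ^ r dvd (a ^ (2 * (m * ?t)) - 1) * poly P (a ^ 2)"
      by (rule mult_dvd_mono)
    then show "int p ^ (r + n) dvd a ^ (2 * m) * poly (Polynomial.monom 1 (m * ?t - m) * P) (a ^ 2) - int p ^ r * ?g a"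
      unfolding eq using P[OF a] by (simp add: power_add mult.commute)
  qed
  then show ?thesis by blast
qed

lemma represents_add:
  assumes "represents p m f n P r" "represents p m g n P' r'"
    and h: "\<And>a. coprime a (int p) \<Longrightarrow> h (orbit p (padic_of_int p a)) n
      = (f (orbit p (padic_of_int p a)) n + g (orbit p (padic_of_int p a)) n) mod int p ^ n"
  shows "represents p m h n (Polynomial.smult (int p ^ r') P + Polynomial.smult (int p ^ r) P') (r + r')"
  unfolding represents_def
proof (intro allI impI)
  fix a assume a: "coprime a (int p)"
  let ?o = "orbit p (padic_of_int p a)" and ?c = "a ^ (2 * m)"
  obtain u where u: "?c * poly P (a ^ 2) - int p ^ r * f ?o n = int p ^ (r + n) * u"
    using assms(1) a unfolding represents_def by blast
  obtain u' where u': "?c * poly P' (a ^ 2) - int p ^ r' * g ?o n = int p ^ (r' + n) * u'"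
    using assms(2) a unfolding represents_def by blast
  have "int p ^ n dvd f ?o n + g ?o n - h ?o n"
    unfolding h[OF a] by (rule dvd_minus_mod)
  then obtain w where w: "f ?o n + g ?o n - h ?o n = int p ^ n * w" by blast
  have "?c * poly (Polynomial.smult (int p ^ r') P + Polynomial.smult (int p ^ r) P') (a ^ 2) - int p ^ (r + r') * h ?o n
    = int p ^ r' * (?c * poly P (a ^ 2) - int p ^ r * f ?o n) + int p ^ r * (?c * poly P' (a ^ 2) - int p ^ r' * g ?o n)
      + int p ^ (r + r') * (f ?o n + g ?o n - h ?o n)"
    by (simp add: algebra_simps power_add)
  also have "\<dots> = int p ^ (r + r' + n) * (u + u' + w)"
    unfolding u u' w by (simp add: algebra_simps power_add)
  finally show "int p ^ (r + r' + n) dvd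
      ?c * poly (Polynomial.smult (int p ^ r') P + Polynomial.smult (int p ^ r) P') (a ^ 2) - int p ^ (r + r') * h ?o n"
    by simp
qed

lemma represents_smult:
  assumes "represents p m f n P r"
    and h: "\<And>a. coprime a (int p) \<Longrightarrow> h (orbit p (padic_of_int p a)) n
      = (c * f (orbit p (padic_of_int p a)) n) mod int p ^ n"
  shows "represents p m h n (Polynomial.smult c P) r"
  unfolding represents_def
proof (intro allI impI)
  fix a assume a: "coprime a (int p)"
  let ?o = "orbit p (padic_of_int p a)" and ?c = "a ^ (2 * m)"
  obtain u where u: "?c * poly P (a ^ 2) - int p ^ r * f ?o n = int p ^ (r + n) * u"
    using assms(1) a unfolding represents_def by blast
  have "int p ^ n dvd c * f ?o n - h ?o n"
    unfolding h[OF a] by (rule dvd_minus_mod)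
  then obtain w where w: "c * f ?o n - h ?o n = int p ^ n * w" by blast
  have "?c * poly (Polynomial.smult c P) (a ^ 2) - int p ^ r * h ?o n
    = c * (?c * poly P (a ^ 2) - int p ^ r * f ?o n) + int p ^ r * (c * f ?o n - h ?o n)"
    by (simp add: algebra_simps)
  also have "\<dots> = int p ^ (r + n) * (c * u + w)"
    unfolding u w by (simp add: algebra_simps power_add)
  finally show "int p ^ (r + n) dvd ?c * poly (Polynomial.smult c P) (a ^ 2) - int p ^ r * h ?o n" by simp
qed

text \<open>Using one representation for two levels makes the values built at successive levels
  coherent.\<close>

lemma represents_Suc:
  assumes p: "prime p" and f: "f \<in> cont_functions p" and R: "represents p m f (Suc n) P r"
  shows "represents p m f n P r"
  unfolding represents_def
proof (intro allI impI)
  fix a assume a: "coprime a (int p)"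
  let ?o = "orbit p (padic_of_int p a)" and ?c = "a ^ (2 * m)"
  have "f ?o \<in> carrier (padic_ints p)"
    using f padic_of_int_Units[OF p a] by (simp add: cont_functions_iff[OF p])
  then have "f ?o (Suc n) mod int p ^ n = f ?o n mod int p ^ n"
    using padic_mod[of "f ?o" p n "Suc n"] padic_mod[of "f ?o" p n n] by simp
  then have "int p ^ n dvd f ?o (Suc n) - f ?o n" by (simp add: mod_eq_dvd_iff)
  then have "int p ^ (r + n) dvd int p ^ r * (f ?o (Suc n) - f ?o n)"
    by (simp add: power_add)
  moreover have "int p ^ (r + n) dvd ?c * poly P (a ^ 2) - int p ^ r * f ?o (Suc n)"
    using R a unfolding represents_def by (metis add_Suc_right dvd_trans le_imp_power_dvd le_SucI order_refl)
  ultimately have "int p ^ (r + n) dvd (?c * poly P (a ^ 2) - int p ^ r * f ?o (Suc n))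
      + int p ^ r * (f ?o (Suc n) - f ?o n)" by (rule dvd_add[rotated])
  then show "int p ^ (r + n) dvd ?c * poly P (a ^ 2) - int p ^ r * f ?o n"
    by (simp add: algebra_simps)
qed

text \<open>The integral modulo p^n is read off from any representation. It does not depend on the
  choice: after clearing denominators, two representations differ by a polynomial whose values at
  units are divisible by p^(r + r' + n), and \<open>L\<close> applies to it. Linearity follows
  because representations can be added and scaled.\<close>

lemma meas_exists:
  assumes p: "prime p"
    and L: "\<And>P r. (\<And>x. coprime x (int p) \<Longrightarrow> int p ^ r dvd poly P (x ^ 2)) \<Longrightarrow> int p ^ r dvd moment_functional y P"
  shows "\<exists>\<mu>\<in>meas p. \<forall>k. \<mu> (power_fun p (2 * (k + m))) = padic_of_int p (y k)"
proof -
  let ?L = "moment_functional y" and ?T = "topspace (units_mod_sign p)"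
  have p0: "p > 0" using p by (rule prime_gt_0_nat)
  have coprime_power: "coprime (a ^ (2 * m)) (int p ^ r)" if "coprime a (int p)" for a r
    using that by simp
  \<comment> \<open>Makes the division by p^r in \<open>val\<close> exact; the unit a^(2m)
    cancels.\<close>
  have value_dvd: "int p ^ r dvd ?L P" if R: "represents p m f n P r" for f n P r
  proof (rule L)
    fix a assume a: "coprime a (int p)"
    have "int p ^ r dvd a ^ (2 * m) * poly P (a ^ 2) - int p ^ r * f (orbit p (padic_of_int p a)) n"
      using R a unfolding represents_def by (meson dvd_trans le_add1 le_imp_power_dvd)
    then have "int p ^ r dvd a ^ (2 * m) * poly P (a ^ 2)" by (simp add: dvd_diff_left_iff)
    then show "int p ^ r dvd poly P (a ^ 2)"
      using coprime_power[OF a, of r] by (simp only: coprime_commute coprime_dvd_mult_right_iff)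
  qed
  have value_unique: "(?L P div int p ^ r) mod int p ^ n = (?L P' div int p ^ r') mod int p ^ n"
    if R: "represents p m f n P r" and R': "represents p m f n P' r'" for f n P r P' r'
  proof -
    obtain l l' where l: "?L P = int p ^ r * l" and l': "?L P' = int p ^ r' * l'"
      using value_dvd[OF R] value_dvd[OF R'] by (auto elim!: dvdE)
    let ?D = "Polynomial.smult (int p ^ r') P - Polynomial.smult (int p ^ r) P'"
    have "int p ^ (r + r' + n) dvd ?L ?D"
    proof (rule L)
      fix a assume a: "coprime a (int p)"
      let ?o = "orbit p (padic_of_int p a)" and ?c = "a ^ (2 * m)"
      obtain u where u: "?c * poly P (a ^ 2) - int p ^ r * f ?o n = int p ^ (r + n) * u"
        using R a unfolding represents_def by blast
      obtain u' where u': "?c * poly P' (a ^ 2) - int p ^ r' * f ?o n = int p ^ (r' + n) * u'"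
        using R' a unfolding represents_def by blast
      have "?c * poly ?D (a ^ 2) = int p ^ r' * (?c * poly P (a ^ 2) - int p ^ r * f ?o n)
          - int p ^ r * (?c * poly P' (a ^ 2) - int p ^ r' * f ?o n)"
        by (simp add: algebra_simps)
      also have "\<dots> = int p ^ (r + r' + n) * (u - u')"
        unfolding u u' by (simp add: algebra_simps power_add)
      finally have "int p ^ (r + r' + n) dvd ?c * poly ?D (a ^ 2)" by simp
      then show "int p ^ (r + r' + n) dvd poly ?D (a ^ 2)"
        using coprime_power[OF a, of "r + r' + n"] by (simp only: coprime_commute coprime_dvd_mult_right_iff)
    qed
    also have "?L ?D = int p ^ (r + r') * (l - l')"
      by (simp add: moment_functional_diff moment_functional_smult l l' power_add algebra_simps)
    finally have "int p ^ n dvd l - l'" using p0 by (simp add: power_add)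
    then show ?thesis using p0 by (simp add: l l' mod_eq_dvd_iff)
  qed
  define val where "val f n = (SOME z. \<exists>P r. represents p m f n P r \<and> z = (?L P div int p ^ r) mod int p ^ n)" for f n
  have val: "val f n = (?L P div int p ^ r) mod int p ^ n" if "represents p m f n P r" for f n P r
  proof -
    have "\<exists>P r. represents p m f n P r \<and> val f n = (?L P div int p ^ r) mod int p ^ n"
      unfolding val_def by (rule someI_ex) (use that in blast)
    then show ?thesis using value_unique[OF that] by metis
  qed
  define \<mu> where "\<mu> = (\<lambda>f\<in>cont_functions p. val f)"
  have carrier: "val f \<in> carrier (padic_ints p)" if f: "f \<in> cont_functions p" for f
    unfolding padic_ints_carrier_iff
  proof (intro allI conjI)
    fix n
    obtain P r where R: "represents p m f (Suc n) P r" using represents_exists[OF p f] by blast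
    show "val f (Suc n) mod int p ^ n = val f n"
      unfolding val[OF R] val[OF represents_Suc[OF p f R]] by (rule mod_pow_Suc)
    show "0 \<le> val f n" "val f n < int p ^ n"
      unfolding val[OF represents_Suc[OF p f R]] using p0 by simp_all
  qed
  have orbit_T: "orbit p (padic_of_int p a) \<in> ?T" if "coprime a (int p)" for a
    using padic_of_int_Units[OF p that] by (simp add: topspace_units_mod_sign)
  have add: "\<mu> (\<lambda>c\<in>?T. f c \<oplus>\<^bsub>padic_ints p\<^esub> g c) = \<mu> f \<oplus>\<^bsub>padic_ints p\<^esub> \<mu> g"
    if f: "f \<in> cont_functions p" and g: "g \<in> cont_functions p" for f g
  proof -
    let ?h = "\<lambda>c\<in>?T. f c \<oplus>\<^bsub>padic_ints p\<^esub> g c"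
    have "?h \<in> cont_functions p" using f g by (rule cont_functions_add[OF p])
    moreover have "val ?h n = (val f n + val g n) mod int p ^ n" for n
    proof -
      obtain P r P' r' where R: "represents p m f n P r" and R': "represents p m g n P' r'"
        using represents_exists[OF p] f g by blast
      have R'': "represents p m ?h n (Polynomial.smult (int p ^ r') P + Polynomial.smult (int p ^ r) P') (r + r')"
        by (rule represents_add[OF R R']) (use orbit_T in \<open>simp add: padic_add\<close>)
      obtain l l' where l: "?L P = int p ^ r * l" and l': "?L P' = int p ^ r' * l'"
        using value_dvd[OF R] value_dvd[OF R'] by (auto elim!: dvdE)
      have "?L (Polynomial.smult (int p ^ r') P + Polynomial.smult (int p ^ r) P') = int p ^ (r + r') * (l + l')"
        by (simp add: moment_functional_add moment_functional_smult l l' power_add algebra_simps)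
      then show ?thesis
        unfolding val[OF R] val[OF R'] val[OF R''] using p0 by (simp add: l l' mod_simps)
    qed
    ultimately show ?thesis
      using f g by (simp add: \<mu>_def fun_eq_iff padic_add)
  qed
  have scale: "\<mu> (\<lambda>c\<in>?T. z \<otimes>\<^bsub>padic_ints p\<^esub> f c) = z \<otimes>\<^bsub>padic_ints p\<^esub> \<mu> f"
    if z: "z \<in> carrier (padic_ints p)" and f: "f \<in> cont_functions p" for z f
  proof -
    let ?h = "\<lambda>c\<in>?T. z \<otimes>\<^bsub>padic_ints p\<^esub> f c"
    have "?h \<in> cont_functions p" using z f by (rule cont_functions_scale[OF p])
    moreover have "val ?h n = (z n * val f n) mod int p ^ n" for n
    proof -
      obtain P r where R: "represents p m f n P r"
        using represents_exists[OF p f] by blast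
      \<comment> \<open>Modulo p^n the p-adic scalar z may be replaced by the integer
        \<open>z n\<close>.\<close>
      have R': "represents p m ?h n (Polynomial.smult (z n) P) r"
        by (rule represents_smult[OF R]) (use orbit_T in \<open>simp add: padic_mult\<close>)
      obtain l where l: "?L P = int p ^ r * l"
        using value_dvd[OF R] by (auto elim!: dvdE)
      have "?L (Polynomial.smult (z n) P) = int p ^ r * (z n * l)"
        by (simp add: moment_functional_smult l)
      then show ?thesis
        unfolding val[OF R] val[OF R'] using p0 by (simp add: l mod_simps)
    qed
    ultimately show ?thesis
      using f by (simp add: \<mu>_def fun_eq_iff padic_mult)
  qed
  have "\<mu> \<in> meas p"
    unfolding meas_def using add scale carrier by (auto simp: \<mu>_def)
  moreover have "\<mu> (power_fun p (2 * (k + m))) = padic_of_int p (y k)" for k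
  proof
    fix n
    \<comment> \<open>x^(2(k+m)) is x^(2m) times the k-th power of x^2, so the monomial represents
      it with denominator 1.\<close>
    have "represents p m (power_fun p (2 * (k + m))) n (Polynomial.monom 1 k) 0"
      unfolding represents_def
    proof (intro allI impI)
      fix a assume a: "coprime a (int p)"
      have "power_fun p (2 * (k + m)) (orbit p (padic_of_int p a)) n = a ^ (2 * (k + m)) mod int p ^ n"
        unfolding power_fun_orbit[OF p0 padic_of_int_Units[OF p a]] by (simp add: padic_of_int_def power_mod)
      moreover have "a ^ (2 * m) * poly (Polynomial.monom 1 k) (a ^ 2) = a ^ (2 * (k + m))"
        by (simp add: poly_monom algebra_simps flip: power_mult power_add)
      ultimately show "int p ^ (0 + n) dvd a ^ (2 * m) * poly (Polynomial.monom 1 k) (a ^ 2)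
          - int p ^ 0 * power_fun p (2 * (k + m)) (orbit p (padic_of_int p a)) n"
        by (simp add: dvd_minus_mod)
    qed
    from val[OF this] have "val (power_fun p (2 * (k + m))) n = y k mod int p ^ n"
      by (simp add: moment_functional_monom)
    moreover have "power_fun p (2 * (k + m)) \<in> cont_functions p"
      unfolding power_fun_eq_sq_fun[OF p0] by (rule sq_fun_cont[OF p])
    ultimately show "\<mu> (power_fun p (2 * (k + m))) n = padic_of_int p (y k) n"
      by (simp add: \<mu>_def padic_of_int_def)
  qed
  ultimately show ?thesis by blast
qed

lemma moment_functional_Q_poly:
  "moment_functional y (Q_poly p k) = y k - (\<Sum>i<k. c_coeff p k i * y i)"
  unfolding Q_poly_def moment_functional_diff moment_functional_sum moment_functional_monom by simp

lemma
  shows degree_Q_poly: "Polynomial.degree (Q_poly p k) = k"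
    and lead_coeff_Q_poly: "Polynomial.lead_coeff (Q_poly p k) = 1"
proof -
  have coef: "poly.coeff (Q_poly p k) n = (if n = k then 1 else if n < k then - c_coeff p k n else 0)" for n
    by (simp add: Q_poly_def coeff_sum)
  show deg: "Polynomial.degree (Q_poly p k) = k"
    by (rule antisym) (auto intro!: degree_le le_degree simp: coef)
  show "Polynomial.lead_coeff (Q_poly p k) = 1"
    by (simp add: deg coef)
qed

lemma meas_exists_iff:
  assumes p: "prime p"
  shows "(\<exists>\<mu>\<in>meas p. \<forall>k. \<mu> (power_fun p (2 * (k + m))) = padic_of_int p (y k)) \<longleftrightarrow>
    (\<forall>k. [y k = (\<Sum>i<k. c_coeff p k i * y i)] (mod int p ^ multiplicity p (C_coeff p k)))"
proof -
  have iff: "[y k = (\<Sum>i<k. c_coeff p k i * y i)] (mod int p ^ multiplicity p (C_coeff p k)) \<longleftrightarrow>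
      int p ^ multiplicity p (C_coeff p k) dvd moment_functional y (Q_poly p k)" for k
    by (simp add: cong_iff_dvd_diff moment_functional_Q_poly)
  show ?thesis
    unfolding iff
  proof
    assume "\<exists>\<mu>\<in>meas p. \<forall>k. \<mu> (power_fun p (2 * (k + m))) = padic_of_int p (y k)"
    then show "\<forall>k. int p ^ multiplicity p (C_coeff p k) dvd moment_functional y (Q_poly p k)"
      using moment_functional_dvd_of_meas[OF p] Q_poly_dvd[OF p] by blast
  next
    assume "\<forall>k. int p ^ multiplicity p (C_coeff p k) dvd moment_functional y (Q_poly p k)"
    then show "\<exists>\<mu>\<in>meas p. \<forall>k. \<mu> (power_fun p (2 * (k + m))) = padic_of_int p (y k)"
      using moment_functional_dvd[OF p degree_Q_poly lead_coeff_Q_poly Q_poly_dvd[OF p]]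
      by (intro meas_exists[OF p]) blast
  qed
qed

subsection \<open>The triangular system\<close>

text \<open>The value of \<open>moment_functional y (Q_poly p k)\<close> at the moments y_i = (1 -
  p^(2(i+m)-1)) \<beta>_i. It is linear in \<beta>, so the congruences can be checked column by
  column.\<close>

definition euler_defect :: "nat \<Rightarrow> nat \<Rightarrow> nat \<Rightarrow> (nat \<Rightarrow> int) \<Rightarrow> int" where
  "euler_defect m p k \<beta> = (1 - int p ^ (2 * (k + m) - 1)) * \<beta> k
     - (\<Sum>i<k. c_coeff p k i * ((1 - int p ^ (2 * (i + m) - 1)) * \<beta> i))"

lemma euler_defect_cong:
  assumes "\<And>i. i \<le> k \<Longrightarrow> \<beta> i = \<gamma> i"
  shows "euler_defect m p k \<beta> = euler_defect m p k \<gamma>"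
  unfolding euler_defect_def using assms by (intro arg_cong2[where f = minus] sum.cong) auto

lemma euler_defect_add: "euler_defect m p k (\<lambda>i. \<beta> i + \<gamma> i) = euler_defect m p k \<beta> + euler_defect m p k \<gamma>"
  by (simp add: euler_defect_def distrib_left sum.distrib)

lemma euler_defect_mult: "euler_defect m p k (\<lambda>i. \<beta> i * a) = euler_defect m p k \<beta> * a"
  by (simp add: euler_defect_def left_diff_distrib sum_distrib_right mult.assoc)

lemma euler_defect_0: "euler_defect m p k (\<lambda>i. 0) = 0"
  by (simp add: euler_defect_def)

lemma euler_defect_sum: "euler_defect m p k (\<lambda>i. \<Sum>j\<in>A. \<beta> j i) = (\<Sum>j\<in>A. euler_defect m p k (\<beta> j))"
  by (induction A rule: infinite_finite_induct) (simp_all add: euler_defect_0 euler_defect_add)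

definition euler_congruent :: "nat \<Rightarrow> (nat \<Rightarrow> int) \<Rightarrow> bool" where
  "euler_congruent m \<beta> \<longleftrightarrow> (\<forall>p k. prime p \<longrightarrow> int p ^ multiplicity p (C_coeff p k) dvd euler_defect m p k \<beta>)"

lemma mom_euler_iff:
  "b \<in> mom_euler m \<longleftrightarrow> b \<in> extensional {2 * m..} \<and> (\<forall>k\<ge>m. b (2 * k + 1) = 0) \<and>
    euler_congruent m (\<lambda>k. b (2 * (k + m)))"
proof -
  have "(\<exists>\<mu>\<in>meas p. \<forall>k\<ge>m. \<mu> (power_fun p (2 * k)) = padic_of_int p ((1 - int p ^ (2 * k - 1)) * b (2 * k))) \<longleftrightarrow>
      (\<forall>k. int p ^ multiplicity p (C_coeff p k) dvd euler_defect m p k (\<lambda>k. b (2 * (k + m))))"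
    if p: "prime p" for p
  proof -
    let ?P = "\<lambda>\<mu> k. \<mu> (power_fun p (2 * k)) = padic_of_int p ((1 - int p ^ (2 * k - 1)) * b (2 * k))"
    have "(\<forall>k\<ge>m. ?P \<mu> k) \<longleftrightarrow> (\<forall>k. ?P \<mu> (k + m))" for \<mu>
      by (metis le_add2 le_add_diff_inverse2)
    then have "(\<exists>\<mu>\<in>meas p. \<forall>k\<ge>m. ?P \<mu> k) \<longleftrightarrow> (\<exists>\<mu>\<in>meas p. \<forall>k. ?P \<mu> (k + m))" by simp
    then show ?thesis
      unfolding meas_exists_iff[OF p, where y = "\<lambda>k. (1 - int p ^ (2 * (k + m) - 1)) * b (2 * (k + m))"]
      unfolding euler_defect_def cong_iff_dvd_diff .
  qed
  then show ?thesis
    unfolding mom_euler_def euler_congruent_def by (auto simp: PiE_def Pi_def)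
qed

section \<open>The moduli and the solvability of the congruences\<close>

lemma finite_S_primes: "finite (S_primes k)"
  by (rule finite_subset[of _ "{..2 * k + 1}"]) (auto simp: S_primes_def)

lemma S_modulus_pos: "S_modulus k > 0"
  unfolding S_modulus_def by (intro prod_pos) (auto simp: S_primes_def prime_gt_0_nat)

text \<open>Here 2k < p - 1, so the factorial in \<open>multiplicity_C_coeff\<close> is 0!. Thus
  primes outside \<open>S_primes k\<close> impose no condition at index k.\<close>

lemma multiplicity_C_coeff_eq_0:
  assumes "prime p" "p \<notin> S_primes k"
  shows "multiplicity p (C_coeff p k) = 0"
  using assms multiplicity_C_coeff[of p k] by (simp add: S_primes_def)

lemma S_modulus_dvd:
  assumes "\<And>p. p \<in> S_primes k \<Longrightarrow> int p ^ multiplicity p (C_coeff p k) dvd z"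
  shows "S_modulus k dvd z"
proof -
  have "(\<Prod>p\<in>A. int p ^ multiplicity p (C_coeff p k)) dvd z" if "finite A" "A \<subseteq> S_primes k" for A
    using that
  proof (induction A)
    case (insert p A)
    have "coprime (int p) (int q)" if "q \<in> A" for q
      using insert.hyps insert.prems that by (auto simp: S_primes_def intro!: primes_coprime)
    then have "coprime (int p ^ multiplicity p (C_coeff p k)) (\<Prod>q\<in>A. int q ^ multiplicity q (C_coeff q k))"
      by (intro prod_coprime_right) (auto intro: coprime_power_left_iff[THEN iffD2] simp: coprime_power_right_iff)
    then show ?case
      using insert assms by (simp add: divides_mult)
  qed simp
  then show ?thesis unfolding S_modulus_def using finite_S_primes by blast
qed

lemma prime_power_dvd_S_modulus:
  assumes "prime p"
  shows "int p ^ multiplicity p (C_coeff p k) dvd S_modulus k"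
proof (cases "p \<in> S_primes k")
  case True
  then show ?thesis unfolding S_modulus_def using finite_S_primes by (intro dvd_prodI)
qed (simp add: multiplicity_C_coeff_eq_0[OF assms])

text \<open>By m >= 1 the exponent is positive already at k = 0, so the factor is 1 modulo p. For k
  = m = 0 the truncated exponent would be 0 and the factor would vanish.\<close>

lemma coprime_euler_factor:
  assumes "prime p" "m \<ge> 1"
  shows "coprime (1 - int p ^ (2 * (k + m) - 1)) (int p ^ v)"
proof -
  have "int p dvd int p ^ (2 * (k + m) - 1)" using assms(2) by (intro dvd_power) auto
  moreover have "\<not> int p dvd 1" using assms(1) by (simp add: prime_nat_iff)
  ultimately have "\<not> int p dvd 1 - int p ^ (2 * (k + m) - 1)"
    using dvd_diff_left_iff by metis
  then show ?thesis using coprime_int_prime_iff[OF assms(1)] by simp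
qed

text \<open>Justifies the definite description in \<open>Phi\<close>. The Euler factor is invertible
  modulo each prime power, so every congruence is solved for z separately, and the Chinese remainder
  theorem glues the solutions.\<close>

lemma ex1_Phi:
  assumes m: "m \<ge> 1"
  shows "\<exists>!z. 0 \<le> z \<and> z < S_modulus k \<and> (\<forall>p\<in>S_primes k.
    [(1 - int p ^ (2 * (k + m) - 1)) * z = u p] (mod int p ^ multiplicity p (C_coeff p k)))"
proof -
  let ?v = "\<lambda>p. multiplicity p (C_coeff p k)" and ?N = "\<lambda>p. 1 - int p ^ (2 * (k + m) - 1)"
  have pr: "prime p" if "p \<in> S_primes k" for p using that by (simp add: S_primes_def)
  have "\<exists>w. [?N p * int w = u p] (mod int p ^ ?v p)" if p: "p \<in> S_primes k" for p
  proof -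
    obtain z where z: "[?N p * z = 1] (mod int p ^ ?v p)"
      using cong_solve_coprime_int[OF coprime_euler_factor[OF pr[OF p] m]] by blast
    \<comment> \<open>Reduction makes the local solution non-negative, since the remainder theorem
      is applied to natural numbers.\<close>
    let ?z = "(z * u p) mod int p ^ ?v p"
    have "?z \<ge> 0" using prime_gt_0_nat[OF pr[OF p]] by simp
    then obtain w where w: "?z = int w" by (metis nonneg_int_cases)
    have "[?N p * z * u p = 1 * u p] (mod int p ^ ?v p)" using z by (rule cong_scalar_right)
    then have "[?N p * int w = u p] (mod int p ^ ?v p)"
      unfolding w[symmetric] by (simp add: cong_def mod_simps mult.assoc)
    then show ?thesis by blast
  qed
  then obtain w where w: "\<And>p. p \<in> S_primes k \<Longrightarrow> [?N p * int (w p) = u p] (mod int p ^ ?v p)"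
    by metis
  have "\<exists>!x. x < (\<Prod>p\<in>S_primes k. p ^ ?v p) \<and> (\<forall>p\<in>S_primes k. [x = w p] (mod p ^ ?v p))"
  proof (rule chinese_remainder_unique_nat[OF finite_S_primes])
    show "\<forall>p\<in>S_primes k. p ^ ?v p \<noteq> 0" using pr by (auto simp: prime_gt_0_nat)
    show "\<forall>p\<in>S_primes k. \<forall>q\<in>S_primes k. p \<noteq> q \<longrightarrow> coprime (p ^ ?v p) (q ^ ?v q)"
      using pr by (auto intro!: coprime_power_left_iff[THEN iffD2] primes_coprime simp: coprime_power_right_iff)
  qed
  then obtain x where x: "x < (\<Prod>p\<in>S_primes k. p ^ ?v p)" "\<And>p. p \<in> S_primes k \<Longrightarrow> [x = w p] (mod p ^ ?v p)"
    by blast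
  show ?thesis
  proof (rule ex1I[of _ "int x"])
    have "int x < int (\<Prod>p\<in>S_primes k. p ^ ?v p)" using x(1) by (simp only: of_nat_less_iff)
    then have "int x < S_modulus k" by (simp add: S_modulus_def)
    moreover have "[?N p * int x = u p] (mod int p ^ ?v p)" if p: "p \<in> S_primes k" for p
    proof -
      have "[int x = int (w p)] (mod int (p ^ ?v p))" using x(2)[OF p] by (simp only: cong_int_iff)
      then have "[?N p * int x = ?N p * int (w p)] (mod int p ^ ?v p)"
        by (simp add: cong_scalar_left)
      then show ?thesis using w[OF p] by (rule cong_trans)
    qed
    ultimately show "0 \<le> int x \<and> int x < S_modulus k \<and> (\<forall>p\<in>S_primes k. [?N p * int x = u p] (mod int p ^ ?v p))"
      by simp
    fix z assume z: "0 \<le> z \<and> z < S_modulus k \<and> (\<forall>p\<in>S_primes k. [?N p * z = u p] (mod int p ^ ?v p))"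
    have "S_modulus k dvd z - int x"
    proof (rule S_modulus_dvd)
      fix p assume p: "p \<in> S_primes k"
      then have "[?N p * z = ?N p * int x] (mod int p ^ ?v p)"
        using z \<open>\<And>p. p \<in> S_primes k \<Longrightarrow> [?N p * int x = u p] (mod int p ^ ?v p)\<close>[OF p]
        by (metis cong_sym cong_trans)
      then have "[z = int x] (mod int p ^ ?v p)"
        using coprime_euler_factor[OF pr[OF p] m] by (simp add: cong_mult_lcancel)
      then show "int p ^ ?v p dvd z - int x" by (simp add: cong_iff_dvd_diff)
    qed
    then show "z = int x"
      using z \<open>int x < S_modulus k\<close>
      by (metis cong_iff_dvd_diff cong_less_imp_eq_int of_nat_0_le_iff)
  qed
qed

section \<open>Entries and columns of the matrix\<close>

lemma Phi_odd: "Phi m (2 * k + 1) j = 0"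
  by (subst Phi.simps) simp

lemma Phi_diag: "Phi m (2 * k) k = S_modulus k"
proof (cases "k = 0")
  case True
  \<comment> \<open>The empty product 1 agrees with the separately defined row 0.\<close>
  have "S_primes 0 = {}" by (auto simp: S_primes_def dest: prime_gt_1_nat)
  then show ?thesis using True by (subst Phi.simps) (simp add: S_modulus_def)
next
  case False
  then show ?thesis by (subst Phi.simps) (simp add: Let_def)
qed

lemma Phi_upper: "j > k \<Longrightarrow> Phi m (2 * k) j = 0"
  by (rule Phi_eq_0) simp

lemma Phi_lower:
  assumes "j < k"
  shows "Phi m (2 * k) j = (THE z. 0 \<le> z \<and> z < S_modulus k \<and>
             (\<forall>p\<in>S_primes k.
                [(1 - int p ^ (2 * (k + m) - 1)) * z =
                 (\<Sum>i<k. c_coeff p k i * (1 - int p ^ (2 * (i + m) - 1)) * Phi m (2 * i) j)]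
                (mod int p ^ multiplicity p (C_coeff p k))))"
  using assms by (subst Phi.simps) (simp add: Let_def)

text \<open>Below the diagonal the congruence defines the entry. On the diagonal the earlier entries
  of the column vanish and the entry is a multiple of the prime power. Above it all terms are
  0.\<close>

lemma euler_congruent_Phi:
  assumes m: "m \<ge> 1"
  shows "euler_congruent m (\<lambda>k. Phi m (2 * k) j)"
  unfolding euler_congruent_def
proof (intro allI impI)
  fix p k :: nat assume p: "prime p"
  let ?v = "multiplicity p (C_coeff p k)"
  have zero: "(\<Sum>i<k. c_coeff p k i * ((1 - int p ^ (2 * (i + m) - 1)) * Phi m (2 * i) j)) = 0" if "j \<ge> k"
    by (rule sum.neutral) (use that in \<open>simp add: Phi_upper\<close>)
  consider "j < k" "p \<in> S_primes k" | "p \<notin> S_primes k" | "j = k" | "j > k" by linarith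
  then show "int p ^ ?v dvd euler_defect m p k (\<lambda>k. Phi m (2 * k) j)"
  proof cases
    case 1
    let ?u = "\<lambda>p. \<Sum>i<k. c_coeff p k i * (1 - int p ^ (2 * (i + m) - 1)) * Phi m (2 * i) j"
    have "[(1 - int p ^ (2 * (k + m) - 1)) * Phi m (2 * k) j = ?u p] (mod int p ^ ?v)"
      using theI'[OF ex1_Phi[OF m, of k ?u], folded Phi_lower[OF 1(1)]] 1(2) by blast
    then show ?thesis
      unfolding euler_defect_def by (simp only: cong_iff_dvd_diff mult.assoc)
  next
    case 2
    then show ?thesis by (simp add: multiplicity_C_coeff_eq_0[OF p])
  next
    case 3
    then show ?thesis
      unfolding euler_defect_def zero[OF eq_refl[OF 3[symmetric]]]
      using prime_power_dvd_S_modulus[OF p, of k] by (simp add: Phi_diag)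
  next
    case 4
    then show ?thesis
      unfolding euler_defect_def zero[OF less_imp_le[OF 4]] by (simp add: Phi_upper)
  qed
qed

text \<open>The bound d is free so that all rows up to a given one can be summed over one common
  range of columns.\<close>

lemma Phi_map_even:
  assumes "k < d"
  shows "Phi_map m l (2 * (k + m)) = (\<Sum>j<d. Phi m (2 * k) j * l j)"
proof -
  have "Sum_any (\<lambda>j. Phi m (2 * k) j * l j) = (\<Sum>j<d. Phi m (2 * k) j * l j)"
  proof (rule Sum_any.expand_superset)
    show "{j. Phi m (2 * k) j * l j \<noteq> 0} \<subseteq> {..<d}"
      using assms Phi_upper[of k _ m] by (force simp: not_less)
  qed simp
  moreover have "2 * (k + m) - 2 * m = 2 * k" by simp
  ultimately show ?thesis by (simp add: Phi_map_def)
qed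

lemma Phi_map_odd:
  assumes "k \<ge> m"
  shows "Phi_map m l (2 * k + 1) = 0"
proof -
  have "2 * k + 1 - 2 * m = 2 * (k - m) + 1" using assms by simp
  then have "Phi_map m l (2 * k + 1) = Sum_any (\<lambda>j. Phi m (2 * (k - m) + 1) j * l j)"
    using assms by (simp add: Phi_map_def)
  then show ?thesis by (simp only: Phi_odd mult_zero_left Sum_any.neutral)
qed

lemma Phi_map_mom_euler:
  assumes "m \<ge> 1"
  shows "Phi_map m l \<in> mom_euler m"
  unfolding mom_euler_iff
proof (intro conjI allI impI)
  show "Phi_map m l \<in> extensional {2 * m..}" by (simp add: Phi_map_def)
  show "k \<ge> m \<Longrightarrow> Phi_map m l (2 * k + 1) = 0" for k by (rule Phi_map_odd)
  show "euler_congruent m (\<lambda>k. Phi_map m l (2 * (k + m)))"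
    unfolding euler_congruent_def
  proof (intro allI impI)
    fix p k :: nat assume p: "prime p"
    have "euler_defect m p k (\<lambda>k. Phi_map m l (2 * (k + m)))
        = euler_defect m p k (\<lambda>i. \<Sum>j<Suc k. Phi m (2 * i) j * l j)"
      by (intro euler_defect_cong Phi_map_even) simp
    also have "\<dots> = (\<Sum>j<Suc k. euler_defect m p k (\<lambda>i. Phi m (2 * i) j) * l j)"
      unfolding euler_defect_sum euler_defect_mult ..
    finally show "int p ^ multiplicity p (C_coeff p k) dvd euler_defect m p k (\<lambda>k. Phi_map m l (2 * (k + m)))"
      using euler_congruent_Phi[OF assms] p unfolding euler_congruent_def
      by (simp only:) (intro dvd_sum dvd_mult2, blast)
  qed
qed

lemma mom_euler_ext:
  assumes "b \<in> mom_euler m" "b' \<in> mom_euler m" "\<And>k. b (2 * (k + m)) = b' (2 * (k + m))"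
  shows "b = b'"
proof (rule extensionalityI)
  show "b \<in> extensional {2 * m..}" "b' \<in> extensional {2 * m..}"
    using assms(1,2) by (simp_all add: mom_euler_iff)
  fix n assume n: "n \<in> {2 * m..}"
  show "b n = b' n"
  proof (cases "even n")
    case True
    then have "n = 2 * ((n div 2 - m) + m)" using n by auto
    then show ?thesis using assms(3) by metis
  next
    case False
    then obtain k where k: "n = 2 * k + 1" by (rule oddE)
    then have "k \<ge> m" using n by simp
    then show ?thesis using assms(1,2) k by (simp add: mom_euler_iff)
  qed
qed

lemma inj_Phi_map: "inj (Phi_map m)"
proof (rule injI)
  fix l l' assume eq: "Phi_map m l = Phi_map m l'"
  have "l k = l' k" for k
  proof (induction k rule: less_induct)
    case (less k)
    have "(\<Sum>j<Suc k. Phi m (2 * k) j * l j) = (\<Sum>j<Suc k. Phi m (2 * k) j * l' j)"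
      using fun_cong[OF eq, of "2 * (k + m)"] unfolding Phi_map_even[OF lessI] .
    moreover have "(\<Sum>j<k. Phi m (2 * k) j * l j) = (\<Sum>j<k. Phi m (2 * k) j * l' j)"
      using less by (intro sum.cong) auto
    ultimately show ?case using S_modulus_pos[of k] by (simp add: Phi_diag)
  qed
  then show "l = l'" ..
qed

text \<open>Forward substitution in the triangular system. The division is exact when
  \<open>euler_congruent m \<beta>\<close> holds, which is the content of the lemma
  \<open>Phi_solve\<close>.\<close>

fun Phi_solve :: "nat \<Rightarrow> (nat \<Rightarrow> int) \<Rightarrow> nat \<Rightarrow> int" where
  "Phi_solve m \<beta> k = (\<beta> k - (\<Sum>j<k. Phi m (2 * k) j * Phi_solve m \<beta> j)) div S_modulus k"

declare Phi_solve.simps [simp del]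

text \<open>The columns before k combine to \<gamma>, which agrees with \<beta> below index k. In
  the difference of the two defects at k the earlier terms cancel, leaving the Euler factor times
  \<beta>_k - \<gamma>_k. That factor is prime to p, so the diagonal entry divides \<beta>_k -
  \<gamma>_k.\<close>

lemma Phi_solve:
  assumes m: "m \<ge> 1" and \<beta>: "euler_congruent m \<beta>"
  shows "(\<Sum>j<Suc k. Phi m (2 * k) j * Phi_solve m \<beta> j) = \<beta> k"
proof (induction k rule: less_induct)
  case (less k)
  let ?l = "Phi_solve m \<beta>"
  define \<gamma> where "\<gamma> i = (\<Sum>j<k. Phi m (2 * i) j * ?l j)" for i
  have \<gamma>_eq: "\<gamma> i = \<beta> i" if "i < k" for i
  proof -
    have "\<gamma> i = (\<Sum>j<Suc i. Phi m (2 * i) j * ?l j)"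
      unfolding \<gamma>_def by (rule sum.mono_neutral_right) (use that in \<open>auto simp: Phi_upper\<close>)
    then show ?thesis using less[OF that] by simp
  qed
  have "S_modulus k dvd \<beta> k - \<gamma> k"
  proof (rule S_modulus_dvd)
    fix p assume "p \<in> S_primes k"
    then have p: "prime p" by (simp add: S_primes_def)
    let ?v = "multiplicity p (C_coeff p k)"
    have "euler_defect m p k \<gamma> = (\<Sum>j<k. euler_defect m p k (\<lambda>i. Phi m (2 * i) j) * ?l j)"
      unfolding \<gamma>_def euler_defect_sum euler_defect_mult ..
    then have "int p ^ ?v dvd euler_defect m p k \<gamma>"
      using euler_congruent_Phi[OF m] p unfolding euler_congruent_def
      by (simp only:) (intro dvd_sum dvd_mult2, blast)
    moreover have "int p ^ ?v dvd euler_defect m p k \<beta>"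
      using \<beta> p by (simp add: euler_congruent_def)
    ultimately have "int p ^ ?v dvd euler_defect m p k \<beta> - euler_defect m p k \<gamma>" by simp
    also have "euler_defect m p k \<beta> - euler_defect m p k \<gamma> = (1 - int p ^ (2 * (k + m) - 1)) * (\<beta> k - \<gamma> k)"
      unfolding euler_defect_def by (simp add: \<gamma>_eq algebra_simps)
    finally show "int p ^ ?v dvd \<beta> k - \<gamma> k"
      using coprime_euler_factor[OF p m, of k ?v]
      by (simp only: coprime_commute coprime_dvd_mult_right_iff)
  qed
  moreover have "?l k = (\<beta> k - \<gamma> k) div S_modulus k"
    unfolding \<gamma>_def by (rule Phi_solve.simps)
  ultimately have "S_modulus k * ?l k = \<beta> k - \<gamma> k" by simp
  then show ?case by (simp add: Phi_diag \<gamma>_def)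
qed

lemma subgroup_mom_euler: "subgroup (mom_euler m) (seq_group {2 * m..})"
proof (rule subgroup.intro)
  show "mom_euler m \<subseteq> carrier (seq_group {2 * m..})"
    by (auto simp: mom_euler_def)
  show "\<one>\<^bsub>seq_group {2 * m..}\<^esub> \<in> mom_euler m"
    by (auto simp: mom_euler_iff euler_congruent_def euler_defect_0)
  fix b assume b: "b \<in> mom_euler m"
  have "inv\<^bsub>seq_group {2 * m..}\<^esub> b = (\<lambda>k\<in>{2 * m..}. - b k)"
    using b by (subst inv_product_group) (auto simp: mom_euler_def)
  moreover have "euler_defect m p k (\<lambda>k. - b (2 * (k + m))) = - euler_defect m p k (\<lambda>k. b (2 * (k + m)))" for p k
    using euler_defect_mult[of m p k "\<lambda>k. b (2 * (k + m))" "-1"] by simp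
  ultimately show "inv\<^bsub>seq_group {2 * m..}\<^esub> b \<in> mom_euler m"
    using b by (auto simp: mom_euler_iff euler_congruent_def)
  fix b' assume b': "b' \<in> mom_euler m"
  show "b \<otimes>\<^bsub>seq_group {2 * m..}\<^esub> b' \<in> mom_euler m"
    using b b' by (auto simp: mom_euler_iff euler_congruent_def euler_defect_add)
qed

theorem theorem2p4p4:
  fixes m :: nat
  assumes "m \<ge> 1"
  shows "subgroup (mom_euler m) (seq_group {2 * m..}) \<and>
    Phi_map m \<in> iso (seq_group UNIV) ((seq_group {2 * m..})\<lparr>carrier := mom_euler m\<rparr>)"
proof
  show "Phi_map m \<in> iso (seq_group UNIV) ((seq_group {2 * m..})\<lparr>carrier := mom_euler m\<rparr>)"
  proof (rule isoI)
    show "Phi_map m \<in> hom (seq_group UNIV) ((seq_group {2 * m..})\<lparr>carrier := mom_euler m\<rparr>)"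
    proof (rule homI)
      fix l l' :: "nat \<Rightarrow> int"
      show "Phi_map m l \<in> carrier ((seq_group {2 * m..})\<lparr>carrier := mom_euler m\<rparr>)"
        using Phi_map_mom_euler[OF assms] by simp
      have "Phi_map m (\<lambda>i. l i + l' i) = (\<lambda>i\<in>{2 * m..}. Phi_map m l i + Phi_map m l' i)"
      \<comment> \<open>Both sides are moment sequences, so only the entries of even index have to
        be compared.\<close>
      proof (rule mom_euler_ext[OF Phi_map_mom_euler[OF assms]])
        show "(\<lambda>i\<in>{2 * m..}. Phi_map m l i + Phi_map m l' i) \<in> mom_euler m"
          using subgroup.m_closed[OF subgroup_mom_euler Phi_map_mom_euler[OF assms] Phi_map_mom_euler[OF assms]]
          by simp
        show "Phi_map m (\<lambda>i. l i + l' i) (2 * (k + m))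
            = (\<lambda>i\<in>{2 * m..}. Phi_map m l i + Phi_map m l' i) (2 * (k + m))" for k
        proof -
          have k: "2 * (k + m) \<in> {2 * m..}" by simp
          show ?thesis
            unfolding restrict_apply'[OF k] Phi_map_even[OF lessI] by (simp only: distrib_left sum.distrib)
        qed
      qed
      then show "Phi_map m (l \<otimes>\<^bsub>seq_group UNIV\<^esub> l')
          = Phi_map m l \<otimes>\<^bsub>(seq_group {2 * m..})\<lparr>carrier := mom_euler m\<rparr>\<^esub> Phi_map m l'"
        by (simp add: restrict_def)
    qed
    have "b \<in> range (Phi_map m)" if b: "b \<in> mom_euler m" for b
    proof (rule range_eqI, rule mom_euler_ext[OF b Phi_map_mom_euler[OF assms]])
      show "b (2 * (k + m)) = Phi_map m (Phi_solve m (\<lambda>k. b (2 * (k + m)))) (2 * (k + m))" for k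
        unfolding Phi_map_even[OF lessI] using b by (subst Phi_solve[OF assms]) (auto simp: mom_euler_iff)
    qed
    then show "bij_betw (Phi_map m) (carrier (seq_group UNIV)) (carrier ((seq_group {2 * m..})\<lparr>carrier := mom_euler m\<rparr>))"
      using inj_Phi_map[of m] Phi_map_mom_euler[OF assms] by (auto simp: bij_betw_def)
  qed
qed (rule subgroup_mom_euler)

end
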